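(* Let $H$ be a graph each of whose connected components is either $3$-color-critical or bipartite. Then $f(H,P_5)=R_3(H)$.
   Context: A graph is $3$-color-critical if it has chromatic number $3$ and has an edge whose removal reduces the chromatic number to $2$. $P_5$ is the path on $5$ vertices. Monochromatic: all edges same color; rainbow: all edges distinct colors. $f(H,G)$ is the minimum $n$ such that every edge-coloring of $K_n$ with any number of colors contains a monochromatic copy of $H$ or a rainbow copy of $G$. $R_3(H)$ is the minimum $n$ such that every coloring of $E(K_n)$ with colors from $\{1,2,3\}$ (not all need be used) contains a monochromatic $H$. *)

theory Defs
  imports "HOL-Library.Extended_Nat"
begin

type_synonym 'a ugraph = "'a set \<times> 'a set set"

abbreviation verts :: "'a ugraph \<Rightarrow> 'a set" where "verts G \<equiv> fst G"
abbreviation edges :: "'a ugraph \<Rightarrow> 'a set set" where "edges G \<equiv> snd G"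

definition simple_graph :: "'a ugraph \<Rightarrow> bool" where
  "simple_graph G \<longleftrightarrow> finite (verts G) \<and> (\<forall>e\<in>edges G. e \<subseteq> verts G \<and> card e = 2)"

definition complete_graph :: "nat \<Rightarrow> nat ugraph" where
  "complete_graph n = ({..<n}, {e. e \<subseteq> {..<n} \<and> card e = 2})"

text \<open>The index of a path graph counts its vertices.\<close>

definition path_graph :: "nat \<Rightarrow> nat ugraph" where
  "path_graph n = ({..<n}, {{i, Suc i} | i. Suc i < n})"

definition reachable :: "'a ugraph \<Rightarrow> 'a \<Rightarrow> 'a \<Rightarrow> bool" where
  "reachable G = (\<lambda>u v. {u, v} \<in> edges G)\<^sup>*\<^sup>*"

definition induced_subgraph :: "'a ugraph \<Rightarrow> 'a set \<Rightarrow> 'a ugraph" where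
  "induced_subgraph G W = (W, {e \<in> edges G. e \<subseteq> W})"

definition components :: "'a ugraph \<Rightarrow> 'a ugraph set" where
  "components G = {induced_subgraph G {w \<in> verts G. reachable G v w} | v. v \<in> verts G}"

definition colorable :: "'a ugraph \<Rightarrow> nat \<Rightarrow> bool" where
  "colorable G k \<longleftrightarrow>
     (\<exists>c :: 'a \<Rightarrow> nat. (\<forall>v\<in>verts G. c v < k) \<and> (\<forall>u v. {u, v} \<in> edges G \<longrightarrow> c u \<noteq> c v))"

definition chromatic_number :: "'a ugraph \<Rightarrow> nat" where
  "chromatic_number G = (LEAST k. colorable G k)"

definition delete_edge :: "'a ugraph \<Rightarrow> 'a set \<Rightarrow> 'a ugraph" where
  "delete_edge G e = (verts G, edges G - {e})"

definition three_color_critical :: "'a ugraph \<Rightarrow> bool" where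
  "three_color_critical G \<longleftrightarrow>
     chromatic_number G = 3 \<and> (\<exists>e\<in>edges G. chromatic_number (delete_edge G e) = 2)"

text \<open>The parts may be empty, so a single vertex is bipartite.\<close>

definition bipartite :: "'a ugraph \<Rightarrow> bool" where
  "bipartite G \<longleftrightarrow>
     (\<exists>A B. A \<inter> B = {} \<and> A \<union> B = verts G \<and> (\<forall>e\<in>edges G. \<exists>a\<in>A. \<exists>b\<in>B. e = {a, b}))"

definition monochromatic :: "('a set \<Rightarrow> 'c) \<Rightarrow> 'a ugraph \<Rightarrow> bool" where
  "monochromatic c G \<longleftrightarrow> (\<forall>e\<in>edges G. \<forall>e'\<in>edges G. c e = c e')"

definition rainbow :: "('a set \<Rightarrow> 'c) \<Rightarrow> 'a ugraph \<Rightarrow> bool" where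
  "rainbow c G \<longleftrightarrow> inj_on c (edges G)"

definition is_copy_in :: "'b ugraph \<Rightarrow> 'a ugraph \<Rightarrow> 'b ugraph \<Rightarrow> bool" where
  "is_copy_in F H K \<longleftrightarrow>
     (\<exists>\<phi>. inj_on \<phi> (verts H) \<and> verts F = \<phi> ` verts H \<and> edges F = (\<lambda>e. \<phi> ` e) ` edges H) \<and>
     verts F \<subseteq> verts K \<and> edges F \<subseteq> edges K"

text \<open>
  Edge colorings are total functions of which only the values on the edges of the complete
  graph matter; these edges are finite in number, so natural numbers provide enough colors
  for an arbitrary number of them. The minima are taken in the extended naturals, with value
  \<open>\<infinity>\<close> if no suitable \<open>n\<close> exists.
\<close>

definition mono_rainbow_number :: "'a ugraph \<Rightarrow> 'b ugraph \<Rightarrow> enat" where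
  "mono_rainbow_number H G = Inf {enat n | n. \<forall>c :: nat set \<Rightarrow> nat.
     (\<exists>F. is_copy_in F H (complete_graph n) \<and> monochromatic c F) \<or>
     (\<exists>F. is_copy_in F G (complete_graph n) \<and> rainbow c F)}"

definition ramsey3 :: "'a ugraph \<Rightarrow> enat" where
  "ramsey3 H = Inf {enat n | n. \<forall>c :: nat set \<Rightarrow> nat.
     c ` edges (complete_graph n) \<subseteq> {1, 2, 3} \<longrightarrow>
     (\<exists>F. is_copy_in F H (complete_graph n) \<and> monochromatic c F)}"

end

theory Submission
  imports Defs
begin

text \<open>
  A coloring with colors \<open>1, 2, 3\<close> contains no rainbow \<open>P\<^sub>5\<close>, so only one inequality needs work:
  if every 3-coloring of \<open>K\<^sub>n\<close> contains a monochromatic \<open>H\<close>, then so does every coloring \<open>c\<close> of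
  \<open>K\<^sub>n\<close> without a rainbow \<open>P\<^sub>5\<close>. For \<open>n \<ge> 6\<close> such a coloring uses at most three colors, or all its
  edges that avoid some vertex and one further edge have the same color, or all edges not contained
  in some set of four vertices do, or it has a dominant color \<open>k\<close>: the edges of the other colors
  span pairwise disjoint vertex sets.

  The first three cases are settled by simple recolorings. If \<open>k\<close> is dominant, let \<open>h\<close> be the number of
  non-isolated vertices of \<open>H\<close> and \<open>t\<close> the number of its non-bipartite components, each of which is a
  bipartite graph plus one edge inside a side. Explicit 3-colorings give \<open>n \<ge> 2h + t - 2\<close> and
  \<open>n \<ge> 4s - 3\<close> for every non-bipartite component with \<open>s\<close> vertices. If the color classes can be
  grouped into two sets of at least \<open>h - 1\<close> vertices, all edges between them have color \<open>k\<close>, and a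
  further recoloring yields \<open>t\<close> disjoint edges of color \<open>k\<close> inside the two sets that accommodate the
  extra edges. Otherwise the classes form three groups of fewer than \<open>h - 1\<close> vertices, and \<open>H\<close> has a
  proper 3-coloring fitting into them.
\<close>

section \<open>Colorings of complete graphs without a rainbow path on five vertices\<close>

text \<open>A statement about three colors has to control colorings with many. It can be applied to
  colorings fixed in advance, which bounds \<open>n\<close> from below, or to a recoloring of
  \<open>c\<close> that merges colors. The obstacle is that a copy of \<open>H\<close> in a merged
  color need not be monochromatic in \<open>c\<close>; all it shows is that some union of classes
  has at least \<open>h\<close> vertices. The sizes \<open>h - 1\<close> reflect the extremal
  coloring: two blocks of \<open>h - 1\<close> vertices cannot contain \<open>H\<close>, the edges
  across are bipartite, and each further vertex can serve only one non-bipartite component.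
  Criticality enters through a single edge per component: two sets of at least \<open>h - 1\<close>
  vertices joined completely in color \<open>k\<close> hold \<open>H\<close> as soon as every
  non-bipartite component finds one more edge of color \<open>k\<close> inside a set. The structure
  of \<open>c\<close> is read off from rainbow graphs with four edges. A triangle, or a path or star
  with three edges, together with a disjoint edge of a fourth color already determines almost all
  other edges; if none of these occurs, a fourth color completes every rainbow triangle, star or
  path with three edges to an excluded graph.\<close>

locale rainbow_P5_free =
  fixes V :: "'v set" and col :: "'v \<Rightarrow> 'v \<Rightarrow> 'c"
  assumes col_commute: "col x y = col y x"
    and no_rainbow_P5: "\<lbrakk>distinct [v, w, x, y, z]; {v, w, x, y, z} \<subseteq> V\<rbrakk>
      \<Longrightarrow> \<not> distinct [col v w, col w x, col x y, col y z]"
begin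

section \<open>Rainbow graphs with four edges on at most six vertices\<close>

definition rainbow_P4_K2 :: "'v \<Rightarrow> 'v \<Rightarrow> 'v \<Rightarrow> 'v \<Rightarrow> 'v \<Rightarrow> 'v \<Rightarrow> bool" where
  "rainbow_P4_K2 a b c d e f \<longleftrightarrow> distinct [a, b, c, d, e, f] \<and> {a, b, c, d, e, f} \<subseteq> V \<and>
     distinct [col a b, col b c, col c d, col e f]"

definition rainbow_K13_K2 :: "'v \<Rightarrow> 'v \<Rightarrow> 'v \<Rightarrow> 'v \<Rightarrow> 'v \<Rightarrow> 'v \<Rightarrow> bool" where
  "rainbow_K13_K2 a b c d e f \<longleftrightarrow> distinct [a, b, c, d, e, f] \<and> {a, b, c, d, e, f} \<subseteq> V \<and>
     distinct [col a b, col a c, col a d, col e f]"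

definition rainbow_K3_K2 :: "'v \<Rightarrow> 'v \<Rightarrow> 'v \<Rightarrow> 'v \<Rightarrow> 'v \<Rightarrow> bool" where
  "rainbow_K3_K2 a b c d e \<longleftrightarrow> distinct [a, b, c, d, e] \<and> {a, b, c, d, e} \<subseteq> V \<and>
     distinct [col a b, col b c, col a c, col d e]"

lemma no_rainbow_P5':
  assumes "distinct [v, w, x, y, z]" "{v, w, x, y, z} \<subseteq> V"
  shows "col v w = col w x \<or> col v w = col x y \<or> col v w = col y z \<or>
    col w x = col x y \<or> col w x = col y z \<or> col x y = col y z"
  using no_rainbow_P5[OF assms] by auto

text \<open>
  In each of the following statements on six vertices, the listed rainbow-free subgraphs leave no
  consistent choice of colors; the selections were found by a computer search.
\<close>

lemma rainbow_P4_K2_ac: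
  assumes "rainbow_P4_K2 a b c d e f"
  shows "col a c = col b c"
proof -
  have V: "distinct [a, b, c, d, e, f]" "{a, b, c, d, e, f} \<subseteq> V"
    using assms by (auto simp: rainbow_P4_K2_def rainbow_K13_K2_def rainbow_K3_K2_def)
  note paths = no_rainbow_P5'[of a b c d e]
    no_rainbow_P5'[of a b c d f]
    no_rainbow_P5'[of a b c f d]
    no_rainbow_P5'[of a b c f e]
    no_rainbow_P5'[of a c d e f]
    no_rainbow_P5'[of a c d f e]
    no_rainbow_P5'[of a c f d e]
    no_rainbow_P5'[of a c f e d]
    no_rainbow_P5'[of b a c d f]
    no_rainbow_P5'[of b a c f d]
    no_rainbow_P5'[of b a c f e]
    no_rainbow_P5'[of b c d e f]
    no_rainbow_P5'[of b c d f e]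
    no_rainbow_P5'[of b c f e d]
  \<comment> \<open>All fifteen pairs are oriented alphabetically, which leaves a quantifier-free
    problem about equality of fifteen colors.\<close>
  note commute = col_commute[of b a] col_commute[of c a] col_commute[of d a] col_commute[of e a] col_commute[of f a]
    col_commute[of c b] col_commute[of d b] col_commute[of e b] col_commute[of f b] col_commute[of d c]
    col_commute[of e c] col_commute[of f c] col_commute[of e d] col_commute[of f d] col_commute[of f e]
  show ?thesis
    using assms(1) paths V unfolding rainbow_P4_K2_def rainbow_K13_K2_def rainbow_K3_K2_def commute
    by simp (smt (verit))
qed

lemma rainbow_P4_K2_ad:
  assumes "rainbow_P4_K2 a b c d e f"
  shows "col a d = col b c"
proof -
  have V: "distinct [a, b, c, d, e, f]" "{a, b, c, d, e, f} \<subseteq> V"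
    using assms by (auto simp: rainbow_P4_K2_def rainbow_K13_K2_def rainbow_K3_K2_def)
  note paths = no_rainbow_P5'[of a b c d e]
    no_rainbow_P5'[of a b c d f]
    no_rainbow_P5'[of a b e d c]
    no_rainbow_P5'[of a b e f d]
    no_rainbow_P5'[of a c b e f]
    no_rainbow_P5'[of a e b c d]
    no_rainbow_P5'[of a e f d c]
    no_rainbow_P5'[of b a d f e]
    no_rainbow_P5'[of b a e f d]
    no_rainbow_P5'[of b c a e d]
    no_rainbow_P5'[of b c a e f]
    no_rainbow_P5'[of b c d e f]
    no_rainbow_P5'[of b c d f e]
    no_rainbow_P5'[of c a b e d]
    no_rainbow_P5'[of c b a d e]
    no_rainbow_P5'[of c b a e f]
    no_rainbow_P5'[of c d a b e]
    no_rainbow_P5'[of c d a e f]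
    no_rainbow_P5'[of d c a e f]
    no_rainbow_P5'[of d c b a e]
    no_rainbow_P5'[of d c b e f]
  note commute = col_commute[of b a] col_commute[of c a] col_commute[of d a] col_commute[of e a] col_commute[of f a]
    col_commute[of c b] col_commute[of d b] col_commute[of e b] col_commute[of f b] col_commute[of d c]
    col_commute[of e c] col_commute[of f c] col_commute[of e d] col_commute[of f d] col_commute[of f e]
  show ?thesis
    using assms(1) paths V unfolding rainbow_P4_K2_def rainbow_K13_K2_def rainbow_K3_K2_def commute
    by simp (smt (verit))
qed

lemma rainbow_P4_K2_ae:
  assumes "rainbow_P4_K2 a b c d e f"
  shows "col a e = col b c"
proof -
  have V: "distinct [a, b, c, d, e, f]" "{a, b, c, d, e, f} \<subseteq> V"
    using assms by (auto simp: rainbow_P4_K2_def rainbow_K13_K2_def rainbow_K3_K2_def)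
  note paths = no_rainbow_P5'[of a b c d f]
    no_rainbow_P5'[of a b c f d]
    no_rainbow_P5'[of a e f c b]
    no_rainbow_P5'[of a e f c d]
    no_rainbow_P5'[of a e f d b]
    no_rainbow_P5'[of a e f d c]
    no_rainbow_P5'[of a f d b c]
    no_rainbow_P5'[of b c d f e]
    no_rainbow_P5'[of c b a e f]
    no_rainbow_P5'[of c b a f d]
    no_rainbow_P5'[of c b a f e]
    no_rainbow_P5'[of c b d f e]
    no_rainbow_P5'[of c d b a f]
    no_rainbow_P5'[of d b c f e]
    no_rainbow_P5'[of d c b a e]
  note commute = col_commute[of b a] col_commute[of c a] col_commute[of d a] col_commute[of e a] col_commute[of f a]
    col_commute[of c b] col_commute[of d b] col_commute[of e b] col_commute[of f b] col_commute[of d c]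
    col_commute[of e c] col_commute[of f c] col_commute[of e d] col_commute[of f d] col_commute[of f e]
  show ?thesis
    using assms(1) paths V unfolding rainbow_P4_K2_def rainbow_K13_K2_def rainbow_K3_K2_def commute
    by simp (smt (verit))
qed

lemma rainbow_P4_K2_be:
  assumes "rainbow_P4_K2 a b c d e f"
  shows "col b e = col b c"
proof -
  have V: "distinct [a, b, c, d, e, f]" "{a, b, c, d, e, f} \<subseteq> V"
    using assms by (auto simp: rainbow_P4_K2_def rainbow_K13_K2_def rainbow_K3_K2_def)
  note paths = no_rainbow_P5'[of a b c d e]
    no_rainbow_P5'[of a b c d f]
    no_rainbow_P5'[of a b e d c]
    no_rainbow_P5'[of a b e d f]
    no_rainbow_P5'[of a b e f d]
    no_rainbow_P5'[of a c b e f]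
    no_rainbow_P5'[of a e b c d]
    no_rainbow_P5'[of b a e f d]
    no_rainbow_P5'[of b c a e d]
    no_rainbow_P5'[of b c a e f]
    no_rainbow_P5'[of b c d e f]
    no_rainbow_P5'[of b c d f e]
    no_rainbow_P5'[of c a b e d]
    no_rainbow_P5'[of c a b e f]
    no_rainbow_P5'[of c b a e f]
    no_rainbow_P5'[of d c b a e]
    no_rainbow_P5'[of d c b e f]
  note commute = col_commute[of b a] col_commute[of c a] col_commute[of d a] col_commute[of e a] col_commute[of f a]
    col_commute[of c b] col_commute[of d b] col_commute[of e b] col_commute[of f b] col_commute[of d c]
    col_commute[of e c] col_commute[of f c] col_commute[of e d] col_commute[of f d] col_commute[of f e]
  show ?thesis
    using assms(1) paths V unfolding rainbow_P4_K2_def rainbow_K13_K2_def rainbow_K3_K2_def commute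
    by simp (smt (verit))
qed

lemma rainbow_K13_K2_be:
  assumes "rainbow_K13_K2 a b c d e f"
  shows "col b e = col e f"
proof -
  have V: "distinct [a, b, c, d, e, f]" "{a, b, c, d, e, f} \<subseteq> V"
    using assms by (auto simp: rainbow_P4_K2_def rainbow_K13_K2_def rainbow_K3_K2_def)
  note paths = no_rainbow_P5'[of a f d e b]
    no_rainbow_P5'[of b a c e d]
    no_rainbow_P5'[of b a d e f]
    no_rainbow_P5'[of b a f e d]
    no_rainbow_P5'[of b c a d f]
    no_rainbow_P5'[of b c e f d]
    no_rainbow_P5'[of b e c a f]
    no_rainbow_P5'[of b e d a c]
    no_rainbow_P5'[of b e f a c]
    no_rainbow_P5'[of c a b e f]
    no_rainbow_P5'[of c a d e f]
    no_rainbow_P5'[of c a f d e]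
    no_rainbow_P5'[of c a f e d]
    no_rainbow_P5'[of c b e d f]
    no_rainbow_P5'[of c b e f d]
    no_rainbow_P5'[of d a b c e]
    no_rainbow_P5'[of d a b e f]
    no_rainbow_P5'[of d a c e f]
    no_rainbow_P5'[of e c b a f]
  note commute = col_commute[of b a] col_commute[of c a] col_commute[of d a] col_commute[of e a] col_commute[of f a]
    col_commute[of c b] col_commute[of d b] col_commute[of e b] col_commute[of f b] col_commute[of d c]
    col_commute[of e c] col_commute[of f c] col_commute[of e d] col_commute[of f d] col_commute[of f e]
  show ?thesis
    using assms(1) paths V unfolding rainbow_P4_K2_def rainbow_K13_K2_def rainbow_K3_K2_def commute
    by simp (smt (verit))
qed

lemma rainbow_K3_K2_df:
  assumes "rainbow_K3_K2 a b c d e" and "f \<in> V" and "f \<notin> {a, b, c, d, e}"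
    and noP4: "\<And>u v w x y z. \<not> rainbow_P4_K2 u v w x y z"
    and noK13: "\<And>u v w x y z. \<not> rainbow_K13_K2 u v w x y z"
  shows "col d f = col d e"
proof -
  have V: "distinct [a, b, c, d, e, f]" "{a, b, c, d, e, f} \<subseteq> V"
    using assms by (auto simp: rainbow_P4_K2_def rainbow_K13_K2_def rainbow_K3_K2_def)
  note paths = no_rainbow_P5'[of a b c f d]
    no_rainbow_P5'[of b a c f d]
    no_rainbow_P5'[of b c a e d]
    no_rainbow_P5'[of d f c a e]
    no_rainbow_P5'[of e a b c f]
    noK13[of c a b f d e]
    noP4[of a b c f d e]
    noP4[of b a c f d e]
    noP4[of b c a e d f]
  note commute = col_commute[of b a] col_commute[of c a] col_commute[of d a] col_commute[of e a] col_commute[of f a]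
    col_commute[of c b] col_commute[of d b] col_commute[of e b] col_commute[of f b] col_commute[of d c]
    col_commute[of e c] col_commute[of f c] col_commute[of e d] col_commute[of f d] col_commute[of f e]
  show ?thesis
    using assms(1) paths V unfolding rainbow_P4_K2_def rainbow_K13_K2_def rainbow_K3_K2_def commute
    by simp (smt (verit))
qed

lemma rainbow_K3_K2_ad:
  assumes "rainbow_K3_K2 a b c d e" and "f \<in> V" and "f \<notin> {a, b, c, d, e}"
    and noP4: "\<And>u v w x y z. \<not> rainbow_P4_K2 u v w x y z"
    and noK13: "\<And>u v w x y z. \<not> rainbow_K13_K2 u v w x y z"
  shows "col a d = col d e"
proof -
  have V: "distinct [a, b, c, d, e, f]" "{a, b, c, d, e, f} \<subseteq> V"
    using assms by (auto simp: rainbow_P4_K2_def rainbow_K13_K2_def rainbow_K3_K2_def)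
  note paths = no_rainbow_P5'[of a b c d e]
    no_rainbow_P5'[of a c d e f]
    no_rainbow_P5'[of b a c d e]
    no_rainbow_P5'[of b a d e f]
    no_rainbow_P5'[of b c a d e]
    no_rainbow_P5'[of c a d e f]
    no_rainbow_P5'[of c b a d e]
    noK13[of a b c d e f]
    noP4[of b a c d e f]
  note commute = col_commute[of b a] col_commute[of c a] col_commute[of d a] col_commute[of e a] col_commute[of f a]
    col_commute[of c b] col_commute[of d b] col_commute[of e b] col_commute[of f b] col_commute[of d c]
    col_commute[of e c] col_commute[of f c] col_commute[of e d] col_commute[of f d] col_commute[of f e]
  show ?thesis
    using assms(1) paths V unfolding rainbow_P4_K2_def rainbow_K13_K2_def rainbow_K3_K2_def commute
    by simp (smt (verit))
qed

lemma no_rainbow_paw: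
  assumes "distinct [a, b, c, d, e, f]" and "{a, b, c, d, e, f} \<subseteq> V"
    and noP4: "\<And>u v w x y z. \<not> rainbow_P4_K2 u v w x y z"
    and noK13: "\<And>u v w x y z. \<not> rainbow_K13_K2 u v w x y z"
    and noK3: "\<And>u v w x y. \<not> rainbow_K3_K2 u v w x y"
  shows "\<not> distinct [col a b, col b c, col a c, col c d]"
proof -
  have V: "distinct [a, b, c, d, e, f]" "{a, b, c, d, e, f} \<subseteq> V"
    using assms by (auto simp: rainbow_P4_K2_def rainbow_K13_K2_def rainbow_K3_K2_def)
  note paths = noK13[of c a b d e f]
    noK3[of a b c e f]
    noP4[of a b c d e f]
    noP4[of b a c d e f]
  note commute = col_commute[of b a] col_commute[of c a] col_commute[of d a] col_commute[of e a] col_commute[of f a]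
    col_commute[of c b] col_commute[of d b] col_commute[of e b] col_commute[of f b] col_commute[of d c]
    col_commute[of e c] col_commute[of f c] col_commute[of e d] col_commute[of f d] col_commute[of f e]
  show ?thesis
    using assms(1) paths V unfolding rainbow_P4_K2_def rainbow_K13_K2_def rainbow_K3_K2_def commute
    by simp (smt (verit))
qed

lemma no_rainbow_K14:
  assumes "distinct [a, b, c, d, e, f]" and "{a, b, c, d, e, f} \<subseteq> V"
    and noP4: "\<And>u v w x y z. \<not> rainbow_P4_K2 u v w x y z"
    and noK13: "\<And>u v w x y z. \<not> rainbow_K13_K2 u v w x y z"
    and noK3: "\<And>u v w x y. \<not> rainbow_K3_K2 u v w x y"
  shows "\<not> distinct [col a b, col a c, col a d, col a e]"
proof -
  have V: "distinct [a, b, c, d, e, f]" "{a, b, c, d, e, f} \<subseteq> V"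
    using assms by (auto simp: rainbow_P4_K2_def rainbow_K13_K2_def rainbow_K3_K2_def)
  note paths = no_rainbow_P5'[of b a d f e]
    no_rainbow_P5'[of b e a d f]
    no_rainbow_P5'[of b f d a c]
    no_rainbow_P5'[of c a b e f]
    no_rainbow_P5'[of c a d f e]
    no_rainbow_P5'[of c a e b f]
    no_rainbow_P5'[of c f d a e]
    no_rainbow_P5'[of d a e b f]
    no_rainbow_P5'[of e b a d f]
    noK13[of a b c d e f]
    noK13[of a b c e d f]
    noK13[of a b d e c f]
    noK13[of a c d e b f]
    noK3[of a b e c f]
    noK3[of a b e d f]
    noP4[of b e a c d f]
    noP4[of c a b e d f]
    noP4[of c a d f b e]
    noP4[of d a b e c f]
  note commute = col_commute[of b a] col_commute[of c a] col_commute[of d a] col_commute[of e a] col_commute[of f a]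
    col_commute[of c b] col_commute[of d b] col_commute[of e b] col_commute[of f b] col_commute[of d c]
    col_commute[of e c] col_commute[of f c] col_commute[of e d] col_commute[of f d] col_commute[of f e]
  show ?thesis
    using assms(1) paths V unfolding rainbow_P4_K2_def rainbow_K13_K2_def rainbow_K3_K2_def commute
    by simp (smt (verit))
qed

lemma no_rainbow_fork:
  assumes "distinct [a, b, c, d, e, f]" and "{a, b, c, d, e, f} \<subseteq> V"
    and noP4: "\<And>u v w x y z. \<not> rainbow_P4_K2 u v w x y z"
    and noK13: "\<And>u v w x y z. \<not> rainbow_K13_K2 u v w x y z"
  shows "\<not> distinct [col a b, col a c, col a d, col d e]"
proof -
  have V: "distinct [a, b, c, d, e, f]" "{a, b, c, d, e, f} \<subseteq> V"
    using assms by (auto simp: rainbow_P4_K2_def rainbow_K13_K2_def rainbow_K3_K2_def)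
  note paths = no_rainbow_P5'[of b a c f e]
    no_rainbow_P5'[of b a d e f]
    no_rainbow_P5'[of c a d e f]
    no_rainbow_P5'[of e d a c f]
    noK13[of a b c d e f]
    noP4[of b a c f d e]
    noP4[of b a d e c f]
  note commute = col_commute[of b a] col_commute[of c a] col_commute[of d a] col_commute[of e a] col_commute[of f a]
    col_commute[of c b] col_commute[of d b] col_commute[of e b] col_commute[of f b] col_commute[of d c]
    col_commute[of e c] col_commute[of f c] col_commute[of e d] col_commute[of f d] col_commute[of f e]
  show ?thesis
    using assms(1) paths V unfolding rainbow_P4_K2_def rainbow_K13_K2_def rainbow_K3_K2_def commute
    by simp (smt (verit))
qed

lemma no_rainbow_C4:
  assumes "distinct [a, b, c, d, e, f]" and "{a, b, c, d, e, f} \<subseteq> V"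
    and noP4: "\<And>u v w x y z. \<not> rainbow_P4_K2 u v w x y z"
  shows "\<not> distinct [col a b, col b c, col c d, col d a]"
proof -
  have V: "distinct [a, b, c, d, e, f]" "{a, b, c, d, e, f} \<subseteq> V"
    using assms by (auto simp: rainbow_P4_K2_def rainbow_K13_K2_def rainbow_K3_K2_def)
  note paths = noP4[of a b c d e f]
    noP4[of b c d a e f]
    noP4[of c d a b e f]
    noP4[of d a b c e f]
  note commute = col_commute[of b a] col_commute[of c a] col_commute[of d a] col_commute[of e a] col_commute[of f a]
    col_commute[of c b] col_commute[of d b] col_commute[of e b] col_commute[of f b] col_commute[of d c]
    col_commute[of e c] col_commute[of f c] col_commute[of e d] col_commute[of f d] col_commute[of f e]
  show ?thesis
    using assms(1) paths V unfolding rainbow_P4_K2_def rainbow_K13_K2_def rainbow_K3_K2_def commute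
    by simp (smt (verit))
qed

section \<open>The exceptional structures\<close>

definition uniform_off_vertex_and_edge :: bool where
  "uniform_off_vertex_and_edge \<longleftrightarrow> (\<exists>a b c k. distinct [a, b, c] \<and> {a, b, c} \<subseteq> V \<and>
     (\<forall>x\<in>V - {a}. \<forall>y\<in>V - {a}. x \<noteq> y \<longrightarrow> {x, y} \<noteq> {b, c} \<longrightarrow> col x y = k))"

definition uniform_off_four_vertices :: bool where
  "uniform_off_four_vertices \<longleftrightarrow> (\<exists>Q k. Q \<subseteq> V \<and> card Q = 4 \<and>
     (\<forall>x\<in>V. \<forall>y\<in>V. x \<noteq> y \<longrightarrow> \<not> {x, y} \<subseteq> Q \<longrightarrow> col x y = k))"

text \<open>The label \<open>l x\<close> is the only color besides \<open>k\<close> that may occur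
  at \<open>x\<close>. Hence vertices with different labels are joined in color \<open>k\<close>,
  and inside a label class only \<open>k\<close> and the label itself occur.\<close>

definition dominant_color :: bool where
  "dominant_color \<longleftrightarrow> (\<exists>k l. \<forall>x\<in>V. \<forall>y\<in>V. x \<noteq> y \<longrightarrow>
     col x y = k \<or> (col x y = l x \<and> col x y = l y))"

text \<open>A rainbow \<open>P4\<close> with a disjoint edge turns into this configuration: the
  color of the middle edge of the path becomes \<open>k\<close> and joins the three other edges
  completely.\<close>

definition rainbow_3K2 :: "'c \<Rightarrow> 'v \<Rightarrow> 'v \<Rightarrow> 'v \<Rightarrow> 'v \<Rightarrow> 'v \<Rightarrow> 'v \<Rightarrow> bool" where
  "rainbow_3K2 k a b c d e f \<longleftrightarrow> distinct [a, b, c, d, e, f] \<and> {a, b, c, d, e, f} \<subseteq> V \<and>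
     distinct [col a b, col c d, col e f, k] \<and>
     (\<forall>x\<in>{a, b}. \<forall>y\<in>{c, d, e, f}. col x y = k) \<and> (\<forall>x\<in>{c, d}. \<forall>y\<in>{e, f}. col x y = k)"

section \<open>A rainbow path with a disjoint edge forces a dominant color\<close>

lemma rainbow_P4_K2_rev:
  assumes "rainbow_P4_K2 a b c d e f"
  shows "rainbow_P4_K2 d c b a e f" "rainbow_P4_K2 a b c d f e"
  using assms col_commute[of d c] col_commute[of c b] col_commute[of b a] col_commute[of f e]
  unfolding rainbow_P4_K2_def by auto

text \<open>Reversing the path and exchanging \<open>e\<close> with \<open>f\<close> carries the
  four equations for \<open>a c\<close>, \<open>a d\<close>, \<open>a e\<close>, \<open>b e\<close>
  to all pairs between the three edges \<open>a b\<close>, \<open>c d\<close>,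
  \<open>e f\<close>.\<close>

lemma rainbow_3K2_if_P4_K2:
  assumes "rainbow_P4_K2 a b c d e f"
  shows "rainbow_3K2 (col b c) a b c d e f"
proof -
  note P = assms rainbow_P4_K2_rev[OF assms] rainbow_P4_K2_rev(2)[OF rainbow_P4_K2_rev(1)[OF assms]]
  note X = P[THEN rainbow_P4_K2_ac] P[THEN rainbow_P4_K2_ad] P[THEN rainbow_P4_K2_ae] P[THEN rainbow_P4_K2_be]
  show ?thesis
    using X assms col_commute[of d b] col_commute[of c b]
    unfolding rainbow_3K2_def rainbow_P4_K2_def by auto
qed

lemma rainbow_3K2_perm:
  assumes "rainbow_3K2 k a b c d e f"
  shows "rainbow_3K2 k b a c d e f" "rainbow_3K2 k c d a b e f" "rainbow_3K2 k a b e f c d"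
  using assms unfolding rainbow_3K2_def
  by (auto simp: col_commute)

text \<open>For \<open>x\<close> outside the six vertices, the paths \<open>x a b c d\<close> and
  \<open>x a b e f\<close> use an edge of color \<open>k\<close>. If \<open>col a x\<close> differed
  from \<open>col a b\<close>, it would have to equal both \<open>col c d\<close> and
  \<open>col e f\<close>.\<close>

lemma rainbow_3K2_inner:
  assumes T: "rainbow_3K2 k a b c d e f" and x: "x \<in> V" "x \<noteq> a" "col a x \<noteq> k"
  shows "col a x = col a b"
proof (cases "x \<in> {b, c, d, e, f}")
  case True
  then show ?thesis using T x unfolding rainbow_3K2_def by auto
next
  case False
  have "\<not> distinct [col x a, col a b, col b c, col c d]" "\<not> distinct [col x a, col a b, col b e, col e f]"
    using no_rainbow_P5[of x a b c d] no_rainbow_P5[of x a b e f] T x False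
    unfolding rainbow_3K2_def by auto
  then show ?thesis
    using T x(3) unfolding rainbow_3K2_def by (auto simp: col_commute[of x a])
qed

lemma rainbow_3K2_inner':
  assumes "rainbow_3K2 k a b c d e f" "x \<in> V"
  shows "x \<noteq> b \<Longrightarrow> col b x \<noteq> k \<Longrightarrow> col b x = col a b"
    and "x \<noteq> c \<Longrightarrow> col c x \<noteq> k \<Longrightarrow> col c x = col c d"
    and "x \<noteq> d \<Longrightarrow> col d x \<noteq> k \<Longrightarrow> col d x = col c d"
    and "x \<noteq> e \<Longrightarrow> col e x \<noteq> k \<Longrightarrow> col e x = col e f"
    and "x \<noteq> f \<Longrightarrow> col f x \<noteq> k \<Longrightarrow> col f x = col e f"
  using rainbow_3K2_inner[OF _ assms(2)] rainbow_3K2_perm assms(1) col_commute by metis+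

text \<open>The path \<open>a b c d\<close> is rainbow with middle color \<open>k\<close>, so any
  disjoint edge of a fresh color can take the place of \<open>e f\<close>.\<close>

lemma rainbow_3K2_extend:
  assumes "rainbow_3K2 k a b c d e f" "{x, y} \<subseteq> V - {a, b, c, d}" "x \<noteq> y"
    "col x y \<notin> {k, col a b, col c d}"
  shows "rainbow_3K2 k a b c d x y"
proof -
  have "rainbow_P4_K2 a b c d x y" "col b c = k"
    using assms unfolding rainbow_3K2_def rainbow_P4_K2_def by auto
  then show ?thesis using rainbow_3K2_if_P4_K2 by blast
qed

text \<open>The common color can only be \<open>col a b\<close>. If \<open>z\<close> is an end of
  \<open>c d\<close> or \<open>e f\<close>, a rainbow path runs from \<open>a\<close> over
  \<open>y\<close> and \<open>z\<close> into the other of these two edges. If \<open>z\<close> lies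
  outside and \<open>y z\<close> has another color, \<open>rainbow_3K2_extend\<close> applies to
  \<open>y z\<close> and makes \<open>col a y\<close> equal to \<open>k\<close>.\<close>

lemma rainbow_3K2_pendant:
  assumes T: "rainbow_3K2 k a b c d e f" and y: "y \<in> V - {a, b, c, d, e, f}" "col y a \<noteq> k"
    and z: "z \<in> V" "z \<noteq> y" "col y z \<noteq> k"
  shows "col y z = col y a"
proof -
  have ya: "col y a = col a b"
    using rainbow_3K2_inner[OF T, of y] y col_commute[of y a] by auto
  have "col y z = col a b"
  proof -
    consider "z = a" | "z = b" | "z \<in> {c, d}" | "z \<in> {e, f}" | "z \<in> V - {a, b, c, d, e, f}" using z by auto
    then show ?thesis
    proof cases
      case 2
      then show ?thesis using rainbow_3K2_inner'(1)[OF T, of y] y z col_commute[of y z] by auto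
    next
      case 3
      then have "col y z = col c d"
        using rainbow_3K2_inner'(2,3)[OF T, of y] y z col_commute[of y z] by auto
      moreover have "\<not> distinct [col a y, col y z, col z e, col e f]"
        using no_rainbow_P5[of a y z e f] T y z 3 unfolding rainbow_3K2_def by auto
      moreover have "col z e = k" using 3 T unfolding rainbow_3K2_def by auto
      ultimately show ?thesis using T ya unfolding rainbow_3K2_def by (auto simp: col_commute)
    next
      case 4
      then have "col y z = col e f"
        using rainbow_3K2_inner'(4,5)[OF T, of y] y z col_commute[of y z] by auto
      moreover have "\<not> distinct [col a y, col y z, col z c, col c d]"
        using no_rainbow_P5[of a y z c d] T y z 4 unfolding rainbow_3K2_def by auto
      moreover have "col z c = k" using 4 T col_commute[of z c] unfolding rainbow_3K2_def by auto
      ultimately show ?thesis using T ya unfolding rainbow_3K2_def by (auto simp: col_commute)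
    next
      case 5
      show ?thesis
      proof (rule ccontr)
        assume ne: "col y z \<noteq> col a b"
        have "col y z \<notin> {k, col a b, col c d} \<or> col y z \<notin> {k, col a b, col e f}"
          using T ne z unfolding rainbow_3K2_def by auto
        then have "rainbow_3K2 k a b c d y z \<or> rainbow_3K2 k a b e f y z"
          using rainbow_3K2_extend[OF T, of y z] rainbow_3K2_extend[OF rainbow_3K2_perm(3)[OF T], of y z]
            5 y(1) z(2) by blast
        then have "col a y = k" unfolding rainbow_3K2_def by auto
        then show False using y col_commute by metis
      qed
    qed (use ya in auto)
  qed
  then show ?thesis using ya by simp
qed

text \<open>The edge \<open>y z\<close> can replace one of \<open>c d\<close> and
  \<open>e f\<close>, because its color cannot agree with both. Then \<open>col z a = k\<close>, and
  the path \<open>x y z a b\<close> would be rainbow if \<open>x y\<close> and \<open>y z\<close>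
  had different colors.\<close>

lemma rainbow_3K2_outer:
  assumes T: "rainbow_3K2 k a b c d e f" and out: "{x, y, z} \<subseteq> V - {a, b, c, d, e, f}"
    and d: "distinct [x, y, z]" and nk: "col x y \<noteq> k" "col y z \<noteq> k" and ab: "col a b \<notin> {col x y, col y z}"
  shows "col x y = col y z"
proof (rule ccontr)
  assume ne: "col x y \<noteq> col y z"
  have "col y z \<notin> {k, col a b, col c d} \<or> col y z \<notin> {k, col a b, col e f}"
    using T ab nk unfolding rainbow_3K2_def by auto
  moreover have "{y, z} \<subseteq> V - {a, b, c, d}" "{y, z} \<subseteq> V - {a, b, e, f}" "y \<noteq> z" using out d by auto
  ultimately have "rainbow_3K2 k a b c d y z \<or> rainbow_3K2 k a b e f y z"
    using rainbow_3K2_extend[OF T, of y z] rainbow_3K2_extend[OF rainbow_3K2_perm(3)[OF T], of y z] by blast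
  then have "col z a = k" using col_commute[of z a] unfolding rainbow_3K2_def by auto
  moreover have "\<not> distinct [col x y, col y z, col z a, col a b]"
    using no_rainbow_P5[of x y z a b] T out d unfolding rainbow_3K2_def by auto
  ultimately show False using ne nk ab T unfolding rainbow_3K2_def by auto
qed

text \<open>This is dominance of \<open>k\<close> in local form. When all three vertices lie outside
  the six, the two colors at \<open>y\<close> miss at least one of the three colors
  \<open>col a b\<close>, \<open>col c d\<close>, \<open>col e f\<close>, and
  \<open>rainbow_3K2_outer\<close> is applied with the edge of that color in front.\<close>

lemma rainbow_3K2_incident:
  assumes T: "rainbow_3K2 k a b c d e f" and V: "{x, y, z} \<subseteq> V"
    and d: "distinct [x, y, z]" and nk: "col x y \<noteq> k" "col y z \<noteq> k"
  shows "col x y = col y z"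
proof -
  note T2 = rainbow_3K2_perm(2)[OF T]
  note T3 = rainbow_3K2_perm(2)[OF rainbow_3K2_perm(3)[OF T]]
  have pend: "col y v = col y u"
    if "u \<in> {a, b, c, d, e, f}" "y \<in> V - {a, b, c, d, e, f}" "col y u \<noteq> k" "v \<in> V" "v \<noteq> y" "col y v \<noteq> k" for u v
  proof -
    have y: "y \<in> V - {a, b, c, d, e, f}" "y \<in> V - {b, a, c, d, e, f}" "y \<in> V - {c, d, a, b, e, f}"
      "y \<in> V - {d, c, a, b, e, f}" "y \<in> V - {e, f, a, b, c, d}" "y \<in> V - {f, e, a, b, c, d}" using that by auto
    note p = rainbow_3K2_pendant[OF T y(1) _ that(4-6)] rainbow_3K2_pendant[OF rainbow_3K2_perm(1)[OF T] y(2) _ that(4-6)]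
      rainbow_3K2_pendant[OF T2 y(3) _ that(4-6)] rainbow_3K2_pendant[OF rainbow_3K2_perm(1)[OF T2] y(4) _ that(4-6)]
      rainbow_3K2_pendant[OF T3 y(5) _ that(4-6)] rainbow_3K2_pendant[OF rainbow_3K2_perm(1)[OF T3] y(6) _ that(4-6)]
    show ?thesis using that(1,3) p by blast
  qed
  consider "y \<in> {a, b, c, d, e, f}" | "y \<in> V - {a, b, c, d, e, f}" "x \<in> {a, b, c, d, e, f}"
    | "y \<in> V - {a, b, c, d, e, f}" "z \<in> {a, b, c, d, e, f}" | "{x, y, z} \<subseteq> V - {a, b, c, d, e, f}"
    using V by auto
  then show ?thesis
  proof cases
    case 1
    then show ?thesis
      using rainbow_3K2_inner[OF T, of x] rainbow_3K2_inner[OF T, of z]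
        rainbow_3K2_inner'[OF T, of x] rainbow_3K2_inner'[OF T, of z] nk V d col_commute[of x y] by auto
  next
    case 2
    then show ?thesis using pend[of x z] nk V d col_commute[of x y] by auto
  next
    case 3
    then show ?thesis using pend[of z x] nk V d col_commute[of x y] by auto
  next
    case 4
    then have "{x, y, z} \<subseteq> V - {c, d, a, b, e, f}" "{x, y, z} \<subseteq> V - {e, f, a, b, c, d}" by auto
    moreover have "col a b \<notin> {col x y, col y z} \<or> col c d \<notin> {col x y, col y z} \<or> col e f \<notin> {col x y, col y z}"
      using T unfolding rainbow_3K2_def by auto
    ultimately show ?thesis
      using rainbow_3K2_outer[OF T 4 d nk] rainbow_3K2_outer[OF T2 _ d nk]
        rainbow_3K2_outer[OF T3 _ d nk] by blast
  qed
qed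

lemma dominant_color_if_P4_K2:
  assumes "rainbow_P4_K2 a b c d e f"
  shows dominant_color
proof -
  define k where "k = col b c"
  have T: "rainbow_3K2 k a b c d e f" using rainbow_3K2_if_P4_K2[OF assms] k_def by simp
  \<comment> \<open>By \<open>rainbow_3K2_incident\<close> the choice of the edge does not influence
    its color; at a vertex with edges of color \<open>k\<close> only, any label will do.\<close>
  define l where "l = (\<lambda>x. col x (SOME y. y \<in> V \<and> y \<noteq> x \<and> col x y \<noteq> k))"
  have l: "col x y = l x" if "x \<in> V" "y \<in> V" "x \<noteq> y" "col x y \<noteq> k" for x y
  proof -
    define z where "z = (SOME y. y \<in> V \<and> y \<noteq> x \<and> col x y \<noteq> k)"
    have z: "z \<in> V \<and> z \<noteq> x \<and> col x z \<noteq> k" unfolding z_def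
      using someI[of "\<lambda>w. w \<in> V \<and> w \<noteq> x \<and> col x w \<noteq> k" y] that by blast
    have "col x y = col x z"
    proof (cases "y = z")
      case False
      then show ?thesis
        using rainbow_3K2_incident[OF T, of y x z] that z col_commute[of x y] by auto
    qed simp
    then show ?thesis by (simp add: l_def z_def)
  qed
  have "\<forall>x\<in>V. \<forall>y\<in>V. x \<noteq> y \<longrightarrow> col x y = k \<or> (col x y = l x \<and> col x y = l y)"
    using l col_commute by metis
  then show ?thesis unfolding dominant_color_def by blast
qed

section \<open>Rainbow stars and triangles with a disjoint edge, and the structure theorem\<close>

lemma rainbow_K13_K2_perm:
  assumes "rainbow_K13_K2 a b c d e f"
  shows "rainbow_K13_K2 a c b d e f" "rainbow_K13_K2 a d b c e f" "rainbow_K13_K2 a b c d f e"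
  using assms col_commute[of f e] unfolding rainbow_K13_K2_def by auto

lemma rainbow_K13_K2_cross:
  assumes "rainbow_K13_K2 a b c d e f"
  shows "col b e = col e f" "col c e = col e f" "col d e = col e f"
  using rainbow_K13_K2_be assms rainbow_K13_K2_perm[OF assms] by blast+

text \<open>If \<open>e u\<close> has a color outside the star, it forms another rainbow star with a
  disjoint edge, and \<open>col b e\<close> equals both \<open>col e u\<close> and
  \<open>col e f\<close>. If it has the color of a star edge, a path from \<open>u\<close> over
  \<open>e\<close> to one leaf, the center and another leaf is rainbow.\<close>

lemma rainbow_K13_K2_move:
  assumes K: "rainbow_K13_K2 a b c d e f" and u: "u \<in> V - {a, b, c, d, e}"
  shows "col e u = col e f"
proof (cases "col e u \<in> {col a b, col a c, col a d}")
  case True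
  have "\<not> distinct [col u e, col e c, col c a, col a d]" "\<not> distinct [col u e, col e b, col b a, col a d]"
    "\<not> distinct [col u e, col e b, col b a, col a c]"
    using no_rainbow_P5[of u e c a d] no_rainbow_P5[of u e b a d] no_rainbow_P5[of u e b a c] K u
    unfolding rainbow_K13_K2_def by auto
  then show ?thesis
    using True K rainbow_K13_K2_cross[OF K]
      col_commute[of u e] col_commute[of e b] col_commute[of e c] col_commute[of c a] col_commute[of b a]
    unfolding rainbow_K13_K2_def by auto
next
  case False
  then have "rainbow_K13_K2 a b c d e u" using K u unfolding rainbow_K13_K2_def by auto
  then show ?thesis using rainbow_K13_K2_cross K by metis
qed

text \<open>All pairs inside \<open>U\<close> and between the leaves and \<open>U\<close> have color
  \<open>k\<close>, so only the edges at the center and the three edges among the leaves are open.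
  If at most one leaf edge is not of color \<open>k\<close>, deleting the center and this edge
  leaves one color. If two are not, the center is joined to \<open>U\<close> in color
  \<open>k\<close> too, and the exceptions lie in \<open>{a, b, c, d}\<close>.\<close>

lemma rainbow_K13_K2_uniform:
  assumes K: "rainbow_K13_K2 a b c d e f"
  shows "uniform_off_vertex_and_edge \<or> uniform_off_four_vertices"
proof -
  define k where "k = col e f"
  define U where "U = V - {a, b, c, d}"
  have KU: "rainbow_K13_K2 a b c d u e" "col u e = k" if "u \<in> U" "u \<noteq> e" for u
    using rainbow_K13_K2_move[OF K, of u] that K col_commute[of u e]
    unfolding rainbow_K13_K2_def U_def k_def by auto
  have UU: "col u v = k" if "u \<in> U" "v \<in> U" "u \<noteq> v" for u v
  proof (cases "u = e")
    case True
    then show ?thesis using KU(2)[of v] that col_commute by metis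
  next
    case False
    then show ?thesis
      using rainbow_K13_K2_move[OF KU(1), of u v] KU(2)[of u] that unfolding U_def by auto
  qed
  have KU2: "\<exists>v\<in>U. rainbow_K13_K2 a b c d u v \<and> v \<noteq> u \<and> col u v = k" if "u \<in> U" for u
  proof (cases "u = e")
    case True
    have "f \<in> U" "f \<noteq> e" using K unfolding U_def rainbow_K13_K2_def by auto
    then show ?thesis using K True k_def by blast
  next
    case False
    have "e \<in> U" using K unfolding U_def rainbow_K13_K2_def by auto
    then show ?thesis using KU[OF that False] False by blast
  qed
  have X: "col x u = k" if "x \<in> {b, c, d}" "u \<in> U" for x u
    using KU2[OF that(2)] rainbow_K13_K2_cross that by blast
  have dist: "distinct [a, b, c, d]" "{a, b, c, d} \<subseteq> V" "e \<in> U"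
    "distinct [col a b, col a c, col a d, k]"
    using K unfolding rainbow_K13_K2_def k_def U_def by auto
  \<comment> \<open>Here \<open>z\<close> is the third leaf. The paths ending in \<open>e\<close>
    determine the color of \<open>x y\<close>; those starting in \<open>u\<close> then restrict
    \<open>a u\<close>.\<close>
  have triangle: "col x y = col a z" "\<And>u. u \<in> U \<Longrightarrow> col a u \<in> {k, col a z}"
    if "distinct [x, y, z]" "{x, y, z} = {b, c, d}" "col x y \<noteq> k" for x y z
  proof -
    have xyz: "x \<in> {b, c, d}" "y \<in> {b, c, d}" "z \<in> {b, c, d}" using that(2) by blast+
    have d4: "distinct [col a x, col a y, col a z, k]"
      using that(1) xyz dist(4) by (elim insertE) auto
    have dv: "distinct [a, x, y, z]" "{a, x, y, z} \<subseteq> V" using dist(1,2) that(1) xyz by auto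
    have eo: "e \<in> V" "e \<notin> {a, x, y, z}" using dist(3) that(2) unfolding U_def by auto
    have "\<not> distinct [col z a, col a y, col y x, col x e]" "\<not> distinct [col z a, col a x, col x y, col y e]"
      using no_rainbow_P5[of z a y x e] no_rainbow_P5[of z a x y e] dv eo by auto
    then show xy: "col x y = col a z"
      using d4 that(3) X[OF xyz(1) dist(3)] X[OF xyz(2) dist(3)]
        col_commute[of z a] col_commute[of y x] by auto
    fix u assume u: "u \<in> U"
    obtain v where v: "v \<in> U" "v \<noteq> u" using KU2[OF u] by auto
    have uo: "u \<in> V" "u \<notin> {a, x, y, z}" "v \<in> V" "v \<notin> {a, x, y, z}"
      using u v(1) that(2) unfolding U_def by auto
    have "\<not> distinct [col u a, col a x, col x y, col y v]" "\<not> distinct [col u a, col a y, col y x, col x v]"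
      using no_rainbow_P5[of u a x y v] no_rainbow_P5[of u a y x v] dv uo v by auto
    then show "col a u \<in> {k, col a z}"
      using d4 xy X[OF xyz(1) v(1)] X[OF xyz(2) v(1)] col_commute[of u a] col_commute[of y x] by auto
  qed
  have off: "uniform_off_vertex_and_edge"
    if "distinct [x, y, z]" "{x, y, z} = {b, c, d}" "col x z = k" "col y z = k" for x y z
    unfolding uniform_off_vertex_and_edge_def
  proof (intro exI conjI ballI impI)
    have "x \<in> {b, c, d}" "y \<in> {b, c, d}" using that(2) by blast+
    then show "distinct [a, x, y]" "{a, x, y} \<subseteq> V" using that(1) dist(1,2) by auto
    fix v w assume vw: "v \<in> V - {a}" "w \<in> V - {a}" "v \<noteq> w" "{v, w} \<noteq> {x, y}"
    have in3: "v \<in> {x, y, z} \<or> v \<in> U" "w \<in> {x, y, z} \<or> w \<in> U" using vw that unfolding U_def by auto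
    have X': "col p q = k" "col q p = k" if "p \<in> {x, y, z}" "q \<in> U" for p q
      using X that \<open>{x, y, z} = {b, c, d}\<close> col_commute by metis+
    have "col z x = k" "col z y = k" using that(3,4) col_commute by metis+
    then have "col v w = k" if "v \<in> {x, y, z}" "w \<in> {x, y, z}"
      using that vw(3,4) \<open>col x z = k\<close> \<open>col y z = k\<close> by (elim insertE) auto
    then show "col v w = k" using in3 X' UU vw(3) by blast
  qed
  have four: "uniform_off_four_vertices"
    if "distinct [x, y, z]" "{x, y, z} = {b, c, d}" "col x z \<noteq> k" "col y z \<noteq> k" for x y z
  proof -
    have xyz: "x \<in> {b, c, d}" "y \<in> {b, c, d}" "z \<in> {b, c, d}" using that(2) by blast+
    have d4: "distinct [col a x, col a y, col a z, k]"
      using that(1) xyz dist(4) by (elim insertE) auto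
    \<comment> \<open>Two leaf edges of other colors leave the choices \<open>k\<close>,
      \<open>col a y\<close> and \<open>k\<close>, \<open>col a x\<close> for \<open>a u\<close>;
      only \<open>k\<close> is common to both.\<close>
    have aU: "col a u = k" if "u \<in> U" for u
    proof -
      have "{x, z, y} = {b, c, d}" "{y, z, x} = {b, c, d}" using \<open>{x, y, z} = {b, c, d}\<close> by auto
      then have "col a u \<in> {k, col a y}" "col a u \<in> {k, col a x}"
        using triangle(2)[of x z y u] triangle(2)[of y z x u] that \<open>distinct [x, y, z]\<close>
          \<open>col x z \<noteq> k\<close> \<open>col y z \<noteq> k\<close> by auto
      then show ?thesis using d4 by auto
    qed
    show ?thesis unfolding uniform_off_four_vertices_def
    proof (intro exI conjI ballI impI)
      show "{a, b, c, d} \<subseteq> V" "card {a, b, c, d} = 4" using dist by auto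
      fix v w assume vw: "v \<in> V" "w \<in> V" "v \<noteq> w" "\<not> {v, w} \<subseteq> {a, b, c, d}"
      then have "v \<in> U \<or> w \<in> U" "v \<in> {a, b, c, d} \<or> v \<in> U" "w \<in> {a, b, c, d} \<or> w \<in> U"
        unfolding U_def by auto
      moreover have "col p q = k" "col q p = k" if "p \<in> {a, b, c, d}" "q \<in> U" for p q
        using aU X that col_commute by (metis insertE insertCI)+
      ultimately show "col v w = k" using vw(3) UU by blast
    qed
  qed
  show ?thesis
    using off[of b c d] off[of b d c] off[of c d b] four[of b c d] four[of b d c] four[of c d b] dist
      col_commute[of b c] col_commute[of b d] col_commute[of c d]
    by (auto simp: insert_commute)
qed

text \<open>Every edge other than the three of the triangle gets color \<open>k\<close>, so it
  suffices to remove \<open>a\<close> and the edge \<open>b c\<close>. The bound on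
  \<open>card V\<close> supplies the sixth vertex that \<open>rainbow_K3_K2_ad\<close> asks
  for.\<close>

lemma rainbow_K3_K2_uniform:
  assumes noP4: "\<And>u v w x y z. \<not> rainbow_P4_K2 u v w x y z"
    and noK13: "\<And>u v w x y z. \<not> rainbow_K13_K2 u v w x y z"
    and K: "rainbow_K3_K2 a b c d e" and V: "finite V" "card V \<ge> 6"
  shows uniform_off_vertex_and_edge
proof -
  define k where "k = col d e"
  define U where "U = V - {a, b, c}"
  have de: "d \<in> U" "e \<in> U" "d \<noteq> e" "distinct [a, b, c]" "{a, b, c} \<subseteq> V"
    using K unfolding rainbow_K3_K2_def U_def by auto
  have perm: "rainbow_K3_K2 b c a x y" "rainbow_K3_K2 c a b x y" "rainbow_K3_K2 a b c y x"
    if "rainbow_K3_K2 a b c x y" for x y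
    using that col_commute[of b a] col_commute[of c a] col_commute[of c b] col_commute[of y x]
    unfolding rainbow_K3_K2_def by auto
  have du: "col d u = k" if "u \<in> U" "u \<noteq> d" for u
    using rainbow_K3_K2_df[OF K, of u, OF _ _ noP4 noK13] that unfolding U_def k_def by auto
  have Ku: "rainbow_K3_K2 a b c u d" if "u \<in> U" "u \<noteq> d" for u
    using du[OF that] that K col_commute[of u d] unfolding rainbow_K3_K2_def k_def U_def by auto
  have UU: "col u v = k" if "u \<in> U" "v \<in> U" "u \<noteq> v" for u v
  proof (cases "u = d")
    case False
    then show ?thesis
      using rainbow_K3_K2_df[OF Ku, of u v, OF _ _ _ _ noP4 noK13] that du[of u] du[of v]
        col_commute[of u d] unfolding U_def by auto
  qed (use du that in auto)
  have X: "col x u = k" if "x \<in> {a, b, c}" "u \<in> U" for x u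
  proof -
    obtain v where v: "v \<in> U" "v \<noteq> u" using de by metis
    have "rainbow_K3_K2 a b c u v"
      using UU[of u v] that v K unfolding rainbow_K3_K2_def k_def U_def by auto
    have "card {a, b, c, u, v} \<le> 5" by (simp add: card_insert_if)
    then have "\<not> V \<subseteq> {a, b, c, u, v}" using V card_mono[of "{a, b, c, u, v}" V] by auto
    then obtain w where w: "w \<in> V" "w \<notin> {a, b, c, u, v}" by auto
    note r = rainbow_K3_K2_ad[OF _ w(1) _ noP4 noK13]
    show ?thesis
      using r[of a b c u v] r[of b c a u v] r[of c a b u v] perm[OF \<open>rainbow_K3_K2 a b c u v\<close>]
        \<open>rainbow_K3_K2 a b c u v\<close> w(2) that(1) UU[of u v] that v by auto
  qed
  show ?thesis unfolding uniform_off_vertex_and_edge_def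
  proof (intro exI conjI ballI impI)
    show "distinct [a, b, c]" "{a, b, c} \<subseteq> V" using de by auto
    fix v w assume vw: "v \<in> V - {a}" "w \<in> V - {a}" "v \<noteq> w" "{v, w} \<noteq> {b, c}"
    have "v \<in> {b, c} \<or> v \<in> U" "w \<in> {b, c} \<or> w \<in> U" using vw unfolding U_def by auto
    moreover have "\<not> (v \<in> {b, c} \<and> w \<in> {b, c})" using vw(3,4) by auto
    moreover have "col p q = k" "col q p = k" if "p \<in> {b, c}" "q \<in> U" for p q
      using X that col_commute by (metis insertCI)+
    ultimately show "col v w = k" using vw(3) UU by blast
  qed
qed

text \<open>By \<open>fresh\<close> some edge \<open>x y\<close> has a color different from those of
  the three given edges. However it meets them, the result contains a rainbow \<open>P5\<close> or a
  rainbow graph that has been excluded before. The triangle comes first because it restricts the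
  chords of the star and of the path.\<close>

lemma no_rainbow_three_edges:
  assumes V: "finite V" "card V \<ge> 6"
    and noP4: "\<And>u v w x y z. \<not> rainbow_P4_K2 u v w x y z"
    and noK13: "\<And>u v w x y z. \<not> rainbow_K13_K2 u v w x y z"
    and noK3: "\<And>u v w x y. \<not> rainbow_K3_K2 u v w x y"
    and fresh: "\<And>p q r. \<exists>x\<in>V. \<exists>y\<in>V. x \<noteq> y \<and> col x y \<notin> {p, q, r}"
  shows "distinct [a, b, c] \<Longrightarrow> {a, b, c} \<subseteq> V \<Longrightarrow> \<not> distinct [col a b, col b c, col a c]"
    and "distinct [a, b, c, d] \<Longrightarrow> {a, b, c, d} \<subseteq> V \<Longrightarrow> \<not> distinct [col a b, col a c, col a d]"
    and "distinct [a, b, c, d] \<Longrightarrow> {a, b, c, d} \<subseteq> V \<Longrightarrow> \<not> distinct [col a b, col b c, col c d]"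
proof -
  have two: "\<exists>e f. e \<in> V - set xs \<and> f \<in> V - set xs \<and> e \<noteq> f" if "length xs = 4" for xs
  proof -
    have "card (set xs) \<le> 4" using card_length[of xs] that by simp
    then have "card (V - set xs) \<ge> 2" using diff_card_le_card_Diff[of "set xs" V] V by simp
    then obtain S where "S \<subseteq> V - set xs" "card S = 2" by (meson obtain_subset_with_card_n)
    then show ?thesis unfolding card_2_iff by blast
  qed
  have one: "\<exists>f. f \<in> V - set xs" if "length xs = 5" for xs
  proof -
    have "\<not> V \<subseteq> set xs" using card_length[of xs] that V card_mono[of "set xs" V] by auto
    then show ?thesis by blast
  qed
  have paw: "\<not> distinct [col a b, col b c, col a c, col c d]"
    if "distinct [a, b, c, d]" "{a, b, c, d} \<subseteq> V" for a b c d
  proof -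
    obtain e f where "e \<in> V - {a, b, c, d}" "f \<in> V - {a, b, c, d}" "e \<noteq> f" using two[of "[a, b, c, d]"] by auto
    then show ?thesis using no_rainbow_paw[of a b c d e f, OF _ _ noP4 noK13 noK3] that by auto
  qed
  have C4: "\<not> distinct [col a b, col b c, col c d, col d a]"
    if "distinct [a, b, c, d]" "{a, b, c, d} \<subseteq> V" for a b c d
  proof -
    obtain e f where "e \<in> V - {a, b, c, d}" "f \<in> V - {a, b, c, d}" "e \<noteq> f" using two[of "[a, b, c, d]"] by auto
    then show ?thesis using no_rainbow_C4[of a b c d e f, OF _ _ noP4] that by auto
  qed
  have K14: "\<not> distinct [col a b, col a c, col a d, col a e]"
    if "distinct [a, b, c, d, e]" "{a, b, c, d, e} \<subseteq> V" for a b c d e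
  proof -
    obtain f where "f \<in> V - {a, b, c, d, e}" using one[of "[a, b, c, d, e]"] by auto
    then show ?thesis using no_rainbow_K14[of a b c d e f, OF _ _ noP4 noK13 noK3] that by auto
  qed
  have fork: "\<not> distinct [col a b, col a c, col a d, col d e]"
    if "distinct [a, b, c, d, e]" "{a, b, c, d, e} \<subseteq> V" for a b c d e
  proof -
    obtain f where "f \<in> V - {a, b, c, d, e}" using one[of "[a, b, c, d, e]"] by auto
    then show ?thesis using no_rainbow_fork[of a b c d e f, OF _ _ noP4 noK13] that by auto
  qed
  show K3: "\<not> distinct [col a b, col b c, col a c]" if abc: "distinct [a, b, c]" "{a, b, c} \<subseteq> V" for a b c
  proof
    assume d: "distinct [col a b, col b c, col a c]"
    obtain x y where xy: "x \<in> V" "y \<in> V" "x \<noteq> y" "col x y \<notin> {col a b, col b c, col a c}"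
      using fresh by metis
    have pend: False if "u \<in> {a, b, c}" "w \<in> V - {a, b, c}" "col u w \<notin> {col a b, col b c, col a c}" for u w
      using that abc d paw[of a b c w] paw[of b c a w] paw[of c a b w]
        col_commute[of c a] col_commute[of b a] col_commute[of c b] by auto
    have "\<not> (x \<in> {a, b, c} \<and> y \<in> {a, b, c})"
      using xy(3,4) col_commute[of c a] col_commute[of b a] col_commute[of c b] by auto
    moreover have "\<not> (x \<notin> {a, b, c} \<and> y \<notin> {a, b, c})"
      using noK3[of a b c x y] abc d xy unfolding rainbow_K3_K2_def by auto
    ultimately show False using pend[of x y] pend[of y x] xy col_commute[of y x] by auto
  qed
  show "\<not> distinct [col a b, col a c, col a d]" if abcd: "distinct [a, b, c, d]" "{a, b, c, d} \<subseteq> V" for a b c d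
  proof
    assume d: "distinct [col a b, col a c, col a d]"
    obtain x y where xy: "x \<in> V" "y \<in> V" "x \<noteq> y" "col x y \<notin> {col a b, col a c, col a d}"
      using fresh by metis
    have leaves: "col u w \<in> {col a b, col a c, col a d}" if "u \<in> {b, c, d}" "w \<in> {b, c, d}" "u \<noteq> w" for u w
      using that abcd d K3[of a u w] col_commute[of w a] by auto
    have pend: False if uw: "u \<in> {a, b, c, d}" "w \<in> V - {a, b, c, d}" "col u w \<notin> {col a b, col a c, col a d}" for u w
    proof -
      consider "u = a" | "u = b" | "u = c" | "u = d" using uw(1) by blast
      then show False
      proof cases
        case 1 then show False using K14[of a b c d w] uw(2,3) abcd d by auto
      next
        case 2 then show False using fork[of a c d b w] uw(2,3) abcd d by auto
      next
        case 3 then show False using fork[of a b d c w] uw(2,3) abcd d by auto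
      next
        case 4 then show False using fork[of a b c d w] uw(2,3) abcd d by auto
      qed
    qed
    have "\<not> (x \<notin> {a, b, c, d} \<and> y \<notin> {a, b, c, d})"
      using noK13[of a b c d x y] abcd d xy unfolding rainbow_K13_K2_def by auto
    moreover have "\<not> (x \<in> {a, b, c, d} \<and> y \<in> {a, b, c, d})"
    proof
      assume "x \<in> {a, b, c, d} \<and> y \<in> {a, b, c, d}"
      then consider "x = a" "y \<in> {b, c, d}" | "y = a" "x \<in> {b, c, d}" | "x \<in> {b, c, d}" "y \<in> {b, c, d}"
        using xy(3) by blast
      then show False using leaves[of x y] xy(3,4) col_commute[of x a] by cases auto
    qed
    ultimately show False using pend[of x y] pend[of y x] xy col_commute[of y x] by auto
  qed
  show "\<not> distinct [col a b, col b c, col c d]" if abcd: "distinct [a, b, c, d]" "{a, b, c, d} \<subseteq> V" for a b c d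
  proof
    assume d: "distinct [col a b, col b c, col c d]"
    obtain x y where xy: "x \<in> V" "y \<in> V" "x \<noteq> y" "col x y \<notin> {col a b, col b c, col c d}"
      using fresh by metis
    have chord: "col a c \<in> {col a b, col b c}" "col b d \<in> {col b c, col c d}"
      using K3[of a b c] K3[of b c d] abcd d by auto
    have close: "col a d \<in> {col a b, col b c, col c d}"
      using C4[of a b c d] abcd d col_commute[of d a] by auto
    have pend: False if uw: "u \<in> {a, b, c, d}" "w \<in> V - {a, b, c, d}" "col u w \<notin> {col a b, col b c, col c d}" for u w
    proof -
      consider "u = a" | "u = b" | "u = c" | "u = d" using uw(1) by blast
      then show False
      proof cases
        case 1 then show False using no_rainbow_P5[of w a b c d] uw(2,3) abcd d col_commute[of w a] by auto
      next
        case 2 then show False using fork[of b a w c d] uw(2,3) abcd d col_commute[of b a] by auto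
      next
        case 3 then show False
          using fork[of c d w b a] uw(2,3) abcd d col_commute[of c b] col_commute[of b a] by auto
      next
        case 4 then show False using no_rainbow_P5[of a b c d w] uw(2,3) abcd d by auto
      qed
    qed
    have "\<not> (x \<notin> {a, b, c, d} \<and> y \<notin> {a, b, c, d})"
      using noP4[of a b c d x y] abcd d xy unfolding rainbow_P4_K2_def by auto
    moreover have "\<not> (x \<in> {a, b, c, d} \<and> y \<in> {a, b, c, d})"
    proof
      assume "x \<in> {a, b, c, d} \<and> y \<in> {a, b, c, d}"
      moreover have "col b a = col a b" "col c b = col b c" "col d c = col c d" "col c a = col a c"
        "col d b = col b d" "col d a = col a d" using col_commute by auto
      ultimately show False using chord close xy(3,4) by (elim conjE insertE) auto
    qed
    ultimately show False using pend[of x y] pend[of y x] xy col_commute[of y x] by auto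
  qed
qed

text \<open>If all alternatives fail, no triangle, star or path with three edges is rainbow. Take
  edges \<open>v a\<close>, \<open>v b\<close> of different colors and \<open>x y\<close> of a
  third. Then \<open>x y\<close> is disjoint from \<open>{v, a, b}\<close>, the edge
  \<open>x v\<close> has the color of \<open>v a\<close> or \<open>v b\<close>, and together with
  the other one and \<open>x y\<close> it forms a rainbow path.\<close>

theorem rainbow_P5_free_structure:
  assumes V: "finite V" "card V \<ge> 6"
  shows "(\<exists>p q r. \<forall>x\<in>V. \<forall>y\<in>V. x \<noteq> y \<longrightarrow> col x y \<in> {p, q, r}) \<or> dominant_color \<or>
    uniform_off_vertex_and_edge \<or> uniform_off_four_vertices"
proof (rule ccontr)
  assume contr: "\<not> ?thesis"
  then have "\<not> (\<exists>p q r. \<forall>x\<in>V. \<forall>y\<in>V. x \<noteq> y \<longrightarrow> col x y \<in> {p, q, r})" by simp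
  then have fresh: "\<exists>x\<in>V. \<exists>y\<in>V. x \<noteq> y \<and> col x y \<notin> {p, q, r}" for p q r by meson
  have noP4: "\<not> rainbow_P4_K2 u v w x y z" for u v w x y z
    using dominant_color_if_P4_K2 contr by blast
  have noK13: "\<not> rainbow_K13_K2 u v w x y z" for u v w x y z
    using rainbow_K13_K2_uniform contr by blast
  have noK3: "\<not> rainbow_K3_K2 u v w x y" for u v w x y
    using rainbow_K3_K2_uniform[OF noP4 noK13 _ V] contr by blast
  note no3 = no_rainbow_three_edges[OF V noP4 noK13 noK3 fresh]
  obtain v a b where vab: "distinct [v, a, b]" "{v, a, b} \<subseteq> V" "col v a \<noteq> col v b"
  proof -
    obtain u w where uw: "u \<in> V" "w \<in> V" "u \<noteq> w" using fresh by metis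
    obtain x y where xy: "x \<in> V" "y \<in> V" "x \<noteq> y" "col x y \<noteq> col u w" using fresh by (metis insertCI)
    have "\<not> (\<forall>v a b. v \<in> V \<longrightarrow> a \<in> V \<longrightarrow> b \<in> V \<longrightarrow> v \<noteq> a \<longrightarrow> v \<noteq> b \<longrightarrow> col v a = col v b)"
    proof
      assume "\<forall>v a b. v \<in> V \<longrightarrow> a \<in> V \<longrightarrow> b \<in> V \<longrightarrow> v \<noteq> a \<longrightarrow> v \<noteq> b \<longrightarrow> col v a = col v b"
      then have none: "\<And>v a b. \<lbrakk>v \<in> V; a \<in> V; b \<in> V; v \<noteq> a; v \<noteq> b\<rbrakk> \<Longrightarrow> col v a = col v b" for v a b by blast
      show False
      proof (cases "w = x")
        case True
        then show False using none[of w u y] uw xy col_commute by metis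
      next
        case False
        then show False using none[of w u x] none[of x w y] uw xy col_commute by metis
      qed
    qed
    then show ?thesis using that by force
  qed
  obtain x y where xy: "x \<in> V" "y \<in> V" "x \<noteq> y" "col x y \<notin> {col v a, col v b}" using fresh by (metis insertCI)
  have va: False if pq: "p \<in> V - {v, a, b}" "q \<in> {v, a, b}" "col p q \<notin> {col v a, col v b}" for p q
  proof -
    consider "q = v" | "q = a" | "q = b" using pq(2) by blast
    then show False
    proof cases
      case 1 then show False using no3(2)[of v a b p] vab pq col_commute[of p v] by auto
    next
      case 2 then show False using no3(3)[of p a v b] vab pq col_commute[of a v] by auto
    next
      case 3 then show False using no3(3)[of p b v a] vab pq col_commute[of b v] by auto
    qed
  qed
  have "\<not> (x \<in> {v, a, b} \<and> y \<in> {v, a, b})"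
  proof
    assume "x \<in> {v, a, b} \<and> y \<in> {v, a, b}"
    then have "{x, y} = {a, b}" using xy(3,4) col_commute[of a v] col_commute[of b v] by auto
    then have "col a b \<notin> {col v a, col v b}" using xy(4) col_commute by (metis doubleton_eq_iff)
    then show False using no3(1)[of v a b] vab by auto
  qed
  moreover have "\<not> (x \<in> {v, a, b} \<and> y \<notin> {v, a, b})" using va[of y x] xy col_commute[of y x] by auto
  moreover have "\<not> (x \<notin> {v, a, b} \<and> y \<in> {v, a, b})" using va[of x y] xy by auto
  ultimately have out: "x \<in> V - {v, a, b}" "y \<in> V - {v, a, b}" using xy by auto
  have "col x v \<in> {col v a, col v b}" using va[of x v] out by auto
  then show False
    using no3(3)[of b v x y] no3(3)[of a v x y] vab out xy col_commute[of x v] col_commute[of a v] col_commute[of b v] by auto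
qed

text \<open>Six paths refute a coloring in which any two adjacent edges differ. This serves the case
  \<open>n = 5\<close>, where the path with two edges is the only \<open>H\<close> with more than
  one edge, up to isolated vertices.\<close>

lemma not_proper_K5:
  assumes "distinct [a, b, c, d, e]" "{a, b, c, d, e} \<subseteq> V"
  shows "\<exists>x y z. distinct [x, y, z] \<and> {x, y, z} \<subseteq> {a, b, c, d, e} \<and> col x y = col x z"
proof (rule ccontr)
  assume neg: "\<not> ?thesis"
  have proper: "col x y \<noteq> col x z" if "distinct [x, y, z]" "{x, y, z} \<subseteq> {a, b, c, d, e}" for x y z
    using neg that by blast
  note pr = proper[of a b c] proper[of a b d] proper[of a b e] proper[of a c d] proper[of a c e] proper[of a d e]
    proper[of b a c] proper[of b a d] proper[of b a e] proper[of b c d] proper[of b c e] proper[of b d e]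
    proper[of c a b] proper[of c a d] proper[of c a e] proper[of c b d] proper[of c b e] proper[of c d e]
    proper[of d a b] proper[of d a c] proper[of d a e] proper[of d b c] proper[of d b e] proper[of d c e]
    proper[of e a b] proper[of e a c] proper[of e a d] proper[of e b c] proper[of e b d] proper[of e c d]
  note paths = no_rainbow_P5'[of c a e b d] no_rainbow_P5'[of c b a e d] no_rainbow_P5'[of a c b d e]
    no_rainbow_P5'[of a c b e d] no_rainbow_P5'[of c a b e d] no_rainbow_P5'[of c a b d e]
  note commute = col_commute[of b a] col_commute[of c a] col_commute[of d a] col_commute[of e a]
    col_commute[of c b] col_commute[of d b] col_commute[of e b] col_commute[of d c] col_commute[of e c] col_commute[of e d]
  show False using pr paths assms unfolding commute by simp (smt (verit))
qed

end

section \<open>Embeddings and packings\<close>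

text \<open>As the sets \<open>S i\<close> are disjoint, the vertices of \<open>Z\<close> in class
  \<open>i\<close> fill exactly the used part of \<open>S i\<close>. Equal numbers are removed from
  the class and from \<open>S i\<close>, so the remaining vertices still fit.\<close>

lemma extend_injection:
  assumes N: "finite N" "Z \<subseteq> N" and \<phi>0: "inj_on \<phi>0 Z" "\<And>v. v \<in> Z \<Longrightarrow> \<phi>0 v \<in> S (\<kappa> v)"
    and S: "\<And>i. finite (S i)" "\<And>i j. i \<noteq> j \<Longrightarrow> S i \<inter> S j = {}"
    and card: "\<And>i. card {v \<in> N. \<kappa> v = i} \<le> card (S i)"
  shows "\<exists>\<phi>. inj_on \<phi> N \<and> (\<forall>v\<in>N. \<phi> v \<in> S (\<kappa> v)) \<and> (\<forall>v\<in>Z. \<phi> v = \<phi>0 v)"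
proof -
  have "\<exists>f. inj_on f {v \<in> N - Z. \<kappa> v = i} \<and> f ` {v \<in> N - Z. \<kappa> v = i} \<subseteq> S i - \<phi>0 ` Z" for i
  proof -
    have fin: "finite Z" using N finite_subset by blast
    have "card {v \<in> N. \<kappa> v = i} = card {v \<in> N - Z. \<kappa> v = i} + card {v \<in> Z. \<kappa> v = i}"
      using N fin by (subst card_Un_disjoint[symmetric]) (auto intro: arg_cong[where f=card])
    moreover have "card {v \<in> Z. \<kappa> v = i} = card (\<phi>0 ` {v \<in> Z. \<kappa> v = i})"
      using \<phi>0(1) by (intro card_image[symmetric]) (auto intro: inj_on_subset)
    moreover have "\<phi>0 ` {v \<in> Z. \<kappa> v = i} = S i \<inter> \<phi>0 ` Z"
      using \<phi>0(2) S(2) by fastforce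
    moreover have "card (S i) = card (S i - \<phi>0 ` Z) + card (S i \<inter> \<phi>0 ` Z)"
      using S(1) by (subst card_Un_disjoint[symmetric]) (auto intro: arg_cong[where f=card])
    ultimately have "card {v \<in> N - Z. \<kappa> v = i} \<le> card (S i - \<phi>0 ` Z)" using card[of i] by simp
    then show ?thesis using card_le_inj[of "{v \<in> N - Z. \<kappa> v = i}" "S i - \<phi>0 ` Z"] N S(1) by auto
  qed
  then have "\<exists>f. \<forall>i. inj_on (f i) {v \<in> N - Z. \<kappa> v = i} \<and> f i ` {v \<in> N - Z. \<kappa> v = i} \<subseteq> S i - \<phi>0 ` Z"
    by (intro choice allI)
  then obtain f where f: "\<And>i. inj_on (f i) {v \<in> N - Z. \<kappa> v = i}"
    "\<And>i. f i ` {v \<in> N - Z. \<kappa> v = i} \<subseteq> S i - \<phi>0 ` Z" by blast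
  define \<phi> where "\<phi> v = (if v \<in> Z then \<phi>0 v else f (\<kappa> v) v)" for v
  have new: "\<phi> v \<in> S (\<kappa> v) - \<phi>0 ` Z" if "v \<in> N - Z" for v using f(2)[of "\<kappa> v"] that by (auto simp: \<phi>_def)
  have in_S: "\<phi> v \<in> S (\<kappa> v)" if "v \<in> N" for v using new[of v] \<phi>0(2) that by (cases "v \<in> Z") (auto simp: \<phi>_def)
  have "inj_on \<phi> N"
  proof (rule inj_onI)
    fix u v assume uv: "u \<in> N" "v \<in> N" "\<phi> u = \<phi> v"
    have \<kappa>: "\<kappa> u = \<kappa> v" using in_S[OF uv(1)] in_S[OF uv(2)] uv(3) S(2) by auto
    consider "u \<in> Z" "v \<in> Z" | "u \<notin> Z" "v \<notin> Z" | "u \<in> Z" "v \<notin> Z" | "u \<notin> Z" "v \<in> Z" by blast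
    then show "u = v"
    proof cases
      case 1 then show ?thesis using uv \<phi>0(1) by (auto simp: \<phi>_def inj_on_def)
    next
      case 2 then show ?thesis using uv \<kappa> f(1)[of "\<kappa> u"] by (auto simp: \<phi>_def inj_on_def)
    next
      case 3 then show ?thesis using uv new[of v] by (metis DiffE DiffI \<phi>_def imageI)
    next
      case 4 then show ?thesis using uv new[of u] by (metis DiffE DiffI \<phi>_def imageI)
    qed
  qed
  then show ?thesis using in_S by (intro exI[of _ \<phi>]) (auto simp: \<phi>_def)
qed

text \<open>Only non-isolated vertices are placed; \<open>mono_copy_iff\<close> brings the isolated
  ones back through a bound on the number of vertices.\<close>

definition embeds :: "'a set set \<Rightarrow> nat \<Rightarrow> (nat \<Rightarrow> nat \<Rightarrow> 'c) \<Rightarrow> 'c \<Rightarrow> bool" where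
  "embeds E n d k \<longleftrightarrow> (\<exists>\<phi>. inj_on \<phi> (\<Union>E) \<and> \<phi> ` \<Union>E \<subseteq> {..<n} \<and>
     (\<forall>u v. {u, v} \<in> E \<longrightarrow> d (\<phi> u) (\<phi> v) = k))"

text \<open>The Ramsey property for three colors, with colorings as symmetric functions of two
  vertices so that explicit ones can be given by formulas; the values on the diagonal have no
  meaning.\<close>

definition arrows3 :: "'a set set \<Rightarrow> nat \<Rightarrow> bool" where
  "arrows3 E n \<longleftrightarrow> (\<forall>d :: nat \<Rightarrow> nat \<Rightarrow> nat. (\<forall>x y. d x y = d y x) \<longrightarrow> (\<forall>x y. d x y < 3) \<longrightarrow>
     (\<exists>k<3. embeds E n d k))"

lemma arrows3E:
  fixes d :: "nat \<Rightarrow> nat \<Rightarrow> nat"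
  assumes "arrows3 E n" "\<And>x y. d x y = d y x" "\<And>x y. d x y < 3"
  obtains k \<phi> where "k \<in> {0, 1, 2}" "inj_on \<phi> (\<Union>E)" "\<And>v. v \<in> \<Union>E \<Longrightarrow> \<phi> v < n"
    "\<And>u v. {u, v} \<in> E \<Longrightarrow> d (\<phi> u) (\<phi> v) = k"
proof -
  obtain k where "k < 3" "embeds E n d k" using assms unfolding arrows3_def by blast
  then obtain \<phi> where "inj_on \<phi> (\<Union>E)" "\<phi> ` \<Union>E \<subseteq> {..<n}" "\<forall>u v. {u, v} \<in> E \<longrightarrow> d (\<phi> u) (\<phi> v) = k"
    unfolding embeds_def by blast
  moreover have "k \<in> {0, 1, 2}" using \<open>k < 3\<close> by auto
  ultimately show ?thesis by (intro that[of k \<phi>]) auto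
qed

lemma embedsI:
  assumes "inj_on \<phi> (\<Union>E)" "\<And>v. v \<in> \<Union>E \<Longrightarrow> \<phi> v < n" "\<And>u v. {u, v} \<in> E \<Longrightarrow> d (\<phi> u) (\<phi> v) = k"
  shows "embeds E n d k"
  using assms unfolding embeds_def by blast

text \<open>An item exceeding both bins would give
  \<open>p + q + 2 \<le> 2 * y a \<le> sum y A + g\<close>, where \<open>A\<close> includes
  \<open>a\<close>, against the assumption. So each item fits somewhere, and shrinking that bin by
  \<open>y a\<close> preserves the inequality.\<close>

lemma two_bin_packing:
  fixes y :: "'b \<Rightarrow> nat"
  assumes "finite A" "\<And>i. i \<in> A \<Longrightarrow> y i \<le> g" "sum y A + g \<le> p + q + 1"
  shows "\<exists>I\<subseteq>A. sum y I \<le> p \<and> sum y (A - I) \<le> q"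
  using assms
proof (induction A arbitrary: p q rule: finite_induct)
  case (insert a A)
  consider "y a \<le> p" | "y a \<le> q" "p < y a"
    using insert by fastforce
  then show ?case
  proof cases
    case 1
    then have "\<exists>I\<subseteq>A. sum y I \<le> p - y a \<and> sum y (A - I) \<le> q" using insert by (intro insert.IH) auto
    then obtain I where I: "I \<subseteq> A" "sum y I \<le> p - y a" "sum y (A - I) \<le> q" by blast
    have "a \<notin> I" "finite I" using I insert finite_subset by auto
    moreover have "insert a A - insert a I = A - I" using insert by auto
    ultimately show ?thesis using I 1 by (intro exI[of _ "insert a I"]) auto
  next
    case 2
    then have "\<exists>I\<subseteq>A. sum y I \<le> p \<and> sum y (A - I) \<le> q - y a" using insert by (intro insert.IH) auto
    then obtain I where I: "I \<subseteq> A" "sum y I \<le> p" "sum y (A - I) \<le> q - y a" by blast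
    have "insert a A - I = insert a (A - I)" using I insert by auto
    then have "sum y (insert a A - I) = y a + sum y (A - I)" using insert by auto
    then show ?thesis using I 2 by (intro exI[of _ I]) auto
  qed
qed auto

text \<open>A label \<open>i\<close> in such an \<open>L\<close> cuts the vertices into the class of
  \<open>i\<close>, the classes of \<open>L - {i}\<close> and those outside \<open>L\<close>, with
  controlled sizes.\<close>

lemma minimal_label_union:
  fixes l :: "'b \<Rightarrow> 'c"
  assumes "finite S" "m \<le> card S" "m > 0"
  obtains L where "L \<noteq> {}" "m \<le> card {x \<in> S. l x \<in> L}" "\<And>i. i \<in> L \<Longrightarrow> card {x \<in> S. l x \<in> L - {i}} < m"
proof -
  let ?P = "\<lambda>L. m \<le> card {x \<in> S. l x \<in> L} \<and> finite L"
  have "{x \<in> S. l x \<in> l ` S} = S" by auto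
  then have "?P (l ` S)" using assms by auto
  then obtain L where L: "?P L" and min: "\<And>L'. ?P L' \<Longrightarrow> card L \<le> card L'"
    using ex_has_least_nat[of ?P "l ` S" card] by blast
  have "L \<noteq> {}" using L assms by auto
  moreover have "card {x \<in> S. l x \<in> L - {i}} < m" if "i \<in> L" for i
    using min[of "L - {i}"] L that card_Diff1_less[of L i] by fastforce
  ultimately show ?thesis using that L by blast
qed

text \<open>Without the sets \<open>A\<close> and \<open>B\<close>, of any union of classes and its
  complement one has fewer than \<open>t\<close> elements. For a minimal \<open>L\<close> reaching
  \<open>t\<close>, the complement is below \<open>t\<close>, so the union has at least
  \<open>2 * t\<close> elements. Dropping a label \<open>i\<close> leaves fewer than
  \<open>t\<close>, so the class of \<open>i\<close> reaches \<open>t\<close>, and then its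
  complement is below \<open>t\<close> as well.\<close>

lemma class_or_cross_pairs:
  fixes l :: "'b \<Rightarrow> 'c"
  assumes "finite U" "3 * t \<le> card U + 1" "t \<ge> 1"
  shows "(\<exists>i. 2 * t \<le> card {x \<in> U. l x = i}) \<or>
    (\<exists>A B. A \<subseteq> U \<and> B \<subseteq> U \<and> card A = t \<and> card B = t \<and> (\<forall>a\<in>A. \<forall>b\<in>B. l a \<noteq> l b))"
proof (rule disjCI)
  assume no_pairs: "\<not> (\<exists>A B. A \<subseteq> U \<and> B \<subseteq> U \<and> card A = t \<and> card B = t \<and> (\<forall>a\<in>A. \<forall>b\<in>B. l a \<noteq> l b))"
  have split: "\<not> (t \<le> card {x \<in> U. l x \<in> L} \<and> t \<le> card {x \<in> U. l x \<notin> L})" for L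
  proof
    assume "t \<le> card {x \<in> U. l x \<in> L} \<and> t \<le> card {x \<in> U. l x \<notin> L}"
    then obtain A B where "A \<subseteq> {x \<in> U. l x \<in> L}" "card A = t" "B \<subseteq> {x \<in> U. l x \<notin> L}" "card B = t"
      by (meson obtain_subset_with_card_n)
    then have "A \<subseteq> U \<and> B \<subseteq> U \<and> card A = t \<and> card B = t \<and> (\<forall>a\<in>A. \<forall>b\<in>B. l a \<noteq> l b)" by fastforce
    then show False using no_pairs by blast
  qed
  have compl: "card {x \<in> U. l x \<in> L} + card {x \<in> U. l x \<notin> L} = card U" for L
    using assms(1) by (subst card_Un_disjoint[symmetric]) (auto intro: arg_cong[where f=card])
  obtain L where L: "L \<noteq> {}" "t \<le> card {x \<in> U. l x \<in> L}"
    "\<And>i. i \<in> L \<Longrightarrow> card {x \<in> U. l x \<in> L - {i}} < t"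
    by (rule minimal_label_union[of U t l]) (use assms in auto)
  then obtain i where i: "i \<in> L" by blast
  have "card {x \<in> U. l x \<in> L} \<le> card {x \<in> U. l x \<in> L - {i}} + card {x \<in> U. l x = i}"
    using assms(1) by (intro order_trans[OF _ card_Un_le] card_mono) auto
  then have "t \<le> card {x \<in> U. l x = i}" if "2 * t \<le> card {x \<in> U. l x \<in> L}"
    using that L(3)[OF i] by linarith
  moreover have "2 * t \<le> card {x \<in> U. l x \<in> L}"
    using split[of L] compl[of L] L(2) assms by linarith
  ultimately have "t \<le> card {x \<in> U. l x \<in> {i}}" by simp
  then have "2 * t \<le> card {x \<in> U. l x \<in> {i}}" using split[of "{i}"] compl[of "{i}"] assms by linarith
  then show "\<exists>i. 2 * t \<le> card {x \<in> U. l x = i}" by auto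
qed

lemma embeds_if_one_edge:
  assumes fin: "finite (\<Union>E)" and card2: "\<And>e. e \<in> E \<Longrightarrow> card e = 2" and n: "card (\<Union>E) \<le> n"
    and one: "\<And>e f. e \<in> E \<Longrightarrow> f \<in> E \<Longrightarrow> e = f" and c: "\<And>x y. c x y = c y x"
  shows "\<exists>k. embeds E n c k"
proof -
  obtain \<phi> where \<phi>: "inj_on \<phi> (\<Union>E)" "\<phi> ` \<Union>E \<subseteq> {..<n}"
    using card_le_inj[OF fin finite_lessThan, of n] n by auto
  show ?thesis
  proof (cases "E = {}")
    case True
    then show ?thesis using \<phi> unfolding embeds_def by auto
  next
    case False
    then obtain a b where ab: "{a, b} \<in> E" using card2 by (metis all_not_in_conv card_2_iff)
    have "c (\<phi> u) (\<phi> v) = c (\<phi> a) (\<phi> b)" if "{u, v} \<in> E" for u v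
      using one[OF ab that] c by (auto simp: doubleton_eq_iff)
    then have "embeds E n c (c (\<phi> a) (\<phi> b))" using \<phi> unfolding embeds_def by blast
    then show ?thesis by blast
  qed
qed

section \<open>Graphs whose components are bipartite up to one edge\<close>

text \<open>
  \<open>K\<close> is the set of components with at least one edge, \<open>Kc\<close> of those that are not bipartite, and
  \<open>\<sigma>\<close> marks one side of every component; \<open>{zc C, xc C}\<close> is the only edge of \<open>C \<in> Kc\<close> inside a side.
\<close>

locale near_bipartite_graph =
  fixes E K Kc :: "'a set set" and \<sigma> :: "'a \<Rightarrow> bool" and zc xc :: "'a set \<Rightarrow> 'a"
  assumes finite_N: "finite (\<Union>E)" and card_edge: "e \<in> E \<Longrightarrow> card e = 2"
    and Union_K: "\<Union>K = \<Union>E" and disjoint_K: "\<lbrakk>C \<in> K; D \<in> K; C \<noteq> D\<rbrakk> \<Longrightarrow> C \<inter> D = {}"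
    and edge_in_K: "e \<in> E \<Longrightarrow> \<exists>C\<in>K. e \<subseteq> C"
    and Kc_K: "Kc \<subseteq> K"
    and proper: "{u, v} \<in> E \<Longrightarrow> \<sigma> u \<noteq> \<sigma> v \<or> (\<exists>C\<in>Kc. {u, v} = {zc C, xc C})"
    and zx: "C \<in> Kc \<Longrightarrow> zc C \<in> C \<and> xc C \<in> C \<and> zc C \<noteq> xc C \<and> \<sigma> (zc C) \<and> \<sigma> (xc C)"
    and odd: "C \<in> Kc \<Longrightarrow> \<exists>u v. {u, v} \<in> E \<and> {u, v} \<subseteq> C \<and> f u = (f v :: bool)"
    and conn: "\<lbrakk>C \<in> Kc; \<And>u v. {u, v} \<in> E \<Longrightarrow> {u, v} \<subseteq> C \<Longrightarrow> g u = g v; u \<in> C; v \<in> C\<rbrakk> \<Longrightarrow> g u = (g v :: nat)"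
    and small_side: "C \<in> K - Kc \<Longrightarrow> card {v \<in> C. \<not> \<sigma> v} \<le> card {v \<in> C. \<sigma> v}"
begin

definition N where "N = \<Union>E"
definition h where "h = card N"
definition t where "t = card Kc"
text \<open>For \<open>C \<in> Kc\<close> this counts the side without the extra edge, even if it is
  the larger one; for the other components it counts the smaller side.\<close>

definition y where "y C = card {v \<in> C. \<not> \<sigma> v}"

section \<open>Sizes of components and of their sides\<close>

lemma finite_K: "finite K"
  using Union_K finite_N finite_UnionD by metis

lemma finite_Kc: "finite Kc"
  using finite_K Kc_K finite_subset by blast

lemma K_subset: "C \<in> K \<Longrightarrow> C \<subseteq> N"
  using Union_K N_def by blast

lemma finite_in_K: "C \<in> K \<Longrightarrow> finite C"
  using K_subset finite_N N_def finite_subset by metis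

lemma edge_verts: assumes "{u, v} \<in> E" shows "u \<noteq> v" "u \<in> N" "v \<in> N"
  using card_edge[OF assms] assms N_def by (auto simp: card_2_iff)

lemma K_unique: "\<lbrakk>C \<in> K; D \<in> K; v \<in> C; v \<in> D\<rbrakk> \<Longrightarrow> C = D"
  using disjoint_K by blast

lemma card_K: assumes "C \<in> K" shows "card C = card {v \<in> C. \<sigma> v} + y C"
  unfolding y_def using finite_in_K[OF assms]
  by (subst card_Un_disjoint[symmetric]) (auto intro: arg_cong[where f=card])

text \<open>If all of \<open>C\<close> were marked, every edge in \<open>C\<close> would be the
  extra edge, and distinguishing \<open>zc C\<close> from the rest would be a proper two-coloring,
  against \<open>odd\<close>.\<close>

lemma other_side: assumes "C \<in> Kc" shows "\<exists>v\<in>C. \<not> \<sigma> v"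
proof (rule ccontr)
  assume c: "\<not> ?thesis"
  obtain u v where uv: "{u, v} \<in> E" "{u, v} \<subseteq> C" "(u = zc C) = (v = zc C)"
    using odd[OF assms, of "\<lambda>u. u = zc C"] by blast
  then obtain D where D: "D \<in> Kc" "{u, v} = {zc D, xc D}" using proper[of u v] c by auto
  then have "zc D \<in> C" "zc D \<in> D" using uv(2) zx[of D] by auto
  then have "D = C" using K_unique[of D C "zc D"] Kc_K assms D(1) by blast
  then show False using D uv zx[of C] assms by (auto simp: doubleton_eq_iff)
qed

lemma y_pos: "C \<in> Kc \<Longrightarrow> 1 \<le> y C"
proof -
  assume C: "C \<in> Kc"
  then have "{v \<in> C. \<not> \<sigma> v} \<noteq> {}" using other_side by auto
  then show ?thesis using finite_in_K[of C] Kc_K C unfolding y_def by (simp add: Suc_le_eq card_gt_0_iff subsetD)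
qed

text \<open>Both ends of the extra edge lie on the marked side.\<close>

lemma y_le: assumes "C \<in> Kc" shows "y C + 2 \<le> card C"
proof -
  have "{zc C, xc C} \<subseteq> {v \<in> C. \<sigma> v}" using zx[OF assms] by auto
  moreover have "card {zc C, xc C} = 2" using zx[OF assms] by simp
  moreover have "finite {v \<in> C. \<sigma> v}" using finite_in_K[of C] Kc_K assms by auto
  ultimately have "2 \<le> card {v \<in> C. \<sigma> v}" using card_mono[of "{v \<in> C. \<sigma> v}" "{zc C, xc C}"] by simp
  then show ?thesis using card_K[of C] Kc_K assms by auto
qed

lemma card_Kc: "C \<in> Kc \<Longrightarrow> 3 \<le> card C"
  using y_pos y_le by fastforce

lemma y_half: "C \<in> K - Kc \<Longrightarrow> 2 * y C \<le> card C"
  using small_side[of C] card_K[of C] by (simp add: y_def)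

lemma h_sum: "h = (\<Sum>C\<in>K. card C)"
  unfolding h_def N_def Union_K[symmetric]
  using finite_in_K disjoint_K by (intro card_Union_disjoint) (auto simp: pairwise_def disjnt_def)

lemma h_ge_3t: "3 * t \<le> h"
proof -
  have "3 * t = (\<Sum>C\<in>Kc. 3)" by (simp add: t_def)
  also have "\<dots> \<le> (\<Sum>C\<in>Kc. card C)" using card_Kc by (intro sum_mono) auto
  also have "\<dots> \<le> (\<Sum>C\<in>K. card C)" using Kc_K finite_K by (intro sum_mono2) auto
  finally show ?thesis using h_sum by simp
qed

lemma h_ge_critical: assumes "C \<in> Kc" shows "card C + 3 * t \<le> h + 3"
proof -
  have "3 * card (Kc - {C}) = (\<Sum>C\<in>Kc - {C}. 3)" by simp
  also have "\<dots> \<le> (\<Sum>C\<in>Kc - {C}. card C)" using card_Kc by (intro sum_mono) auto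
  also have "\<dots> \<le> (\<Sum>C\<in>K - {C}. card C)" using Kc_K finite_K by (intro sum_mono2) auto
  finally have "3 * card (Kc - {C}) \<le> (\<Sum>C\<in>K - {C}. card C)" .
  moreover have "h = card C + (\<Sum>C\<in>K - {C}. card C)"
    unfolding h_sum using assms Kc_K finite_K by (intro sum.remove) auto
  moreover have "card (Kc - {C}) + 1 = t" unfolding t_def using assms finite_Kc by (metis Suc_eq_plus1 card.remove)
  ultimately show ?thesis by linarith
qed

lemma h_ge_bipartite: assumes "C \<in> K - Kc" shows "card C + 3 * t \<le> h"
proof -
  have "3 * t = (\<Sum>C\<in>Kc. 3)" by (simp add: t_def)
  also have "\<dots> \<le> (\<Sum>C\<in>Kc. card C)" using card_Kc by (intro sum_mono) auto
  also have "\<dots> \<le> (\<Sum>C\<in>K - {C}. card C)" using Kc_K finite_K assms by (intro sum_mono2) auto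
  finally show ?thesis
    unfolding h_sum using assms finite_K by (subst sum.remove[of K C]) auto
qed

lemma sum_y: "sum y K + 2 * t \<le> h"
proof -
  have "sum y K + 2 * t = (\<Sum>C\<in>K. y C + (if C \<in> Kc then 2 else 0))"
    using finite_K Kc_K by (simp add: sum.distrib sum.If_cases t_def Int_absorb1)
  also have "\<dots> \<le> (\<Sum>C\<in>K. card C)"
  proof (rule sum_mono)
    fix C assume "C \<in> K"
    then have "y C \<le> card C" using card_K by simp
    then show "y C + (if C \<in> Kc then 2 else 0) \<le> card C" using y_le by auto
  qed
  finally show ?thesis using h_sum by simp
qed

section \<open>Lower bounds on the number of vertices from explicit colorings\<close>

lemma incident_edge: "v \<in> N \<Longrightarrow> \<exists>u. {v, u} \<in> E"
  unfolding N_def using card_edge by (fastforce simp: card_2_iff insert_commute)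

text \<open>Two blocks of \<open>h - 1\<close> vertices get colors 1 and 2 inside and are too small
  for a copy; all other edges get color 0. Edges of color 0 that avoid the vertices from
  \<open>2 * h - 2\<close> on are bipartite, so each non-bipartite component occupies one of these
  vertices, and there must be at least \<open>t\<close> of them.\<close>

lemma arrows3_card_bound:
  assumes arr: "arrows3 E n" and t: "t \<ge> 1"
  shows "2 * h + t \<le> n + 2"
proof (rule ccontr)
  assume neg: "\<not> ?thesis"
  have h3: "h \<ge> 3" using h_ge_3t t by simp
  define d :: "nat \<Rightarrow> nat \<Rightarrow> nat" where "d x y = (if (x < h - 1) \<noteq> (y < h - 1) then 0 else if x < h - 1 then 1
     else if 2 * h - 2 \<le> x \<or> 2 * h - 2 \<le> y then 0 else 2)" for x y
  obtain k \<phi> where k: "k \<in> {0, 1, 2}" and \<phi>: "inj_on \<phi> (\<Union>E)" "\<And>v. v \<in> \<Union>E \<Longrightarrow> \<phi> v < n"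
    and col: "\<And>u v. {u, v} \<in> E \<Longrightarrow> d (\<phi> u) (\<phi> v) = k"
    by (rule arrows3E[OF arr, of d]) (auto simp: d_def)
  have big: "h \<le> card S" if "\<phi> ` N \<subseteq> S" "finite S" for S
    using card_mono[OF that(2,1)] card_image[OF \<phi>(1)] unfolding h_def N_def by simp
  have k12: "k = 0"
  proof (rule ccontr)
    assume "k \<noteq> 0"
    then consider "k = 1" | "k = 2" using k by auto
    then show False
    proof cases
      case 1
      have "\<phi> v < h - 1" if "v \<in> N" for v
        using incident_edge[OF that] col 1 by (fastforce simp: d_def split: if_splits)
      then have "\<phi> ` N \<subseteq> {..<h - 1}" by auto
      from big[OF this] show False using h3 by simp
    next
      case 2
      have "h - 1 \<le> \<phi> v \<and> \<phi> v < 2 * h - 2" if "v \<in> N" for v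
        using incident_edge[OF that] col 2 by (fastforce simp: d_def split: if_splits)
      then have "\<phi> ` N \<subseteq> {h - 1..<2 * h - 2}" by auto
      from big[OF this] show False using h3 by simp
    qed
  qed
  have "\<exists>w\<in>C. 2 * h - 2 \<le> \<phi> w" if C: "C \<in> Kc" for C
  proof -
    obtain u v where uv: "{u, v} \<in> E" "{u, v} \<subseteq> C" "(\<phi> u < h - 1) = (\<phi> v < h - 1)"
      using odd[OF C, of "\<lambda>u. \<phi> u < h - 1"] by blast
    then show ?thesis using col[OF uv(1)] k12 by (auto simp: d_def split: if_splits)
  qed
  then obtain w where w: "\<And>C. C \<in> Kc \<Longrightarrow> w C \<in> C \<and> 2 * h - 2 \<le> \<phi> (w C)" by metis
  have "inj_on (\<lambda>C. \<phi> (w C)) Kc"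
  proof (rule inj_onI)
    fix C D assume CD: "C \<in> Kc" "D \<in> Kc" "\<phi> (w C) = \<phi> (w D)"
    then have "w C \<in> N" "w D \<in> N" using w K_subset Kc_K by blast+
    then have "w C = w D" using CD \<phi>(1) unfolding N_def inj_on_def by blast
    then show "C = D" using w CD K_unique Kc_K by (metis subsetD)
  qed
  moreover have "(\<lambda>C. \<phi> (w C)) ` Kc \<subseteq> {2 * h - 2..<n}"
    using w \<phi>(2) K_subset Kc_K unfolding N_def by fastforce
  ultimately have "t \<le> card {2 * h - 2..<n}" unfolding t_def using card_inj_on_le by blast
  then show False using neg t by auto
qed

text \<open>Four blocks of \<open>card C - 1\<close> vertices get color 2 inside, too little room
  for the connected \<open>C\<close>. Color 0 joins blocks of different parity and color 1 blocks of
  the same parity; both are bipartite, the latter because it joins block 0 to 2 and 1 to 3.\<close>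

lemma arrows3_critical_bound:
  assumes arr: "arrows3 E n" and C: "C \<in> Kc"
  shows "4 * card C \<le> n + 3"
proof (rule ccontr)
  assume neg: "\<not> ?thesis"
  define s where "s = card C - 1"
  have s: "s \<ge> 2" "n \<le> 4 * s" "card C = Suc s" using card_Kc[OF C] neg unfolding s_def by auto
  define q where "q x = x div s" for x
  define d :: "nat \<Rightarrow> nat \<Rightarrow> nat" where "d x y = (if q x = q y then 2
     else if even (q x) \<noteq> even (q y) then 0 else 1)" for x y
  obtain k \<phi> where k: "k \<in> {0, 1, 2}" and \<phi>: "inj_on \<phi> (\<Union>E)" "\<And>v. v \<in> \<Union>E \<Longrightarrow> \<phi> v < n"
    and col: "\<And>u v. {u, v} \<in> E \<Longrightarrow> d (\<phi> u) (\<phi> v) = k"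
    by (rule arrows3E[OF arr, of d]) (auto simp: d_def)
  have q4: "q (\<phi> v) < 4" if "v \<in> N" for v
    using \<phi>(2)[of v] that s(1,2) unfolding N_def q_def by (intro less_mult_imp_div_less) auto
  have "k \<noteq> 0"
  proof -
    obtain u v where uv: "{u, v} \<in> E" "even (q (\<phi> u)) = even (q (\<phi> v))"
      using odd[OF C, of "\<lambda>u. even (q (\<phi> u))"] by blast
    then show ?thesis using col[OF uv(1)] by (auto simp: d_def split: if_splits)
  qed
  moreover have "k \<noteq> 1"
  proof
    assume "k = 1"
    obtain u v where uv: "{u, v} \<in> E" "(q (\<phi> u) < 2) = (q (\<phi> v) < 2)"
      using odd[OF C, of "\<lambda>u. q (\<phi> u) < 2"] by blast
    have "q (\<phi> u) < 4" "q (\<phi> v) < 4" using q4 edge_verts[OF uv(1)] by auto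
    moreover have "d (\<phi> u) (\<phi> v) = 1" using col[OF uv(1)] \<open>k = 1\<close> by simp
    then have "q (\<phi> u) \<noteq> q (\<phi> v) \<and> even (q (\<phi> u)) = even (q (\<phi> v))"
      unfolding d_def by (cases "q (\<phi> u) = q (\<phi> v)"; cases "even (q (\<phi> u)) = even (q (\<phi> v))"; simp)
    moreover have "(a < 2) \<noteq> (b < 2)" if "a < 4" "b < 4" "a \<noteq> b" "even a = even b" for a b :: nat
      using that by presburger
    ultimately show False using uv(2) by blast
  qed
  moreover have "k \<noteq> 2"
  proof
    assume k: "k = 2"
    obtain v where v: "v \<in> C" using zx[OF C] by blast
    have "q (\<phi> a) = q (\<phi> b)" if "{a, b} \<in> E" for a b
      using col[OF that] k unfolding d_def by (cases "q (\<phi> a) = q (\<phi> b)"; cases "even (q (\<phi> a)) = even (q (\<phi> b))"; simp)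
    \<comment> \<open>Connectivity of \<open>C\<close> is available as constancy of functions that
      do not change along edges; here the function is the block number.\<close>
    then have same: "q (\<phi> u) = q (\<phi> v)" if "u \<in> C" for u
      using conn[OF C, of "\<lambda>u. q (\<phi> u)" u v] that v by blast
    have "\<phi> ` C \<subseteq> {\<phi> v div s * s..<\<phi> v div s * s + s}"
    proof
      fix x assume "x \<in> \<phi> ` C"
      then have "x div s = \<phi> v div s" using same unfolding q_def by auto
      then have "x = \<phi> v div s * s + x mod s" by (metis div_mult_mod_eq)
      moreover have "x mod s < s" using s by simp
      ultimately show "x \<in> {\<phi> v div s * s..<\<phi> v div s * s + s}" by (metis add_less_cancel_left atLeastLessThan_iff le_add1)
    qed
    then have "card (\<phi> ` C) \<le> s" using card_mono[of "{\<phi> v div s * s..<\<phi> v div s * s + s}" "\<phi> ` C"] by simp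
    moreover have "inj_on \<phi> C" using \<phi>(1) K_subset Kc_K C unfolding N_def by (meson inj_on_subset subsetD)
    ultimately show False using s card_image by fastforce
  qed
  ultimately show False using k by auto
qed

text \<open>
  At most two components have \<open>3 * y C \<ge> h + 2 * t\<close>; they are placed by hand and the others greedily.
\<close>

lemma component_bins:
  assumes t: "t \<ge> 1" and n: "2 * h + t \<le> P + Q + R + 2"
    and s: "\<And>C. C \<in> Kc \<Longrightarrow> 4 * card C \<le> P + Q + R + 3"
    and PQR: "Q \<le> P" "R \<le> Q" "P + 2 \<le> h"
  shows "\<exists>I\<subseteq>K. sum y I + t \<le> P \<and> sum y (K - I) + t \<le> Q"
proof -
  \<comment> \<open>In each of the two bins \<open>t\<close> places are kept free for the ends
    \<open>xc C\<close> of the extra edges.\<close>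
  define p where "p = P - t"
  define q where "q = Q - t"
  \<comment> \<open>\<open>R\<close> is at most \<open>Q\<close> and at most the mean of
    \<open>P\<close> and \<open>Q\<close>. With \<open>P + 2 \<le> h\<close>, this turns
    \<open>n\<close> into lower bounds on \<open>q\<close>, \<open>p\<close> and
    \<open>p + q\<close>.\<close>
  have pq: "P = p + t" "Q = q + t" "2 * q + t \<ge> h" "3 * p + 2 * t + 2 \<ge> 2 * h"
    "3 * (p + q) + 4 * t + 4 \<ge> 4 * h"
    using n PQR h_ge_3t t unfolding p_def q_def by auto
  \<comment> \<open>A non-bipartite component may have almost all its vertices on the unmarked side;
    the bound \<open>s\<close> on \<open>card C\<close> makes it fit into the first bin.\<close>
  have yp: "y C \<le> p" if "C \<in> K" for C
  proof (cases "C \<in> Kc")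
    case True
    then show ?thesis using s[OF True] h_ge_critical[OF True] y_le[OF True] n PQR pq t by linarith
  next
    case False
    then have "2 * y C + 3 * t \<le> h" using h_ge_bipartite[of C] y_half[of C] that by auto
    then show ?thesis using pq t h_ge_3t by linarith
  qed
  \<comment> \<open>The largest integer with \<open>3 * g < h + 2 * t\<close>. By
    \<open>sum_y\<close>, \<open>3 * (sum y K + g) \<le> 4 * h - 4 * t - 1 \<le> 3 * (p + q) +
    3\<close>, as \<open>two_bin_packing\<close> demands.\<close>
  define g where "g = (h + 2 * t - 1) div 3"
  have "3 * g + 1 \<le> h + 2 * t" using t unfolding g_def by simp
  then have g: "sum y K + g \<le> p + q + 1" using pq sum_y by simp
  have pack: ?thesis if IJ: "I \<subseteq> K" "J \<subseteq> K" "I \<inter> J = {}" "sum y I \<le> p" "sum y J \<le> q"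
    and small: "\<And>C. C \<in> K - I - J \<Longrightarrow> y C \<le> g" for I J
  proof -
    have fin: "finite I" "finite J" using IJ finite_K finite_subset by auto
    have "I \<union> J \<union> (K - I - J) = K" using IJ by blast
    then have dec: "sum y K = sum y I + sum y J + sum y (K - I - J)"
      using sum.union_disjoint[of "I \<union> J" "K - I - J" y] sum.union_disjoint[of I J y] fin finite_K IJ(3) by auto
    have "\<exists>M\<subseteq>K - I - J. sum y M \<le> p - sum y I \<and> sum y (K - I - J - M) \<le> q - sum y J"
      using small g dec IJ finite_K by (intro two_bin_packing[where g = g]) auto
    then obtain M where M: "M \<subseteq> K - I - J" "sum y M \<le> p - sum y I" "sum y (K - I - J - M) \<le> q - sum y J" by blast
    have "finite M" using M finite_K finite_subset by blast
    then have "sum y (I \<union> M) = sum y I + sum y M" using M fin by (intro sum.union_disjoint) auto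
    moreover have "K - (I \<union> M) = J \<union> (K - I - J - M)" using M IJ by blast
    then have "sum y (K - (I \<union> M)) = sum y J + sum y (K - I - J - M)"
      using sum.union_disjoint[of J "K - I - J - M" y] fin finite_K by auto
    ultimately show ?thesis using M IJ pq by (intro exI[of _ "I \<union> M"]) auto
  qed
  define B where "B = {C \<in> K. g < y C}"
  have finB: "finite B" using finite_K unfolding B_def by auto
  have "card B * (h + 2 * t) = (\<Sum>C\<in>B. h + 2 * t)" by simp
  also have "\<dots> \<le> (\<Sum>C\<in>B. 3 * y C)" by (rule sum_mono) (auto simp: B_def g_def)
  also have "\<dots> \<le> 3 * sum y K" unfolding sum_distrib_left[symmetric]
    using finite_K by (intro mult_left_mono sum_mono2) (auto simp: B_def)
  finally have B3: "card B * (h + 2 * t) \<le> 3 * sum y K" .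
  have "card B < 3"
  proof (rule ccontr)
    assume "\<not> ?thesis"
    then have "3 * (h + 2 * t) \<le> card B * (h + 2 * t)" by (intro mult_right_mono) auto
    then have "3 * (h + 2 * t) \<le> 3 * sum y K" using B3 by (rule order_trans)
    then show False using sum_y t by simp
  qed
  then consider "card B = 0" | "card B = 1" | "card B = 2" by linarith
  then show ?thesis
  proof cases
    case 1
    then have "B = {}" using finB by simp
    then show ?thesis by (intro pack[of "{}" "{}"]) (auto simp: B_def)
  next
    case 2
    then obtain C where C: "B = {C}" by (auto simp: card_1_singleton_iff)
    then have "C \<in> K" by (auto simp: B_def)
    then show ?thesis using yp[of C] C by (intro pack[of "{C}" "{}"]) (auto simp: B_def)
  next
    case 3
    then obtain C D where CD: "B = {C, D}" "C \<noteq> D" "y D \<le> y C" by (metis card_2_iff insert_commute nle_le)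
    then have K: "C \<in> K" "D \<in> K" unfolding B_def by blast+
    \<comment> \<open>The smaller of the two has at most half of the total, so
      \<open>2 * y D \<le> h - 2 * t\<close>, and \<open>h \<le> 2 * q + t\<close>.\<close>
    have "sum y {C, D} \<le> sum y K" using K finite_K by (intro sum_mono2) auto
    then have "y D \<le> q" using CD sum_y pq by auto
    moreover have "\<And>A. A \<in> K - {C} - {D} \<Longrightarrow> y A \<le> g" using CD(1) unfolding B_def by force
    ultimately show ?thesis using yp[OF K(1)] K CD(2) by (intro pack[of "{C}" "{D}"]) auto
  qed
qed

text \<open>
  The smaller sides go to the first or second class according to the bins, one end of each extra edge to
  the third, the other end to the class not used by its bin, and the remaining vertices wherever there is room.
\<close>

lemma three_coloring:
  assumes t: "t \<ge> 1" and n: "2 * h + t \<le> P + Q + R + 2"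
    and s: "\<And>C. C \<in> Kc \<Longrightarrow> 4 * card C \<le> P + Q + R + 3"
    and PQR: "Q \<le> P" "R \<le> Q" "P + 2 \<le> h"
  shows "\<exists>\<kappa> :: 'a \<Rightarrow> nat. (\<forall>u v. {u, v} \<in> E \<longrightarrow> \<kappa> u \<noteq> \<kappa> v) \<and> (\<forall>v\<in>N. \<kappa> v < 3) \<and>
    card {v \<in> N. \<kappa> v = 0} \<le> P \<and> card {v \<in> N. \<kappa> v = 1} \<le> Q \<and> card {v \<in> N. \<kappa> v = 2} \<le> R"
proof -
  obtain I where I: "I \<subseteq> K" "sum y I + t \<le> P" "sum y (K - I) + t \<le> Q"
    using component_bins[OF assms] by blast
  have finN: "finite N" using finite_N N_def by simp
  define U where "U = \<Union>I"
  have U_iff: "v \<in> U \<longleftrightarrow> C \<in> I" if "C \<in> K" "v \<in> C" for v C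
    unfolding U_def using K_unique that I by blast
  define A where "A = {v \<in> N. \<not> \<sigma> v \<and> v \<in> U}"
  define B where "B = {v \<in> N. \<not> \<sigma> v \<and> v \<notin> U}"
  define Z where "Z = zc ` Kc"
  define XI where "XI = xc ` (Kc \<inter> I)"
  define XJ where "XJ = xc ` (Kc - I)"
  define DI where "DI = {v \<in> N. \<sigma> v \<and> v \<in> U} - Z - XI"
  define DJ where "DJ = {v \<in> N. \<sigma> v \<and> v \<notin> U} - Z - XJ"
  have ZN: "zc C \<in> N" "xc C \<in> N" "\<sigma> (zc C)" "\<sigma> (xc C)" if "C \<in> Kc" for C
    using zx[OF that] K_subset Kc_K that by blast+
  have ZZ: "\<sigma> v" if "v \<in> Z" for v using that ZN unfolding Z_def by auto
  have XI: "v \<in> N \<and> \<sigma> v \<and> v \<in> U" if "v \<in> XI" for v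
    using that ZN zx unfolding XI_def U_def by auto
  have XJ: "v \<in> N \<and> \<sigma> v \<and> v \<notin> U" if "v \<in> XJ" for v
    using that ZN zx U_iff Kc_K unfolding XJ_def by auto
  have ZX: "v \<notin> XI \<and> v \<notin> XJ" if "v \<in> Z" for v
  proof -
    have "zc C \<noteq> xc D" if "C \<in> Kc" "D \<in> Kc" for C D
    proof
      assume eq: "zc C = xc D"
      then have "C = D" using K_unique[of C D "zc C"] zx[OF that(1)] zx[OF that(2)] Kc_K that by auto
      then show False using zx[OF that(1)] eq by simp
    qed
    then show ?thesis using that unfolding Z_def XI_def XJ_def by auto
  qed
  have mem: "v \<in> A \<Longrightarrow> \<not> \<sigma> v \<and> v \<in> U" "v \<in> B \<Longrightarrow> \<not> \<sigma> v \<and> v \<notin> U"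
    "v \<in> DI \<Longrightarrow> \<sigma> v \<and> v \<in> U \<and> v \<notin> Z \<and> v \<notin> XI" "v \<in> DJ \<Longrightarrow> \<sigma> v \<and> v \<notin> U \<and> v \<notin> Z \<and> v \<notin> XJ" for v
    unfolding A_def B_def DI_def DJ_def by auto
  have fin: "finite A" "finite B" "finite Z" "finite XI" "finite XJ" "finite DI" "finite DJ"
    using finN finite_Kc unfolding A_def B_def Z_def XI_def XJ_def DI_def DJ_def by auto
  have card_side: "card (\<Union>C\<in>M. {v \<in> C. \<not> \<sigma> v}) = sum y M" if "M \<subseteq> K" for M
    unfolding y_def using that finite_K finite_in_K disjoint_K finite_subset
    by (intro card_UN_disjoint) (auto, blast+)
  have "A = (\<Union>C\<in>I. {v \<in> C. \<not> \<sigma> v})" using I(1) K_subset unfolding A_def U_def by blast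
  then have cA: "card A = sum y I" using card_side I(1) by simp
  have "B = (\<Union>C\<in>K - I. {v \<in> C. \<not> \<sigma> v})"
  proof (intro equalityI subsetI)
    fix v assume v: "v \<in> B"
    then obtain C where "C \<in> K" "v \<in> C" using Union_K unfolding B_def N_def by blast
    then show "v \<in> (\<Union>C\<in>K - I. {v \<in> C. \<not> \<sigma> v})" using U_iff v unfolding B_def by blast
  next
    fix v assume "v \<in> (\<Union>C\<in>K - I. {v \<in> C. \<not> \<sigma> v})"
    then obtain C where "C \<in> K - I" "v \<in> C" "\<not> \<sigma> v" by blast
    then show "v \<in> B" using U_iff[of C v] K_subset[of C] unfolding B_def by blast
  qed
  then have cB: "card B = sum y (K - I)" using card_side by simp
  have "inj_on zc Kc"
    using zx K_unique Kc_K by (intro inj_onI) (metis subsetD)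
  then have cZ: "card Z = t" unfolding Z_def t_def by (rule card_image)
  have cX: "card XI + card XJ \<le> t"
  proof -
    have "card XI \<le> card (Kc \<inter> I)" "card XJ \<le> card (Kc - I)"
      unfolding XI_def XJ_def using finite_Kc by (auto intro: card_image_le)
    moreover have "card (Kc \<inter> I) + card (Kc - I) = card Kc"
      using finite_Kc by (subst card_Un_disjoint[symmetric]) (auto intro: arg_cong[where f=card])
    ultimately show ?thesis unfolding t_def by linarith
  qed
  have "N = (A \<union> XJ \<union> DJ) \<union> (B \<union> XI \<union> DI) \<union> Z"
  proof -
    have "A \<union> B \<union> DI \<union> DJ \<union> Z \<union> XI \<union> XJ \<subseteq> N"
      using XI XJ ZN(1) unfolding A_def B_def DI_def DJ_def Z_def by auto
    moreover have "v \<in> A \<union> B \<union> DI \<union> DJ \<union> Z \<union> XI \<union> XJ" if "v \<in> N" for v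
      using that unfolding A_def B_def DI_def DJ_def by (cases "\<sigma> v"; cases "v \<in> U") auto
    ultimately show ?thesis by blast
  qed
  moreover have "card ((A \<union> XJ \<union> DJ) \<union> (B \<union> XI \<union> DI) \<union> Z) = (card A + card XJ + card DJ) + (card B + card XI + card DI) + card Z"
  proof -
    have "A \<inter> XJ = {}" "(A \<union> XJ) \<inter> DJ = {}" "B \<inter> XI = {}" "(B \<union> XI) \<inter> DI = {}"
      "(A \<union> XJ \<union> DJ) \<inter> (B \<union> XI \<union> DI) = {}" "((A \<union> XJ \<union> DJ) \<union> (B \<union> XI \<union> DI)) \<inter> Z = {}"
      by (auto dest: mem XI XJ ZX ZZ)
    then show ?thesis using fin by (simp add: card_Un_disjoint)
  qed
  ultimately have h: "h = card A + card XJ + card DJ + card B + card XI + card DI + t"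
    using cZ unfolding h_def by simp
  \<comment> \<open>The room left in the first two classes after the forced vertices; the reserve of
    \<open>t\<close> in each bin covers \<open>XJ\<close> and \<open>XI\<close>.\<close>
  define P0 where "P0 = P - (card A + card XJ)"
  define Q0 where "Q0 = Q - (card B + card XI)"
  have PQ0: "P = P0 + card A + card XJ" "Q = Q0 + card B + card XI"
    using cA cB cX I unfolding P0_def Q0_def by linarith+
  obtain GI where GI: "GI \<subseteq> DI" "card GI = min (card DI) Q0" by (metis min.cobounded1 obtain_subset_with_card_n)
  obtain GJ where GJ: "GJ \<subseteq> DJ" "card GJ = min (card DJ) P0" by (metis min.cobounded1 obtain_subset_with_card_n)
  define \<kappa> :: "'a \<Rightarrow> nat" where
    "\<kappa> v = (if v \<in> A \<union> XJ \<union> GJ then 0 else if v \<in> B \<union> XI \<union> GI then 1 else 2)" for v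
  have finG: "finite GI" "finite GJ" using GI GJ fin finite_subset by auto
  have "card {v \<in> N. \<kappa> v = 0} \<le> card (A \<union> XJ \<union> GJ)"
    using fin finG by (intro card_mono) (auto simp: \<kappa>_def)
  also have "\<dots> \<le> card A + card XJ + card GJ" by (meson add_le_mono1 card_Un_le order_trans)
  finally have c0: "card {v \<in> N. \<kappa> v = 0} \<le> P" using GJ PQ0 by linarith
  have "card {v \<in> N. \<kappa> v = 1} \<le> card (B \<union> XI \<union> GI)"
    using fin finG by (intro card_mono) (auto simp: \<kappa>_def split: if_splits)
  also have "\<dots> \<le> card B + card XI + card GI" by (meson add_le_mono1 card_Un_le order_trans)
  finally have c1: "card {v \<in> N. \<kappa> v = 1} \<le> Q" using GI PQ0 by linarith
  have "{v \<in> N. \<kappa> v = 2} \<subseteq> Z \<union> (DI - GI) \<union> (DJ - GJ)"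
    unfolding \<kappa>_def A_def B_def DI_def DJ_def by (auto split: if_splits)
  then have "card {v \<in> N. \<kappa> v = 2} \<le> card (Z \<union> (DI - GI) \<union> (DJ - GJ))"
    using fin by (intro card_mono) auto
  also have "\<dots> \<le> card Z + card (DI - GI) + card (DJ - GJ)" by (meson add_le_mono1 card_Un_le order_trans)
  also have "\<dots> = t + (card DI - card GI) + (card DJ - card GJ)"
    using cZ card_Diff_subset[OF finG(1) GI(1)] card_Diff_subset[OF finG(2) GJ(1)] by simp
  \<comment> \<open>Depending on which of the first two classes are filled up, this needs
    \<open>t \<le> R\<close>, \<open>h \<le> P + R\<close>, \<open>h \<le> Q + R\<close> or
    \<open>h \<le> P + Q + R\<close>. All follow from \<open>n\<close>, as \<open>P\<close> and
    \<open>Q\<close> are at most \<open>h - 2\<close>.\<close>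
  also have "\<dots> \<le> R" using GI GJ h PQ0 n PQR by linarith
  finally have c2: "card {v \<in> N. \<kappa> v = 2} \<le> R" .
  note memG = subsetD[OF GI(1)] subsetD[OF GJ(1)]
  have \<kappa>Y: "\<kappa> v = (if v \<in> U then 0 else 1)" if "v \<in> N" "\<not> \<sigma> v" for v
  proof -
    have "v \<in> (if v \<in> U then A else B)" using that unfolding A_def B_def by auto
    then show ?thesis unfolding \<kappa>_def by (auto split: if_splits dest: mem XI XJ ZX ZZ memG)
  qed
  have \<kappa>X: "\<kappa> v \<noteq> (if v \<in> U then 0 else 1)" if "v \<in> N" "\<sigma> v" for v
    using that unfolding \<kappa>_def by (auto split: if_splits dest: mem XI XJ ZX ZZ memG)
  have \<kappa>Z: "\<kappa> v = 2" if "v \<in> Z" for v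
    using that unfolding \<kappa>_def by (auto dest: mem XI XJ ZX ZZ memG)
  have \<kappa>xc: "\<kappa> (xc C) \<noteq> 2" if "C \<in> Kc" for C
    using that unfolding \<kappa>_def XI_def XJ_def by auto
  have "\<kappa> u \<noteq> \<kappa> v" if uv: "{u, v} \<in> E" for u v
  proof (cases "\<sigma> u = \<sigma> v")
    case True
    then obtain C where "C \<in> Kc" "{u, v} = {zc C, xc C}" using proper[OF uv] by blast
    then show ?thesis using \<kappa>Z[of "zc C"] \<kappa>xc[of C] unfolding Z_def by (auto simp: doubleton_eq_iff)
  next
    case False
    obtain C where "C \<in> K" "{u, v} \<subseteq> C" using edge_in_K[OF uv] by blast
    then have "u \<in> U \<longleftrightarrow> v \<in> U" using U_iff[of C u] U_iff[of C v] by simp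
    then show ?thesis using False \<kappa>Y[of u] \<kappa>Y[of v] \<kappa>X[of u] \<kappa>X[of v] edge_verts[OF uv] by auto
  qed
  moreover have "\<kappa> v < 3" for v unfolding \<kappa>_def by simp
  ultimately show ?thesis using c0 c1 c2 by blast
qed

section \<open>Embeddings into a complete bipartite or tripartite part of one color\<close>

lemma finite_N': "finite N"
  using finite_N N_def by simp

lemma tripartite_embeds:
  assumes c: "\<And>x y. c x y = c y x"
    and sub: "A \<subseteq> {..<n}" "B \<subseteq> {..<n}" "D \<subseteq> {..<n}"
    and dis: "A \<inter> B = {}" "A \<inter> D = {}" "B \<inter> D = {}"
    and cross: "\<And>x y. x \<in> A \<Longrightarrow> y \<in> B \<Longrightarrow> c x y = k" "\<And>x y. x \<in> A \<Longrightarrow> y \<in> D \<Longrightarrow> c x y = k"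
      "\<And>x y. x \<in> B \<Longrightarrow> y \<in> D \<Longrightarrow> c x y = k"
    and t: "t \<ge> 1" and n: "2 * h + t \<le> card A + card B + card D + 2"
    and s: "\<And>C. C \<in> Kc \<Longrightarrow> 4 * card C \<le> card A + card B + card D + 3"
    and PQR: "card B \<le> card A" "card D \<le> card B" "card A + 2 \<le> h"
  shows "embeds E n c k"
proof -
  obtain \<kappa> :: "'a \<Rightarrow> nat" where \<kappa>: "\<And>u v. {u, v} \<in> E \<Longrightarrow> \<kappa> u \<noteq> \<kappa> v" "\<And>v. v \<in> N \<Longrightarrow> \<kappa> v < 3"
    "card {v \<in> N. \<kappa> v = 0} \<le> card A" "card {v \<in> N. \<kappa> v = 1} \<le> card B" "card {v \<in> N. \<kappa> v = 2} \<le> card D"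
    using three_coloring[OF t n s PQR] by blast
  define S where "S i = (if i = 0 then A else if i = 1 then B else if i = 2 then D else {})" for i :: nat
  have fin: "finite (S i)" for i using sub unfolding S_def by (auto intro: finite_subset[OF _ finite_lessThan])
  have "\<exists>\<phi>. inj_on \<phi> N \<and> (\<forall>v\<in>N. \<phi> v \<in> S (\<kappa> v)) \<and> (\<forall>v\<in>{}. \<phi> v = undefined v)"
  proof (rule extend_injection[where S = S and \<kappa> = \<kappa>])
    show "S i \<inter> S j = {}" if "i \<noteq> j" for i j using dis that unfolding S_def by auto
    show "card {v \<in> N. \<kappa> v = i} \<le> card (S i)" for i
    proof (cases "i < 3")
      case True
      then have "i = 0 \<or> i = 1 \<or> i = 2" by linarith
      then show ?thesis using \<kappa>(3-5) unfolding S_def by auto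
    next
      case False
      then have "{v \<in> N. \<kappa> v = i} = {}" using \<kappa>(2) by auto
      then show ?thesis by (simp only: card.empty)
    qed
  qed (use finite_N' fin in auto)
  then obtain \<phi> where \<phi>: "inj_on \<phi> N" "\<And>v. v \<in> N \<Longrightarrow> \<phi> v \<in> S (\<kappa> v)" by blast
  have S3: "S i \<subseteq> {..<n}" for i using sub unfolding S_def by auto
  have SS: "c x y = k" if "x \<in> S i" "y \<in> S j" "i \<noteq> j" for x y i j
    using that cross cross[of y x] c[of x y] unfolding S_def by (auto split: if_splits)
  show ?thesis
  proof (rule embedsI[of \<phi>])
    show "inj_on \<phi> (\<Union>E)" using \<phi>(1) N_def by simp
    show "\<phi> v < n" if "v \<in> \<Union>E" for v using \<phi>(2)[of v] S3 that N_def by blast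
    show "c (\<phi> u) (\<phi> v) = k" if "{u, v} \<in> E" for u v
      using SS[OF \<phi>(2) \<phi>(2) \<kappa>(1)[OF that]] edge_verts[OF that] by blast
  qed
qed

text \<open>One of the two sides of \<open>H\<close> has at most half of its vertices and goes to
  \<open>S\<close>; the other is placed in \<open>T\<close>.\<close>

lemma bipartite_embeds:
  assumes c: "\<And>x y. c x y = c y x" and t: "t = 0"
    and sub: "S \<subseteq> {..<n}" "T \<subseteq> {..<n}" "S \<inter> T = {}"
    and cross: "\<And>x y. x \<in> S \<Longrightarrow> y \<in> T \<Longrightarrow> c x y = k"
    and card: "h \<le> 2 * card S" "h \<le> card T"
  shows "embeds E n c k"
proof -
  have Kc: "Kc = {}" using t finite_Kc unfolding t_def by simp
  have "card {v \<in> N. \<sigma> v} + card {v \<in> N. \<not> \<sigma> v} = h"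
    unfolding h_def using finite_N' by (subst card_Un_disjoint[symmetric]) (auto intro: arg_cong[where f=card])
  then have "2 * card {v \<in> N. \<sigma> v} \<le> h \<or> 2 * card {v \<in> N. \<not> \<sigma> v} \<le> h" by linarith
  then have "\<exists>b. 2 * card {v \<in> N. \<sigma> v = b} \<le> h" by (auto intro: exI[of _ True] exI[of _ False])
  then obtain b where b: "2 * card {v \<in> N. \<sigma> v = b} \<le> h" by blast
  define P where "P i = (if i then S else T)" for i
  have fin: "finite (P i)" for i using sub unfolding P_def by (auto intro: finite_subset[OF _ finite_lessThan])
  have "\<exists>\<phi>. inj_on \<phi> N \<and> (\<forall>v\<in>N. \<phi> v \<in> P (\<sigma> v = b)) \<and> (\<forall>v\<in>{}. \<phi> v = undefined v)"
  proof (rule extend_injection[where S = P and \<kappa> = "\<lambda>v. \<sigma> v = b"])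
    show "P i \<inter> P j = {}" if "i \<noteq> j" for i j using sub(3) that unfolding P_def by auto
    show "card {v \<in> N. (\<sigma> v = b) = i} \<le> card (P i)" for i
    proof (cases i)
      case True
      then show ?thesis using b card unfolding P_def by simp
    next
      case False
      have "card {v \<in> N. (\<sigma> v = b) = i} \<le> h" unfolding h_def using finite_N' by (intro card_mono) auto
      then show ?thesis using False card unfolding P_def by simp
    qed
  qed (use finite_N' fin in auto)
  then obtain \<phi> where \<phi>: "inj_on \<phi> N" "\<And>v. v \<in> N \<Longrightarrow> \<phi> v \<in> P (\<sigma> v = b)" by blast
  have P3: "P i \<subseteq> {..<n}" for i using sub unfolding P_def by auto
  have PP: "c x y = k" if "x \<in> P i" "y \<in> P j" "i \<noteq> j" for x y i j
    using that cross cross[of y x] c[of x y] unfolding P_def by (auto split: if_splits)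
  show ?thesis
  proof (rule embedsI[of \<phi>])
    show "inj_on \<phi> (\<Union>E)" using \<phi>(1) N_def by simp
    show "\<phi> v < n" if "v \<in> \<Union>E" for v using \<phi>(2)[of v] P3 that N_def by blast
    show "c (\<phi> u) (\<phi> v) = k" if "{u, v} \<in> E" for u v
      using PP[OF \<phi>(2)[of u] \<phi>(2)[of v]] edge_verts[OF that] proper[OF that] Kc by auto
  qed
qed

text \<open>The edge from \<open>\<alpha> C\<close> to \<open>\<beta> C\<close> receives the extra
  edge of \<open>C\<close>. The two sides of each component can be exchanged independently, so the
  marked side of \<open>C\<close> can go wherever its edge lies.\<close>

lemma matching_embeds:
  fixes \<alpha> \<beta> :: "'a set \<Rightarrow> nat"
  assumes c: "\<And>x y. c x y = c y x" and t: "t \<ge> 1"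
    and sub: "S \<subseteq> {..<n}" "T \<subseteq> {..<n}" "S \<inter> T = {}"
    and cross: "\<And>x y. x \<in> S \<Longrightarrow> y \<in> T \<Longrightarrow> c x y = k"
    and card: "h \<le> card S + 1" "h \<le> card T + 1"
    and inj: "inj_on \<alpha> Kc" "inj_on \<beta> Kc" "\<alpha> ` Kc \<inter> \<beta> ` Kc = {}"
    and side: "\<And>C. C \<in> Kc \<Longrightarrow> {\<alpha> C, \<beta> C} \<subseteq> S \<or> {\<alpha> C, \<beta> C} \<subseteq> T"
    and edge: "\<And>C. C \<in> Kc \<Longrightarrow> c (\<alpha> C) (\<beta> C) = k"
  shows "embeds E n c k"
proof -
  \<comment> \<open>True for the vertices sent to \<open>S\<close>. In a non-bipartite component the
    marking is flipped when its edge lies in \<open>T\<close>; elsewhere it is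
    \<open>\<sigma>\<close>.\<close>
  define \<kappa> where "\<kappa> v \<longleftrightarrow> (\<sigma> v \<longleftrightarrow> (\<forall>C\<in>Kc. v \<in> C \<longrightarrow> \<alpha> C \<in> S))" for v
  define comp where "comp v = (THE C. C \<in> Kc \<and> v \<in> C)" for v
  have comp: "comp v = C" if "C \<in> Kc" "v \<in> C" for v C
    unfolding comp_def using that K_unique Kc_K by (intro the_equality) blast+
  have \<kappa>: "\<kappa> v \<longleftrightarrow> (\<sigma> v \<longleftrightarrow> \<alpha> C \<in> S)" if "C \<in> Kc" "v \<in> C" for v C
    unfolding \<kappa>_def using that K_unique Kc_K by blast
  define P where "P i = (if i then S else T)" for i
  have fin: "finite (P i)" for i using sub unfolding P_def by (auto intro: finite_subset[OF _ finite_lessThan])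
  define Z where "Z = zc ` Kc \<union> xc ` Kc"
  define \<phi>0 where "\<phi>0 v = (if v = zc (comp v) then \<alpha> (comp v) else \<beta> (comp v))" for v
  have \<phi>0: "\<phi>0 (zc C) = \<alpha> C" "\<phi>0 (xc C) = \<beta> C" if "C \<in> Kc" for C
    using comp[OF that] zx[OF that] unfolding \<phi>0_def by auto
  have ZK: "zc C \<in> N" "xc C \<in> N" if "C \<in> Kc" for C using zx[OF that] K_subset Kc_K that by blast+
  have "\<exists>\<phi>. inj_on \<phi> N \<and> (\<forall>v\<in>N. \<phi> v \<in> P (\<kappa> v)) \<and> (\<forall>v\<in>Z. \<phi> v = \<phi>0 v)"
  proof (rule extend_injection[where S = P and \<kappa> = \<kappa>])
    show "Z \<subseteq> N" using ZK unfolding Z_def by auto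
    show "inj_on \<phi>0 Z"
    proof (rule inj_onI)
      fix u v assume "u \<in> Z" "v \<in> Z" and eq: "\<phi>0 u = \<phi>0 v"
      then obtain C D where "C \<in> Kc" "D \<in> Kc" "u = zc C \<or> u = xc C" "v = zc D \<or> v = xc D"
        unfolding Z_def by blast
      moreover have "\<alpha> C \<noteq> \<beta> D" "\<beta> C \<noteq> \<alpha> D" if "C \<in> Kc" "D \<in> Kc" for C D
        using inj(3) that by (metis disjoint_iff imageI)+
      ultimately show "u = v" using eq \<phi>0 inj(1,2) by (auto dest: inj_onD)
    qed
    show "\<phi>0 v \<in> P (\<kappa> v)" if vZ: "v \<in> Z" for v
    proof -
      obtain C where C: "C \<in> Kc" "v = zc C \<or> v = xc C" using vZ unfolding Z_def by blast
      then have "\<kappa> v \<longleftrightarrow> \<alpha> C \<in> S" using \<kappa>[of C v] zx[of C] by auto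
      moreover have "\<phi>0 v \<in> {\<alpha> C, \<beta> C}" using C \<phi>0 by auto
      ultimately show ?thesis using side[OF C(1)] sub(3) unfolding P_def by auto
    qed
    show "P i \<inter> P j = {}" if "i \<noteq> j" for i j using sub(3) that unfolding P_def by auto
    show "card {v \<in> N. \<kappa> v = i} \<le> card (P i)" for i
    proof -
      \<comment> \<open>Room for \<open>h - 1\<close> vertices on each side suffices, because a
        non-bipartite component puts vertices on both.\<close>
      obtain C where C: "C \<in> Kc" using t unfolding t_def by fastforce
      obtain w where w: "w \<in> C" "\<not> \<sigma> w" using other_side[OF C] by blast
      have "\<kappa> w \<noteq> \<kappa> (zc C)" using \<kappa>[OF C] w zx[OF C] by auto
      moreover have "w \<in> N" "zc C \<in> N" using w ZK[OF C] K_subset Kc_K C by blast+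
      ultimately have "{v \<in> N. \<kappa> v = i} \<noteq> N" by blast
      then have "card {v \<in> N. \<kappa> v = i} < h" unfolding h_def using finite_N' by (intro psubset_card_mono) auto
      then show ?thesis using card unfolding P_def by auto
    qed
  qed (use finite_N' fin in auto)
  then obtain \<phi> where \<phi>: "inj_on \<phi> N" "\<And>v. v \<in> N \<Longrightarrow> \<phi> v \<in> P (\<kappa> v)" "\<And>v. v \<in> Z \<Longrightarrow> \<phi> v = \<phi>0 v" by blast
  have P3: "P i \<subseteq> {..<n}" for i using sub unfolding P_def by auto
  have PP: "c x y = k" if "x \<in> P i" "y \<in> P j" "i \<noteq> j" for x y i j
    using that cross cross[of y x] c[of x y] unfolding P_def by (auto split: if_splits)
  show ?thesis
  proof (rule embedsI[of \<phi>])
    show "inj_on \<phi> (\<Union>E)" using \<phi>(1) N_def by simp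
    show "\<phi> v < n" if "v \<in> \<Union>E" for v using \<phi>(2)[of v] P3 that N_def by blast
    show "c (\<phi> u) (\<phi> v) = k" if uv: "{u, v} \<in> E" for u v
    proof (cases "\<sigma> u = \<sigma> v")
      case True
      then obtain C where C: "C \<in> Kc" "{u, v} = {zc C, xc C}" using proper[OF uv] by blast
      have "\<phi> (zc C) = \<alpha> C" "\<phi> (xc C) = \<beta> C" using \<phi>(3) \<phi>0 C unfolding Z_def by auto
      then show ?thesis using C edge[OF C(1)] c by (auto simp: doubleton_eq_iff)
    next
      case False
      obtain C where C: "C \<in> K" "{u, v} \<subseteq> C" using edge_in_K[OF uv] by blast
      have "\<kappa> u \<noteq> \<kappa> v"
      proof (cases "C \<in> Kc")
        case True
        then show ?thesis using \<kappa>[OF True] C False by auto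
      next
        case nKc: False
        then have "v \<notin> D \<and> u \<notin> D" if "D \<in> Kc" for D using that C K_unique Kc_K by blast
        then show ?thesis using False unfolding \<kappa>_def by blast
      qed
      then show ?thesis using PP[OF \<phi>(2) \<phi>(2)] edge_verts[OF uv] by blast
    qed
  qed
qed

section \<open>Nearly uniform colorings and small complete graphs\<close>

lemma arrows3_h_le: "arrows3 E n \<Longrightarrow> h \<le> n"
proof -
  assume "arrows3 E n"
  then obtain k \<phi> where "inj_on \<phi> (\<Union>E)" "\<And>v. v \<in> \<Union>E \<Longrightarrow> \<phi> v < n"
    by (rule arrows3E[of E n "\<lambda>x y. 0"]) auto
  then have "card N \<le> card {..<n}" unfolding N_def by (intro card_inj_on_le) auto
  then show ?thesis unfolding h_def by simp
qed

lemma embeds_one_edge: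
  assumes "arrows3 E n" "\<And>e f. e \<in> E \<Longrightarrow> f \<in> E \<Longrightarrow> e = f" "\<And>x y. c x y = c y x"
  shows "\<exists>k. embeds E n c k"
proof (rule embeds_if_one_edge[of E n c])
  show "card (\<Union>E) \<le> n" using arrows3_h_le[OF assms(1)] unfolding h_def N_def .
qed (use finite_N card_edge assms(2,3) in auto)

lemma edge_obtain: assumes "e \<in> E" obtains u v where "e = {u, v}" "u \<noteq> v" "u \<in> N" "v \<in> N"
  using card_edge[OF assms] edge_verts assms by (metis card_2_iff)

text \<open>Recolor the edges at \<open>a\<close> by 1, the edge \<open>b d\<close> by 2 and the
  rest by 0. A copy in color 0 has color \<open>k\<close> throughout, one in color 2 is a single
  edge, and one in color 1 is a star, which is moved to a center away from \<open>a\<close>,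
  \<open>b\<close> and \<open>d\<close>.\<close>

lemma embeds_if_uniform_off_vertex_and_edge:
  assumes arr: "arrows3 E n" and n: "n \<ge> 6" and c: "\<And>x y. c x y = c y x"
    and abd: "a < n" "b < n" "d < n" "distinct [a, b, d]"
    and unif: "\<And>x y. \<lbrakk>x < n; y < n; x \<noteq> y; x \<noteq> a; y \<noteq> a; {x, y} \<noteq> {b, d}\<rbrakk> \<Longrightarrow> c x y = k"
  shows "\<exists>k. embeds E n c k"
proof -
  define g :: "nat \<Rightarrow> nat \<Rightarrow> nat" where
    "g x y = (if x = a \<or> y = a then 1 else if {x, y} = {b, d} then 2 else 0)" for x y
  have gs: "g x y = g y x" "g x y < 3" for x y unfolding g_def by (auto simp: insert_commute)
  obtain i \<phi> where i: "i \<in> {0, 1, 2}" and \<phi>: "inj_on \<phi> (\<Union>E)" "\<And>v. v \<in> \<Union>E \<Longrightarrow> \<phi> v < n"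
    and col: "\<And>u v. {u, v} \<in> E \<Longrightarrow> g (\<phi> u) (\<phi> v) = i"
    by (rule arrows3E[where d = g, OF arr gs]) blast
  have inj: "u = v" if "u \<in> N" "v \<in> N" "\<phi> u = \<phi> v" for u v
    using that \<phi>(1) unfolding N_def inj_on_def by blast
  consider "i = 0" | "i = 1" | "i = 2" using i by blast
  then show ?thesis
  proof cases
    case 1
    have "c (\<phi> u) (\<phi> v) = k" if "{u, v} \<in> E" for u v
    proof (rule unif)
      have "g (\<phi> u) (\<phi> v) = 0" using col[OF that] 1 by simp
      then show "\<phi> u \<noteq> a" "\<phi> v \<noteq> a" "{\<phi> u, \<phi> v} \<noteq> {b, d}" unfolding g_def by (metis zero_neq_one zero_neq_numeral)+
      show "\<phi> u < n" "\<phi> v < n" using \<phi>(2) edge_verts[OF that] N_def by auto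
      show "\<phi> u \<noteq> \<phi> v" using inj edge_verts[OF that] by blast
    qed
    then show ?thesis using embedsI[of \<phi> E n c k] \<phi> by blast
  next
    case 2
    show ?thesis
    proof (cases "E = {}")
      case True
      then show ?thesis using embeds_one_edge[where c = c, OF arr _ c] by blast
    next
      case False
      have one: "\<phi> u = a \<or> \<phi> v = a" if "{u, v} \<in> E" for u v
        using col[OF that] 2 unfolding g_def by (metis one_eq_numeral_iff zero_neq_one semiring_norm(85))
      obtain w where w: "w \<in> N" "\<phi> w = a"
      proof -
        obtain e where "e \<in> E" using False by blast
        then obtain u v where "{u, v} \<in> E" "u \<in> N" "v \<in> N" by (metis edge_obtain)
        then show ?thesis using that one by blast
      qed
      have center: "u = w \<or> v = w" if "{u, v} \<in> E" for u v
        using one[OF that] inj[of u w] inj[of v w] edge_verts[OF that] w by auto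
      have "h \<noteq> n"
      proof
        assume hn: "h = n"
        \<comment> \<open>A spanning star is impossible: every vertex is incident with both colors
          of this coloring, the complete bipartite graph between \<open>{0, 1}\<close> and the rest
          and its complement.\<close>
        define g2 :: "nat \<Rightarrow> nat \<Rightarrow> nat" where "g2 x y = (if (x < 2) \<noteq> (y < 2) then 0 else 1)" for x y
        have g2s: "g2 x y = g2 y x" "g2 x y < 3" for x y unfolding g2_def by auto
        obtain j \<psi> where \<psi>: "inj_on \<psi> (\<Union>E)" "\<And>v. v \<in> \<Union>E \<Longrightarrow> \<psi> v < n"
          and col2: "\<And>u v. {u, v} \<in> E \<Longrightarrow> g2 (\<psi> u) (\<psi> v) = j"
          by (rule arrows3E[where d = g2, OF arr g2s]) blast
        have "card (\<psi> ` N) = n" using card_image[OF \<psi>(1)] hn unfolding h_def N_def by simp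
        moreover have "\<psi> ` N \<subseteq> {..<n}" using \<psi>(2) N_def by auto
        ultimately have onto: "\<psi> ` N = {..<n}" by (simp add: card_subset_eq)
        have leaf: "g2 (\<psi> w) x = j" if x: "x < n" "x \<noteq> \<psi> w" for x
        proof -
          obtain v where v: "v \<in> N" "\<psi> v = x" using onto x(1) by (metis imageE lessThan_iff)
          obtain u where "{v, u} \<in> E" using incident_edge[OF v(1)] by blast
          then have "{w, v} \<in> E" using center[of v u] v x by (auto simp: insert_commute)
          then show ?thesis using col2 v by blast
        qed
        consider "\<psi> w = 0" | "\<psi> w = 1" | "\<psi> w = 2" | "\<psi> w > 2" by linarith
        then show False
          using leaf[of 0] leaf[of 1] leaf[of 2] leaf[of 3] n unfolding g2_def by cases auto
      qed
      then have h: "h < n" using arrows3_h_le[OF arr] by simp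
      have "\<not> {..<n} \<subseteq> {a, b, d}" using card_mono[of "{a, b, d}" "{..<n}"] n by (auto simp: card_insert_if split: if_splits)
      then obtain p where p: "p < n" "p \<notin> {a, b, d}" by auto
      \<comment> \<open>The leaves avoid both \<open>a\<close> and the new center \<open>p\<close>,
        so \<open>h - 1\<close> of them need \<open>n - 2\<close> places; this is where
        \<open>h < n\<close> is used.\<close>
      have "card (N - {w}) \<le> card ({..<n} - {a, p})"
        using h w p abd finite_N' unfolding h_def by (simp add: card_Diff_subset)
      then obtain \<psi> where \<psi>: "inj_on \<psi> (N - {w})" "\<psi> ` (N - {w}) \<subseteq> {..<n} - {a, p}"
        using card_le_inj[of "N - {w}" "{..<n} - {a, p}"] finite_N' by auto
      define \<theta> where "\<theta> v = (if v = w then p else \<psi> v)" for v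
      have \<theta>: "\<theta> v \<in> {..<n} - {a, p}" if "v \<in> N" "v \<noteq> w" for v using \<psi>(2) that unfolding \<theta>_def by auto
      have \<theta>w: "\<theta> w = p" unfolding \<theta>_def by simp
      have "inj_on \<theta> N"
      proof (rule inj_onI)
        fix u v assume uv: "u \<in> N" "v \<in> N" "\<theta> u = \<theta> v"
        consider "u = w" | "v = w" | "u \<noteq> w" "v \<noteq> w" by blast
        then show "u = v"
        proof cases
          case 1 then show ?thesis using \<theta>[of v] \<theta>w uv by auto
        next
          case 2 then show ?thesis using \<theta>[of u] \<theta>w uv by auto
        next
          case 3 then show ?thesis using \<psi>(1) uv unfolding \<theta>_def inj_on_def by auto
        qed
      qed
      moreover have "\<theta> v < n" if "v \<in> N" for v using \<theta>[OF that] \<theta>w p by (cases "v = w") auto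
      moreover have pk: "c p x = k" if "x \<in> {..<n} - {a, p}" for x
        using unif[of p x] that p by (auto simp: doubleton_eq_iff)
      then have "c (\<theta> u) (\<theta> v) = k" if "{u, v} \<in> E" for u v
        using center[OF that] \<theta>[of u] \<theta>[of v] \<theta>w edge_verts[OF that] c by metis
      ultimately have "embeds E n c k" using N_def by (intro embedsI[of \<theta>]) auto
      then show ?thesis by blast
    qed
  next
    case 3
    have bd: "{\<phi> u, \<phi> v} = {b, d}" if "{u, v} \<in> E" for u v
      using col[OF that] 3 unfolding g_def by (metis one_eq_numeral_iff zero_neq_numeral semiring_norm(85))
    have "e = f" if ef: "e \<in> E" "f \<in> E" for e f
    proof -
      have sub: "e \<subseteq> N" "f \<subseteq> N" using ef N_def by auto
      obtain u v x y where "e = {u, v}" "f = {x, y}" using ef by (metis edge_obtain)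
      then have "\<phi> ` e = \<phi> ` f" using bd ef by (metis image_empty image_insert)
      then show ?thesis using inj_on_image_eq_iff[OF \<phi>(1)] sub N_def by simp
    qed
    then show ?thesis using embeds_one_edge[where c = c, OF arr _ c] by blast
  qed
qed

text \<open>Give the edges inside \<open>Q\<close> a color of their own. A copy in that color shows
  \<open>h \<le> 4\<close>. Then a bipartite \<open>H\<close> fits between \<open>Q\<close> and its
  complement, and otherwise \<open>n\<close> is large enough to avoid \<open>Q\<close>
  altogether.\<close>

lemma embeds_if_uniform_off_four_vertices:
  assumes arr: "arrows3 E n" and n: "n \<ge> 6" and c: "\<And>x y. c x y = c y x"
    and Q: "Q \<subseteq> {..<n}" "card Q = 4"
    and unif: "\<And>x y. \<lbrakk>x < n; y < n; x \<noteq> y; \<not> {x, y} \<subseteq> Q\<rbrakk> \<Longrightarrow> c x y = k"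
  shows "\<exists>k. embeds E n c k"
proof -
  define g :: "nat \<Rightarrow> nat \<Rightarrow> nat" where "g x y = (if x \<in> Q \<and> y \<in> Q then 1 else 0)" for x y
  have gs: "g x y = g y x" "g x y < 3" for x y unfolding g_def by auto
  obtain i \<phi> where \<phi>: "inj_on \<phi> (\<Union>E)" "\<And>v. v \<in> \<Union>E \<Longrightarrow> \<phi> v < n"
    and col: "\<And>u v. {u, v} \<in> E \<Longrightarrow> g (\<phi> u) (\<phi> v) = i"
    by (rule arrows3E[where d = g, OF arr gs]) blast
  have finQ: "finite Q" using Q(1) finite_subset by blast
  have rest: "card ({..<n} - Q) = n - 4" using Q finQ by (simp add: card_Diff_subset)
  show ?thesis
  proof (cases "i = 1")
    case False
    have "c (\<phi> u) (\<phi> v) = k" if "{u, v} \<in> E" for u v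
    proof (rule unif)
      show "\<not> {\<phi> u, \<phi> v} \<subseteq> Q" using col[OF that] False unfolding g_def by auto
      show "\<phi> u < n" "\<phi> v < n" using \<phi>(2) edge_verts[OF that] N_def by auto
      show "\<phi> u \<noteq> \<phi> v" using \<phi>(1) edge_verts[OF that] unfolding N_def inj_on_def by blast
    qed
    then show ?thesis using embedsI[of \<phi> E n c k] \<phi> by blast
  next
    case True
    have "\<phi> u \<in> Q" if "{u, v} \<in> E" for u v
      using col[OF that] True unfolding g_def by (metis zero_neq_one)
    then have "\<phi> ` N \<subseteq> Q" using incident_edge by blast
    then have h4: "h \<le> 4" using card_inj_on_le[OF \<phi>(1), of Q] finQ Q unfolding h_def N_def by simp
    show ?thesis
    proof (cases "t = 0")
      case True
      have "embeds E n c k"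
      proof (rule bipartite_embeds[where c = c, OF c True, where S = "{..<n} - Q" and T = Q])
        show "c x y = k" if "x \<in> {..<n} - Q" "y \<in> Q" for x y
          using unif[of x y] that Q(1) by auto
      qed (use Q rest n h4 in auto)
      then show ?thesis by blast
    next
      case False
      then obtain C where C: "C \<in> Kc" unfolding t_def by fastforce
      \<comment> \<open>A non-bipartite component has at least three vertices, hence
        \<open>12 \<le> n + 3\<close>; at least five vertices lie outside \<open>Q\<close>.\<close>
      have "n \<ge> 9" using arrows3_critical_bound[OF arr C] card_Kc[OF C] by linarith
      then have "card N \<le> card ({..<n} - Q)" using h4 rest unfolding h_def by simp
      then obtain \<psi> where \<psi>: "inj_on \<psi> N" "\<psi> ` N \<subseteq> {..<n} - Q"
        using card_le_inj[of N "{..<n} - Q"] finite_N' by auto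
      have "c (\<psi> u) (\<psi> v) = k" if "{u, v} \<in> E" for u v
      proof (rule unif)
        show "\<not> {\<psi> u, \<psi> v} \<subseteq> Q" "\<psi> u < n" "\<psi> v < n" using \<psi>(2) edge_verts[OF that] by auto
        show "\<psi> u \<noteq> \<psi> v" using \<psi>(1) edge_verts[OF that] unfolding inj_on_def by blast
      qed
      then have "embeds E n c k" using \<psi> unfolding embeds_def N_def by blast
      then show ?thesis by blast
    qed
  qed
qed

text \<open>On five vertices, a star at 0, a star at 1 and the triangle on 2, 3, 4 partition the
  edges, and none of them contains two disjoint edges.\<close>

lemma edges_intersect:
  assumes arr: "arrows3 E n" and n: "n \<le> 5" and ef: "e \<in> E" "f \<in> E"
  shows "e \<inter> f \<noteq> {}"
proof
  assume dis: "e \<inter> f = {}"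
  define g :: "nat \<Rightarrow> nat \<Rightarrow> nat" where "g x y = (if x = 0 \<or> y = 0 then 0 else if x = 1 \<or> y = 1 then 1 else 2)" for x y
  have gs: "g x y = g y x" "g x y < 3" for x y unfolding g_def by auto
  obtain i \<phi> where \<phi>: "inj_on \<phi> (\<Union>E)" "\<And>v. v \<in> \<Union>E \<Longrightarrow> \<phi> v < n"
    and col: "\<And>u v. {u, v} \<in> E \<Longrightarrow> g (\<phi> u) (\<phi> v) = i"
    by (rule arrows3E[where d = g, OF arr gs]) blast
  obtain u v where uv: "e = {u, v}" "u \<noteq> v" "u \<in> N" "v \<in> N" by (metis edge_obtain[OF ef(1)])
  obtain x y where xy: "f = {x, y}" "x \<noteq> y" "x \<in> N" "y \<in> N" by (metis edge_obtain[OF ef(2)])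
  have ne: "\<phi> a \<noteq> \<phi> b" if "a \<in> N" "b \<in> N" "a \<noteq> b" for a b using that \<phi>(1) unfolding N_def inj_on_def by blast
  have "\<phi> u < 5" "\<phi> v < 5" "\<phi> x < 5" "\<phi> y < 5" using \<phi>(2) uv xy n unfolding N_def by fastforce+
  moreover have "\<phi> u \<noteq> \<phi> v" "\<phi> u \<noteq> \<phi> x" "\<phi> u \<noteq> \<phi> y" "\<phi> v \<noteq> \<phi> x" "\<phi> v \<noteq> \<phi> y" "\<phi> x \<noteq> \<phi> y"
    using ne uv xy dis by blast+
  moreover have "g (\<phi> u) (\<phi> v) = g (\<phi> x) (\<phi> y)" using col ef uv xy by metis
  moreover have False if "a < 5" "b < 5" "p < 5" "q < 5" "a \<noteq> b" "a \<noteq> p" "a \<noteq> q" "b \<noteq> p" "b \<noteq> q" "p \<noteq> q" "g a b = g p q"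
    for a b p q
  proof -
    have "g x y = 0 \<and> (x = 0 \<or> y = 0) \<or> g x y = 1 \<and> (x = 1 \<or> y = 1) \<or> g x y = 2 \<and> x \<ge> 2 \<and> y \<ge> 2" for x y
      unfolding g_def by auto
    from this[of a b] this[of p q] have "a \<ge> 2 \<and> b \<ge> 2 \<and> p \<ge> 2 \<and> q \<ge> 2" using that by auto
    then have "{a, b, p, q} \<subseteq> {2..<5}" using that by auto
    then have "card {a, b, p, q} \<le> 3" using card_mono[of "{2..<5 :: nat}" "{a, b, p, q}"] by simp
    then show False using that by simp
  qed
  ultimately show False by blast
qed

text \<open>The three perfect matchings of \<open>K4\<close>, told apart by \<open>x + y\<close>,
  form a coloring in which adjacent edges differ. With \<open>edges_intersect\<close>,
  \<open>H\<close> has at most one edge.\<close>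

lemma embeds_if_le_4:
  assumes arr: "arrows3 E n" and n: "n \<le> 4" and c: "\<And>x y. c x y = c y x"
  shows "\<exists>k. embeds E n c k"
proof (rule embeds_one_edge[where c = c, OF arr _ c])
  fix e f assume ef: "e \<in> E" "f \<in> E"
  define g :: "nat \<Rightarrow> nat \<Rightarrow> nat" where "g x y = (if x + y = 3 then 0 else if x + y = 1 \<or> x + y = 5 then 1 else 2)" for x y
  have gs: "g x y = g y x" "g x y < 3" for x y unfolding g_def by (auto simp: add.commute)
  obtain i \<phi> where \<phi>: "inj_on \<phi> (\<Union>E)" "\<And>v. v \<in> \<Union>E \<Longrightarrow> \<phi> v < n"
    and col: "\<And>u v. {u, v} \<in> E \<Longrightarrow> g (\<phi> u) (\<phi> v) = i"
    by (rule arrows3E[where d = g, OF arr gs]) blast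
  have ne: "\<phi> a \<noteq> \<phi> b" if "a \<in> N" "b \<in> N" "a \<noteq> b" for a b using that \<phi>(1) unfolding N_def inj_on_def by blast
  obtain u where u: "u \<in> e" "u \<in> f" using edges_intersect[OF arr _ ef] n by auto
  obtain v where v: "e = {u, v}" "v \<noteq> u" using edge_obtain[OF ef(1)] u(1) by (metis insertE insert_commute singletonD)
  obtain w where w: "f = {u, w}" "w \<noteq> u" using edge_obtain[OF ef(2)] u(2) by (metis insertE insert_commute singletonD)
  have N: "u \<in> N" "v \<in> N" "w \<in> N" using ef v w unfolding N_def by auto
  have lt: "\<phi> u < 4" "\<phi> v < 4" "\<phi> w < 4" using \<phi>(2) N n unfolding N_def by fastforce+
  have "g (\<phi> u) (\<phi> v) = g (\<phi> u) (\<phi> w)" using col ef v w by metis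
  moreover have "b = q" if "a < 4" "b < 4" "q < 4" "a \<noteq> b" "a \<noteq> q" "g a b = g a q" for a b q
  proof -
    have "g x y = 0 \<and> x + y = 3 \<or> g x y = 1 \<and> (x + y = 1 \<or> x + y = 5) \<or> g x y = 2 \<and> (x + y = 2 \<or> x + y = 4)"
      if "x < 4" "y < 4" "x \<noteq> y" for x y
    proof -
      have "x + y \<in> {1, 2, 3, 4, 5}" using that by auto
      then show ?thesis unfolding g_def by auto
    qed
    note this[of a b] this[of a q]
    moreover have "\<not> (a + b = 2 \<and> a + q = 4)" "\<not> (a + b = 4 \<and> a + q = 2)" using that(1-5) by presburger+
    ultimately show ?thesis using that by auto
  qed
  ultimately have "\<phi> v = \<phi> w" using lt ne N v w by metis
  then show "e = f" using ne N v w by blast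
qed

text \<open>The pentagon and its complement, again a pentagon, contain neither a triangle nor three
  edges at a vertex. As the edges of \<open>H\<close> pairwise meet, there are at most two, and a
  path of two edges is found by \<open>not_proper_K5\<close>.\<close>

lemma embeds_if_5:
  assumes arr: "arrows3 E 5" and c: "\<And>x y. c x y = c y x"
    and P5: "rainbow_P5_free {..<5} c"
  shows "\<exists>k. embeds E 5 c k"
proof (cases "\<forall>e\<in>E. \<forall>f\<in>E. e = f")
  case True
  then show ?thesis using embeds_one_edge[where c = c, OF arr _ c] by blast
next
  case False
  then obtain e f where ef: "e \<in> E" "f \<in> E" "e \<noteq> f" by blast
  define g :: "nat \<Rightarrow> nat \<Rightarrow> nat" where "g x y = (if x + 1 = y \<or> y + 1 = x \<or> x + 4 = y \<or> y + 4 = x then 0 else 1)" for x y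
  have gs: "g x y = g y x" "g x y < 3" for x y unfolding g_def by auto
  obtain i \<phi> where \<phi>: "inj_on \<phi> (\<Union>E)" "\<And>v. v \<in> \<Union>E \<Longrightarrow> \<phi> v < 5"
    and col: "\<And>u v. {u, v} \<in> E \<Longrightarrow> g (\<phi> u) (\<phi> v) = i"
    by (rule arrows3E[where d = g, OF arr gs]) blast
  have ne: "\<phi> a \<noteq> \<phi> b" if "a \<in> N" "b \<in> N" "a \<noteq> b" for a b using that \<phi>(1) unfolding N_def inj_on_def by blast
  have lt: "\<phi> a < 5" if "a \<in> N" for a using \<phi>(2) that unfolding N_def by blast
  obtain u where u: "u \<in> e" "u \<in> f" using edges_intersect[OF arr _ ef(1,2)] by auto
  obtain v where v: "e = {u, v}" "v \<noteq> u" using edge_obtain[OF ef(1)] u(1) by (metis insertE insert_commute singletonD)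
  obtain w where w: "f = {u, w}" "w \<noteq> u" using edge_obtain[OF ef(2)] u(2) by (metis insertE insert_commute singletonD)
  have N: "u \<in> N" "v \<in> N" "w \<in> N" "v \<noteq> w" using ef v w unfolding N_def by auto
  \<comment> \<open>\<open>nb1 a j\<close> and \<open>nb2 a j\<close> are the two neighbors of
    \<open>a\<close> in color \<open>j\<close>: at distance 1 on the pentagon for color 0, at
    distance 2 for color 1.\<close>
  define nb1 where "nb1 a j = (a + (if j = 0 then 1 else 2)) mod 5" for a j :: nat
  define nb2 where "nb2 a j = (a + (if j = 0 then 4 else 3)) mod 5" for a j :: nat
  have five: "a \<in> {0, 1, 2, 3, 4}" if "a < 5" for a :: nat using that by auto
  have near: "y = nb1 x (g x y) \<or> y = nb2 x (g x y)" if "x < 5" "y < 5" "x \<noteq> y" for x y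
    using five[OF that(1)] five[OF that(2)] that(3) unfolding nb1_def nb2_def g_def by (elim insertE) simp_all
  have far: "g (nb1 a j) (nb2 a j) \<noteq> j \<and> g (nb2 a j) (nb1 a j) \<noteq> j" if "a < 5" for a j
    using five[OF that] unfolding nb1_def nb2_def g_def by (elim insertE) simp_all
  have star: False if "a < 5" "b < 5" "p < 5" "q < 5" "a \<noteq> b" "a \<noteq> p" "a \<noteq> q" "b \<noteq> p" "b \<noteq> q" "p \<noteq> q"
    "g a b = j" "g a p = j" "g a q = j" for a b p q j
    using near[OF that(1,2,5)] near[OF that(1,3,6)] near[OF that(1,4,7)] that(8-13) by auto
  have triangle: False if "a < 5" "b < 5" "p < 5" "a \<noteq> b" "a \<noteq> p" "b \<noteq> p" "g a b = j" "g a p = j" "g b p = j" for a b p j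
    using near[OF that(1,2,4)] near[OF that(1,3,5)] far[OF that(1), of j] that(6-9) by auto
  have E: "r = e \<or> r = f" if r: "r \<in> E" for r
  proof (rule ccontr)
    assume nr: "\<not> ?thesis"
    show False
    proof (cases "u \<in> r")
      case True
      then obtain x where x: "r = {u, x}" "x \<noteq> u" using edge_obtain[OF r] by (metis insertE insert_commute singletonD)
      then have "x \<in> N" "x \<noteq> v" "x \<noteq> w" using r nr v w unfolding N_def by auto
      then show False
        using star[of "\<phi> u" "\<phi> v" "\<phi> w" "\<phi> x" i] lt ne N v w x col[of u v] col[of u w] col[of u x] ef r by metis
    next
      case False
      then have "v \<in> r" "w \<in> r" using edges_intersect[OF arr _ r ef(1)] edges_intersect[OF arr _ r ef(2)] v w by auto
      moreover obtain a b where "r = {a, b}" by (metis edge_obtain[OF r])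
      ultimately have "r = {v, w}" using N(4) by auto
      then show False
        using triangle[of "\<phi> u" "\<phi> v" "\<phi> w" i] lt ne N v w col[of u v] col[of u w] col[of v w] ef r by metis
    qed
  qed
  interpret P: rainbow_P5_free "{..<5 :: nat}" c by (fact P5)
  have "\<exists>x y z. distinct [x, y, z] \<and> {x, y, z} \<subseteq> {0, 1, 2, 3, 4} \<and> c x y = c x z"
    by (rule P.not_proper_K5) auto
  then obtain x y z where xyz: "distinct [x, y, z]" "{x, y, z} \<subseteq> {0, 1, 2, 3, 4}" "c x y = c x z" by blast
  define \<theta> where "\<theta> a = (if a = u then x else if a = v then y else z)" for a
  have "\<Union>E = {u, v, w}" using E ef v w by blast
  moreover have "inj_on \<theta> {u, v, w}" using xyz(1) v w N unfolding inj_on_def \<theta>_def by auto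
  moreover have "\<theta> a < 5" for a using xyz(2) unfolding \<theta>_def by auto
  moreover have "c (\<theta> a) (\<theta> b) = c x y" if "{a, b} \<in> E" for a b
  proof -
    have "{a, b} = {u, v} \<or> {a, b} = {u, w}" using E[OF that] v w by simp
    moreover have "\<theta> u = x" "\<theta> v = y" "\<theta> w = z" using v w N unfolding \<theta>_def by auto
    ultimately show ?thesis using xyz(3) c[of y x] c[of z x] by (auto simp: doubleton_eq_iff)
  qed
  ultimately have "embeds E 5 c (c x y)" by (intro embedsI[of \<theta>]) auto
  then show ?thesis by blast
qed

end

section \<open>Colorings with a dominant color\<close>

locale dominant_coloring = near_bipartite_graph E K Kc \<sigma> zc xc
  for E K Kc :: "'a set set" and \<sigma> :: "'a \<Rightarrow> bool" and zc xc :: "'a set \<Rightarrow> 'a" +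
  fixes n :: nat and c :: "nat \<Rightarrow> nat \<Rightarrow> 'c" and k :: 'c and l :: "nat \<Rightarrow> 'c"
  assumes arr: "arrows3 E n" and c_commute: "\<And>x y. c x y = c y x"
    and dom: "\<And>x y. \<lbrakk>x < n; y < n; x \<noteq> y\<rbrakk> \<Longrightarrow> c x y = k \<or> (c x y = l x \<and> c x y = l y)"
begin

definition part :: "'c set \<Rightarrow> nat set" where "part L = {x. x < n \<and> l x \<in> L}"

lemma finite_part: "finite (part L)"
  unfolding part_def by auto

lemma cross_part: "\<And>x y. \<lbrakk>x \<in> part L; y \<in> part M; L \<inter> M = {}\<rbrakk> \<Longrightarrow> c x y = k"
  using dom unfolding part_def by fastforce

lemma image_part:
  assumes "inj_on \<phi> (\<Union>E)" "\<And>v. v \<in> N \<Longrightarrow> \<phi> v < n \<and> l (\<phi> v) \<in> L"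
  shows "h \<le> card (part L)"
proof -
  have "\<phi> ` N \<subseteq> part L" using assms(2) unfolding part_def by auto
  then show ?thesis using card_inj_on_le[of \<phi> N "part L"] assms(1) finite_part unfolding h_def N_def by blast
qed

text \<open>Keep \<open>k\<close> as one color and merge all others into two, according to whether
  they occur inside \<open>L\<close> or outside. A copy in a merged color uses several labels in
  general, so of the third outcome only the size is kept.\<close>

lemma recolor:
  obtains j where "embeds E n c j" | "\<exists>\<phi>. inj_on \<phi> (\<Union>E) \<and> (\<forall>v\<in>N. \<phi> v < n \<and> l (\<phi> v) \<in> L) \<and> (\<forall>u v. {u, v} \<in> E \<longrightarrow> c (\<phi> u) (\<phi> v) \<noteq> k)"
  | "h \<le> card (part (- L))"
proof -
  define d :: "nat \<Rightarrow> nat \<Rightarrow> nat" where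
    "d x y = (if c x y = k \<or> (l x \<in> L) \<noteq> (l y \<in> L) then 0 else if l x \<in> L then 1 else 2)" for x y
  obtain i \<phi> where i: "i \<in> {0, 1, 2}" and \<phi>: "inj_on \<phi> (\<Union>E)" "\<And>v. v \<in> \<Union>E \<Longrightarrow> \<phi> v < n"
    and col: "\<And>u v. {u, v} \<in> E \<Longrightarrow> d (\<phi> u) (\<phi> v) = i"
    by (rule arrows3E[OF arr, of d]) (auto simp: d_def c_commute)
  have ne: "\<phi> u \<noteq> \<phi> v" if "{u, v} \<in> E" for u v
    using edge_verts[OF that] \<phi>(1) unfolding N_def inj_on_def by blast
  consider "i = 0" | "i = 1" | "i = 2" using i by blast
  then show ?thesis
  proof cases
    case 1
    have "c (\<phi> u) (\<phi> v) = k" if "{u, v} \<in> E" for u v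
      using col[OF that] 1 dom[of "\<phi> u" "\<phi> v"] ne[OF that] \<phi>(2) edge_verts[OF that]
      unfolding d_def N_def by (auto split: if_splits)
    then show ?thesis using that(1) embedsI[of \<phi> E n c k] \<phi> by blast
  next
    case 2
    have "l (\<phi> u) \<in> L \<and> c (\<phi> u) (\<phi> v) \<noteq> k" if "{u, v} \<in> E" for u v
      using col[OF that] 2 unfolding d_def
      by (cases "c (\<phi> u) (\<phi> v) = k"; cases "l (\<phi> u) \<in> L"; cases "l (\<phi> v) \<in> L"; simp)
    moreover from this have "\<phi> v < n \<and> l (\<phi> v) \<in> L" if "v \<in> N" for v
      using incident_edge[OF that] \<phi>(2) that N_def by blast
    ultimately show ?thesis using \<phi>(1) by (intro that(2) exI[of _ \<phi>]) blast
  next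
    case 3
    have "l (\<phi> u) \<notin> L" if "{u, v} \<in> E" for u v
      using col[OF that] 3 unfolding d_def
      by (cases "c (\<phi> u) (\<phi> v) = k"; cases "l (\<phi> u) \<in> L"; cases "l (\<phi> v) \<in> L"; simp)
    then have "\<phi> v < n \<and> l (\<phi> v) \<in> - L" if "v \<in> N" for v
      using incident_edge[OF that] \<phi>(2) that N_def by blast
    then show ?thesis using that(3) image_part[OF \<phi>(1)] by blast
  qed
qed

lemma large_part:
  assumes "\<And>j. \<not> embeds E n c j"
  shows "h \<le> card (part L) \<or> h \<le> card (part (- L))"
  by (rule recolor[where L = L]) (use assms image_part in blast)+

text \<open>For a single label the merged color inside the class is the color \<open>i\<close>
  itself, so the second outcome of \<open>recolor\<close> would be a monochromatic copy.\<close>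

lemma large_compl_class:
  assumes "\<And>j. \<not> embeds E n c j"
  shows "h \<le> card (part (- {i}))"
proof (rule recolor[where L = "{i}"])
  assume "\<exists>\<phi>. inj_on \<phi> (\<Union>E) \<and> (\<forall>v\<in>N. \<phi> v < n \<and> l (\<phi> v) \<in> {i}) \<and> (\<forall>u v. {u, v} \<in> E \<longrightarrow> c (\<phi> u) (\<phi> v) \<noteq> k)"
  then obtain \<phi> where \<phi>: "inj_on \<phi> (\<Union>E)" "\<And>v. v \<in> N \<Longrightarrow> \<phi> v < n \<and> l (\<phi> v) = i"
    "\<And>u v. {u, v} \<in> E \<Longrightarrow> c (\<phi> u) (\<phi> v) \<noteq> k" by blast
  have "c (\<phi> u) (\<phi> v) = i" if "{u, v} \<in> E" for u v
  proof -
    have "\<phi> u \<noteq> \<phi> v" using edge_verts[OF that] \<phi>(1) unfolding N_def inj_on_def by blast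
    then show ?thesis using dom[of "\<phi> u" "\<phi> v"] \<phi>(2,3) edge_verts[OF that] that by metis
  qed
  then show ?thesis using assms embedsI[of \<phi> E n c i] \<phi> N_def by blast
qed (use assms in auto)

text \<open>It suffices to find disjoint unions of classes with at least \<open>h / 2\<close> and
  \<open>h\<close> vertices. For a minimal \<open>L\<close> with at least \<open>h\<close> vertices
  and \<open>i \<in> L\<close>, either the class of \<open>i\<close> and its complement will do, or
  this class is below \<open>h / 2\<close>. In the latter case \<open>L - {i}\<close> is below
  \<open>h\<close>, so its complement reaches \<open>h\<close>, and the classes outside
  \<open>L\<close> keep at least \<open>h / 2\<close> of it.\<close>

lemma bipartite_case:
  assumes "t = 0"
  shows "\<exists>j. embeds E n c j"
proof (rule ccontr)
  assume "\<not> ?thesis"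
  then have no: "\<And>j. \<not> embeds E n c j" by blast
  have sub: "part L \<subseteq> {..<n}" for L unfolding part_def by auto
  have bip: False if "L \<inter> M = {}" "h \<le> 2 * card (part L)" "h \<le> card (part M)" for L M
  proof -
    have "part L \<inter> part M = {}" using that unfolding part_def by auto
    then have "embeds E n c k"
      using bipartite_embeds[of c "part L" n "part M" k] c_commute assms sub that cross_part by blast
    then show False using no by blast
  qed
  have "h > 0"
  proof (rule ccontr)
    assume "\<not> h > 0"
    then have "\<Union>E = {}" using finite_N' unfolding h_def N_def by simp
    then have "embeds E n c k" by (intro embedsI[of "\<lambda>_. 0"]) (auto simp: inj_on_def)
    then show False using no by blast
  qed
  have part_eq: "{x \<in> {..<n}. l x \<in> M} = part M" for M unfolding part_def by auto
  have hn: "h \<le> card {..<n}" using arrows3_h_le[OF arr] by simp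
  obtain L where L: "L \<noteq> {}" "h \<le> card (part L)" "\<And>i. i \<in> L \<Longrightarrow> card (part (L - {i})) < h"
    by (rule minimal_label_union[OF finite_lessThan hn \<open>h > 0\<close>, of l]) (unfold part_eq, blast)
  obtain i where i: "i \<in> L" using L by blast
  show False
  proof (cases "h \<le> 2 * card (part {i})")
    case True
    then show False using bip[of "{i}" "- {i}"] large_compl_class[OF no] by blast
  next
    case False
    have "h \<le> card (part (- (L - {i})))" using large_part[OF no, of "L - {i}"] L(3)[OF i] by simp
    also have "\<dots> \<le> card (part (- L) \<union> part {i})" using finite_part by (intro card_mono) (auto simp: part_def)
    also have "\<dots> \<le> card (part (- L)) + card (part {i})" by (rule card_Un_le)
    finally have "h \<le> 2 * card (part (- L))" using False by linarith
    then show False using bip[of "- L" L] L(2) by auto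
  qed
qed

text \<open>
  Each side either has \<open>t\<close> disjoint pairs of vertices in different classes or one class with at least
  \<open>2 * t\<close> vertices. In the latter case, keep the other colors only inside these two big classes: an
  embedding into the remaining color yields an edge of it inside a side for every non-bipartite
  component, and an edge outside the big classes can be redirected to an unused vertex of one of them.
\<close>

lemma balanced_case:
  assumes t: "t \<ge> 1" and card: "h \<le> card (part L) + 1" "h \<le> card (part (- L)) + 1"
  shows "\<exists>j. embeds E n c j"
proof (rule ccontr)
  assume "\<not> ?thesis"
  then have no: "\<And>j. \<not> embeds E n c j" by blast
  have sub: "part L \<subseteq> {..<n}" "part (- L) \<subseteq> {..<n}" "part L \<inter> part (- L) = {}" unfolding part_def by auto
  have crossL: "c x y = k" if "x \<in> part L" "y \<in> part (- L)" for x y using cross_part[OF that] by simp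
  have no_matching: False
    if "inj_on \<alpha> Kc" "inj_on \<beta> Kc" "\<alpha> ` Kc \<inter> \<beta> ` Kc = {}"
      "\<And>C. C \<in> Kc \<Longrightarrow> {\<alpha> C, \<beta> C} \<subseteq> part L \<or> {\<alpha> C, \<beta> C} \<subseteq> part (- L)"
      "\<And>C. C \<in> Kc \<Longrightarrow> c (\<alpha> C) (\<beta> C) = k" for \<alpha> \<beta>
    using matching_embeds[OF c_commute t sub crossL card that] no by blast
  have big_class: "\<exists>i\<in>M. 2 * t \<le> card (part {i})" if M: "M = L \<or> M = - L" for M
  proof -
    \<comment> \<open>Non-bipartite components have at least three vertices, so
      \<open>3 * t \<le> h\<close>.\<close>
    have "3 * t \<le> card (part M) + 1" using M card h_ge_3t by fastforce
    from class_or_cross_pairs[OF finite_part this t, of l]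
    show ?thesis
    proof
      assume "\<exists>i. 2 * t \<le> card {x \<in> part M. l x = i}"
      then obtain i where i: "2 * t \<le> card {x \<in> part M. l x = i}" by blast
      then have "{x \<in> part M. l x = i} \<noteq> {}" using t by force
      then have "i \<in> M" unfolding part_def by auto
      moreover have "{x \<in> part M. l x = i} \<subseteq> part {i}" unfolding part_def by auto
      then have "card {x \<in> part M. l x = i} \<le> card (part {i})" by (intro card_mono finite_part)
      ultimately show ?thesis using i by (meson order_trans)
    next
      assume "\<exists>A B. A \<subseteq> part M \<and> B \<subseteq> part M \<and> card A = t \<and> card B = t \<and> (\<forall>a\<in>A. \<forall>b\<in>B. l a \<noteq> l b)"
      then obtain A B where AB: "A \<subseteq> part M" "B \<subseteq> part M" "card A = t" "card B = t" "\<forall>a\<in>A. \<forall>b\<in>B. l a \<noteq> l b" by blast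
      have "finite A" "finite B" using AB finite_part finite_subset by blast+
      then obtain \<alpha> \<beta> where \<alpha>: "bij_betw \<alpha> Kc A" and \<beta>: "bij_betw \<beta> Kc B"
        using finite_same_card_bij[of Kc A] finite_same_card_bij[of Kc B] finite_Kc AB(3,4) unfolding t_def by auto
      have im: "\<alpha> C \<in> A" "\<beta> C \<in> B" if "C \<in> Kc" for C using \<alpha> \<beta> that bij_betwE by metis+
      have "A \<inter> B = {}" using AB(5) by blast
      moreover have "c (\<alpha> C) (\<beta> C) = k" if "C \<in> Kc" for C
        using im[OF that] AB cross_part[of "\<alpha> C" "{l (\<alpha> C)}" "\<beta> C" "{l (\<beta> C)}"] unfolding part_def by blast
      moreover have "{\<alpha> C, \<beta> C} \<subseteq> part L \<or> {\<alpha> C, \<beta> C} \<subseteq> part (- L)" if "C \<in> Kc" for C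
        using im[OF that] AB M by blast
      ultimately show ?thesis using no_matching[of \<alpha> \<beta>] \<alpha> \<beta> unfolding bij_betw_def by blast
    qed
  qed
  obtain i j where i: "i \<in> L" "2 * t \<le> card (part {i})" and j: "j \<in> - L" "2 * t \<le> card (part {j})"
    using big_class[of L] big_class[of "- L"] by auto
  define d :: "nat \<Rightarrow> nat \<Rightarrow> nat" where
    "d x y = (if (l x \<in> L) \<noteq> (l y \<in> L) \<or> c x y = k then 0
      else if l x = i \<and> l y = i then 1 else if l x = j \<and> l y = j then 2 else 0)" for x y
  have d_nz: "c x y \<noteq> k \<and> (l x = i \<and> l y = i \<and> d x y = 1 \<or> l x = j \<and> l y = j \<and> d x y = 2)" if "d x y \<noteq> 0" for x y
    using that unfolding d_def
    by (cases "l x \<in> L"; cases "l y \<in> L"; cases "c x y = k"; cases "l x = i \<and> l y = i"; cases "l x = j \<and> l y = j"; simp)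
  have d_z: "c x y = k \<or> \<not> (l x = i \<and> l y = i) \<and> \<not> (l x = j \<and> l y = j)" if "d x y = 0" "(l x \<in> L) = (l y \<in> L)" for x y
    using that unfolding d_def
    by (cases "l x \<in> L"; cases "l y \<in> L"; cases "c x y = k"; cases "l x = i \<and> l y = i"; cases "l x = j \<and> l y = j"; simp)
  obtain m \<phi> where m: "m \<in> {0, 1, 2}" and \<phi>: "inj_on \<phi> (\<Union>E)" "\<And>v. v \<in> \<Union>E \<Longrightarrow> \<phi> v < n"
    and col: "\<And>u v. {u, v} \<in> E \<Longrightarrow> d (\<phi> u) (\<phi> v) = m"
    by (rule arrows3E[OF arr, of d]) (auto simp: d_def c_commute)
  have ne: "\<phi> u \<noteq> \<phi> v" if "u \<in> N" "v \<in> N" "u \<noteq> v" for u v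
    using that \<phi>(1) unfolding N_def inj_on_def by blast
  have edge: "\<phi> u < n \<and> \<phi> v < n \<and> \<phi> u \<noteq> \<phi> v" if "{u, v} \<in> E" for u v
    using edge_verts[OF that] ne \<phi>(2) N_def by blast
  have m0: "m = 0"
  proof (rule ccontr)
    assume "m \<noteq> 0"
    then have "c (\<phi> u) (\<phi> v) = (if m = 1 then i else j)" if "{u, v} \<in> E" for u v
      using d_nz[of "\<phi> u" "\<phi> v"] col[OF that] dom[of "\<phi> u" "\<phi> v"] edge[OF that] by auto
    then have "embeds E n c (if m = 1 then i else j)" using \<phi> by (intro embedsI[of \<phi>]) auto
    then show False using no by blast
  qed
  have "\<exists>u v. {u, v} \<in> E \<and> {u, v} \<subseteq> C \<and> (l (\<phi> u) \<in> L \<longleftrightarrow> l (\<phi> v) \<in> L) \<and>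
      (c (\<phi> u) (\<phi> v) = k \<or> l (\<phi> u) \<notin> {i, j})" if C: "C \<in> Kc" for C
  proof -
    obtain u v where uv: "{u, v} \<in> E" "{u, v} \<subseteq> C" "(l (\<phi> u) \<in> L) = (l (\<phi> v) \<in> L)"
      using odd[OF C, of "\<lambda>u. l (\<phi> u) \<in> L"] by blast
    have "c (\<phi> u) (\<phi> v) = k \<or> l (\<phi> u) \<notin> {i, j}"
      using d_z[of "\<phi> u" "\<phi> v"] col[OF uv(1)] m0 uv(3) dom[of "\<phi> u" "\<phi> v"] edge[OF uv(1)] by auto
    then show ?thesis using uv by blast
  qed
  then have "\<forall>C. \<exists>p. C \<in> Kc \<longrightarrow> {fst p, snd p} \<in> E \<and> {fst p, snd p} \<subseteq> C \<and> (l (\<phi> (fst p)) \<in> L \<longleftrightarrow> l (\<phi> (snd p)) \<in> L) \<and>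
      (c (\<phi> (fst p)) (\<phi> (snd p)) = k \<or> l (\<phi> (fst p)) \<notin> {i, j})" by (metis fst_conv snd_conv)
  then obtain p where p: "\<And>C. C \<in> Kc \<Longrightarrow> {fst (p C), snd (p C)} \<in> E \<and> {fst (p C), snd (p C)} \<subseteq> C \<and>
      (l (\<phi> (fst (p C))) \<in> L \<longleftrightarrow> l (\<phi> (snd (p C))) \<in> L) \<and>
      (c (\<phi> (fst (p C))) (\<phi> (snd (p C))) = k \<or> l (\<phi> (fst (p C))) \<notin> {i, j})" by metis
  define a where "a C = \<phi> (fst (p C))" for C
  define b where "b C = \<phi> (snd (p C))" for C
  have ab: "a C < n" "b C < n" "a C \<noteq> b C" "l (a C) \<in> L \<longleftrightarrow> l (b C) \<in> L" "c (a C) (b C) = k \<or> l (a C) \<notin> {i, j}"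
    if "C \<in> Kc" for C using p[OF that] edge unfolding a_def b_def by blast+
  have diff: "a C \<noteq> a D \<and> a C \<noteq> b D \<and> b C \<noteq> a D \<and> b C \<noteq> b D" if CD: "C \<in> Kc" "D \<in> Kc" "C \<noteq> D" for C D
  proof -
    have "C \<inter> D = {}" using disjoint_K CD Kc_K by blast
    moreover have "{fst (p C), snd (p C)} \<subseteq> C" "{fst (p D), snd (p D)} \<subseteq> D" using p CD by blast+
    moreover have "C \<subseteq> N" "D \<subseteq> N" using K_subset Kc_K CD by blast+
    ultimately have "\<phi> u \<noteq> \<phi> v" if "u \<in> C" "v \<in> D" for u v using ne[of u v] that by blast
    then show ?thesis
      using \<open>{fst (p C), snd (p C)} \<subseteq> C\<close> \<open>{fst (p D), snd (p D)} \<subseteq> D\<close> unfolding a_def b_def by simp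
  qed
  \<comment> \<open>The components whose chosen edge already has color \<open>k\<close>; for the
    others the end \<open>b C\<close> will be exchanged. \<open>F\<close> is the set of vertices
    occupied by the edges that are kept.\<close>
  define G where "G = {C \<in> Kc. c (a C) (b C) = k}"
  define F where "F = a ` G \<union> b ` G"
  have finG: "finite G" "G \<subseteq> Kc" using finite_Kc unfolding G_def by auto
  have "card F \<le> card G + card G"
    unfolding F_def using card_Un_le card_image_le finG(1) by (metis add_mono order_trans)
  moreover have "card (Kc - G) = t - card G" using finG unfolding t_def by (simp add: card_Diff_subset)
  moreover have "card G \<le> t" unfolding t_def using finG finite_Kc by (intro card_mono)
  ultimately have need: "card (Kc - G) \<le> 2 * t - card F" by simp
  have "finite F" using finG unfolding F_def by auto
  then have room: "card (Kc - G) \<le> card (part {q} - F)" if "2 * t \<le> card (part {q})" for q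
    using diff_card_le_card_Diff[of F "part {q}"] need that by linarith
  have fr: "\<exists>f. inj_on f (Kc - G) \<and> f ` (Kc - G) \<subseteq> part {q} - F" if "2 * t \<le> card (part {q})" for q
    using card_le_inj[OF _ _ room[OF that]] finite_Kc finite_part by auto
  obtain f where f: "inj_on f (Kc - G)" "f ` (Kc - G) \<subseteq> part {i} - F" using fr[OF i(2)] by blast
  obtain g where g: "inj_on g (Kc - G)" "g ` (Kc - G) \<subseteq> part {j} - F" using fr[OF j(2)] by blast
  \<comment> \<open>The new end is taken from the big class on the side of \<open>a C\<close>. As
    \<open>a C\<close> lies in neither big class, the labels differ and the new edge has color
    \<open>k\<close>.\<close>
  define \<beta> where "\<beta> C = (if C \<in> G then b C else if l (a C) \<in> L then f C else g C)" for C
  have fresh: "\<beta> C \<in> part {i, j} - F" "(l (\<beta> C) = i \<longleftrightarrow> l (a C) \<in> L)" "l (a C) \<notin> {i, j}" if "C \<in> Kc - G" for C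
  proof -
    have "f C \<in> part {i} - F" "g C \<in> part {j} - F" using f(2) g(2) that by blast+
    then show "\<beta> C \<in> part {i, j} - F" "(l (\<beta> C) = i \<longleftrightarrow> l (a C) \<in> L)"
      using that i(1) j(1) unfolding \<beta>_def part_def by auto
    show "l (a C) \<notin> {i, j}" using that ab(5)[of C] unfolding G_def by blast
  qed
  have old: "\<beta> C = b C" "a C \<in> F" "b C \<in> F" "c (a C) (b C) = k" if "C \<in> G" for C
    using that unfolding \<beta>_def F_def G_def by auto
  show False
  proof (rule no_matching[of a \<beta>])
    show "inj_on a Kc" using diff by (meson inj_onI)
    show "inj_on \<beta> Kc"
    proof (rule inj_onI, rule ccontr)
      fix C D assume CD: "C \<in> Kc" "D \<in> Kc" "\<beta> C = \<beta> D" "C \<noteq> D"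
      consider "C \<in> G" "D \<in> G" | "C \<in> G" "D \<in> Kc - G" | "C \<in> Kc - G" "D \<in> G" | "C \<in> Kc - G" "D \<in> Kc - G"
        using CD by blast
      then show False
      proof cases
        case 1 then show False using diff[OF CD(1,2,4)] CD(3) old by simp
      next
        case 2 then show False using CD(3) old[of C] fresh(1)[of D] by auto
      next
        case 3 then show False using CD(3) old[of D] fresh(1)[of C] by auto
      next
        case 4
        then have "l (a C) \<in> L \<longleftrightarrow> l (a D) \<in> L" using fresh(2) CD(3) by metis
        then show False using CD 4 f(1) g(1) unfolding \<beta>_def by (auto split: if_splits dest: inj_onD)
      qed
    qed
    show "a ` Kc \<inter> \<beta> ` Kc = {}"
    proof -
      have "a C \<noteq> \<beta> D" if CD: "C \<in> Kc" "D \<in> Kc" for C D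
      proof (cases "D \<in> G")
        case True
        then show ?thesis using diff[OF CD] ab(3)[OF CD(1)] old(1)[OF True] by metis
      next
        case False
        then have D: "\<beta> D \<in> part {i, j} - F" using fresh CD by blast
        show ?thesis
        proof (cases "C \<in> G")
          case True then show ?thesis using D old(2)[OF True] by auto
        next
          case False then show ?thesis using D fresh(3)[of C] CD unfolding part_def by auto
        qed
      qed
      then show ?thesis by blast
    qed
    fix C assume C: "C \<in> Kc"
    show "{a C, \<beta> C} \<subseteq> part L \<or> {a C, \<beta> C} \<subseteq> part (- L)"
    proof (cases "C \<in> G")
      case True
      then show ?thesis using ab[OF C] old(1)[OF True] unfolding part_def by auto
    next
      case False
      then show ?thesis using fresh[of C] C ab(1)[OF C] i(1) j(1) unfolding part_def by auto
    qed
    show "c (a C) (\<beta> C) = k"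
    proof (cases "C \<in> G")
      case True
      then show ?thesis using old by simp
    next
      case False
      then have "\<beta> C \<in> part {i, j}" "a C \<in> part {l (a C)}" "{l (a C)} \<inter> {i, j} = {}"
        using fresh[of C] C ab(1)[OF C] unfolding part_def by auto
      then show ?thesis using cross_part by blast
    qed
  qed
qed

text \<open>For a minimal \<open>L\<close> reaching \<open>h - 1\<close> and
  \<open>i \<in> L\<close>, all three groups are below \<open>h - 1\<close>: \<open>L - {i}\<close>
  by minimality, the classes outside \<open>L\<close> by \<open>balanced_case\<close>, and the class
  of \<open>i\<close> because its complement has at least \<open>h\<close> vertices. Sorted by size,
  they satisfy the assumptions of \<open>tripartite_embeds\<close>.\<close>

theorem embeds_if_dominant: "\<exists>j. embeds E n c j"
proof (rule ccontr)
  assume neg: "\<not> ?thesis"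
  then have no: "\<And>j. \<not> embeds E n c j" by blast
  have t: "t \<ge> 1" using bipartite_case neg by fastforce
  have n: "2 * h + t \<le> n + 2" using arrows3_card_bound[OF arr t] .
  have h3: "h \<ge> 3" using h_ge_3t t by simp
  have bal: "card (part L) + 1 < h \<or> card (part (- L)) + 1 < h" for L
    using balanced_case[OF t, of L] neg not_le by blast
  have part_eq: "{x \<in> {..<n}. l x \<in> M} = part M" for M unfolding part_def by auto
  have hn: "h - 1 \<le> card {..<n}" "0 < h - 1" using n h3 by simp_all
  obtain L where L: "L \<noteq> {}" "h - 1 \<le> card (part L)" "\<And>i. i \<in> L \<Longrightarrow> card (part (L - {i})) < h - 1"
    by (rule minimal_label_union[OF finite_lessThan hn, of l]) (unfold part_eq, blast)
  then obtain i where i: "i \<in> L" by blast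
  define A where "A = part {i}"
  define B where "B = part (L - {i})"
  define D where "D = part (- L)"
  have dis: "A \<inter> B = {}" "A \<inter> D = {}" "B \<inter> D = {}" "B \<inter> A = {}" "D \<inter> A = {}" "D \<inter> B = {}" using i unfolding A_def B_def D_def part_def by auto
  have "A \<union> B \<union> D = {..<n}" using i unfolding A_def B_def D_def part_def by auto
  moreover have "card (A \<union> B \<union> D) = card A + card B + card D"
    using dis finite_part unfolding A_def B_def D_def by (subst card_Un_disjoint; auto simp: card_Un_disjoint Int_Un_distrib2)
  ultimately have sum: "card A + card B + card D = n" by simp
  have cD: "card D + 2 \<le> h" using bal[of L] L(2) h3 unfolding D_def by linarith
  have cB: "card B + 2 \<le> h" using L(3)[OF i] h3 unfolding B_def by linarith
  have cA: "card A + 2 \<le> h" using bal[of "{i}"] large_compl_class[OF no, of i] unfolding A_def by linarith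
  have cross: "\<And>x y. x \<in> A \<Longrightarrow> y \<in> B \<Longrightarrow> c x y = k" "\<And>x y. x \<in> A \<Longrightarrow> y \<in> D \<Longrightarrow> c x y = k"
    "\<And>x y. x \<in> B \<Longrightarrow> y \<in> D \<Longrightarrow> c x y = k"
    using i unfolding A_def B_def D_def by (auto intro: cross_part)
  have cross': "\<And>x y. x \<in> B \<Longrightarrow> y \<in> A \<Longrightarrow> c x y = k" "\<And>x y. x \<in> D \<Longrightarrow> y \<in> A \<Longrightarrow> c x y = k"
    "\<And>x y. x \<in> D \<Longrightarrow> y \<in> B \<Longrightarrow> c x y = k"
    using cross c_commute by metis+
  have s: "4 * card C \<le> n + 3" if "C \<in> Kc" for C using arrows3_critical_bound[OF arr that] .
  have sub: "A \<subseteq> {..<n}" "B \<subseteq> {..<n}" "D \<subseteq> {..<n}" unfolding A_def B_def D_def part_def by auto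
  have tri: False
    if XYZ: "X \<subseteq> {..<n}" "Y \<subseteq> {..<n}" "Z \<subseteq> {..<n}" "X \<inter> Y = {}" "X \<inter> Z = {}" "Y \<inter> Z = {}"
      "\<And>x y. x \<in> X \<Longrightarrow> y \<in> Y \<Longrightarrow> c x y = k" "\<And>x y. x \<in> X \<Longrightarrow> y \<in> Z \<Longrightarrow> c x y = k"
      "\<And>x y. x \<in> Y \<Longrightarrow> y \<in> Z \<Longrightarrow> c x y = k"
      "card X + card Y + card Z = n" "card Y \<le> card X" "card Z \<le> card Y" "card X + 2 \<le> h" for X Y Z
    using tripartite_embeds[of c X n Y Z k, OF c_commute XYZ(1-9) t _ _ XYZ(11-13)] n s XYZ(10) no by simp
  consider "card B \<le> card A" "card D \<le> card B" | "card D \<le> card A" "card B \<le> card D"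
    | "card A \<le> card B" "card D \<le> card A" | "card D \<le> card B" "card A \<le> card D"
    | "card A \<le> card D" "card B \<le> card A" | "card B \<le> card D" "card A \<le> card B" by linarith
  then show False
  proof cases
    case 1 then show False using tri[of A B D] sub dis cross cross' sum cA by auto
  next
    case 2 then show False using tri[of A D B] sub dis cross cross' sum cA by auto
  next
    case 3 then show False using tri[of B A D] sub dis cross cross' sum cB by auto
  next
    case 4 then show False using tri[of B D A] sub dis cross cross' sum cB by auto
  next
    case 5 then show False using tri[of D A B] sub dis cross cross' sum cD by auto
  next
    case 6 then show False using tri[of D B A] sub dis cross cross' sum cD by auto
  qed
qed

end

section \<open>The theorem\<close>

lemma embeds_if_rainbow_P5_free:
  assumes G: "near_bipartite_graph E K Kc \<sigma> zc xc" and arr: "arrows3 E n"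
    and P5: "rainbow_P5_free {..<n} c"
  shows "\<exists>k. embeds E n c k"
proof -
  interpret near_bipartite_graph E K Kc \<sigma> zc xc by (fact G)
  interpret P: rainbow_P5_free "{..<n}" c by (fact P5)
  have c: "c x y = c y x" for x y by (rule P.col_commute)
  consider "n \<le> 4" | "n = 5" | "n \<ge> 6" by linarith
  then show ?thesis
  proof cases
    case 1
    then show ?thesis using embeds_if_le_4[where c = c, OF arr _ c] by blast
  next
    case 2
    then show ?thesis using embeds_if_5[where c = c, OF _ c] arr P5 by blast
  next
    case n: 3
    consider (three) "\<exists>p q r. \<forall>x\<in>{..<n}. \<forall>y\<in>{..<n}. x \<noteq> y \<longrightarrow> c x y \<in> {p, q, r}" | (dom) P.dominant_color
      | (star) P.uniform_off_vertex_and_edge | (four) P.uniform_off_four_vertices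
      using P.rainbow_P5_free_structure n by auto
    then show ?thesis
    proof cases
      case three
      then obtain p q r where "\<forall>x\<in>{..<n}. \<forall>y\<in>{..<n}. x \<noteq> y \<longrightarrow> c x y \<in> {p, q, r}" by (elim exE)
      then have pqr: "x < n \<Longrightarrow> y < n \<Longrightarrow> x \<noteq> y \<Longrightarrow> c x y \<in> {p, q, r}" for x y by simp
      define g :: "nat \<Rightarrow> nat \<Rightarrow> nat" where "g x y = (if c x y = p then 0 else if c x y = q then 1 else 2)" for x y
      have gs: "g x y = g y x" "g x y < 3" for x y unfolding g_def using c[of x y] by auto
      obtain i \<phi> where \<phi>: "inj_on \<phi> (\<Union>E)" "\<And>v. v \<in> \<Union>E \<Longrightarrow> \<phi> v < n"
        and col: "\<And>u v. {u, v} \<in> E \<Longrightarrow> g (\<phi> u) (\<phi> v) = i"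
        by (rule arrows3E[where d = g, OF arr gs]) blast
      have "c (\<phi> u) (\<phi> v) = (if i = 0 then p else if i = 1 then q else r)" if "{u, v} \<in> E" for u v
      proof -
        have "\<phi> u \<noteq> \<phi> v" using \<phi>(1) edge_verts[OF that] unfolding N_def inj_on_def by blast
        moreover have "\<phi> u < n" "\<phi> v < n" using \<phi>(2) edge_verts[OF that] unfolding N_def by blast+
        ultimately have "c (\<phi> u) (\<phi> v) \<in> {p, q, r}" by (intro pqr)
        then show ?thesis using col[OF that] unfolding g_def
          by (cases "c (\<phi> u) (\<phi> v) = p"; cases "c (\<phi> u) (\<phi> v) = q"; simp)
      qed
      then have "embeds E n c (if i = 0 then p else if i = 1 then q else r)" using \<phi> unfolding embeds_def by blast
      then show ?thesis by blast
    next
      case dom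
      then obtain k l where kl: "\<And>x y. x < n \<Longrightarrow> y < n \<Longrightarrow> x \<noteq> y \<Longrightarrow> c x y = k \<or> (c x y = l x \<and> c x y = l y)"
        unfolding P.dominant_color_def by (metis lessThan_iff)
      interpret D: dominant_coloring E K Kc \<sigma> zc xc n c k l
        by unfold_locales (use arr c kl in auto)
      show ?thesis by (rule D.embeds_if_dominant)
    next
      case star
      then obtain a b d k where abd: "distinct [a, b, d]" "{a, b, d} \<subseteq> {..<n}"
        and k: "\<forall>x\<in>{..<n} - {a}. \<forall>y\<in>{..<n} - {a}. x \<noteq> y \<longrightarrow> {x, y} \<noteq> {b, d} \<longrightarrow> c x y = k"
        unfolding P.uniform_off_vertex_and_edge_def by (elim exE conjE)
      show ?thesis
        by (rule embeds_if_uniform_off_vertex_and_edge[OF arr n, where c = c and a = a and b = b and d = d and k = k])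
          (use c abd k in auto)
    next
      case four
      then obtain Q k where Q: "Q \<subseteq> {..<n}" "card Q = 4"
        and k: "\<forall>x\<in>{..<n}. \<forall>y\<in>{..<n}. x \<noteq> y \<longrightarrow> \<not> {x, y} \<subseteq> Q \<longrightarrow> c x y = k"
        unfolding P.uniform_off_four_vertices_def by (elim exE conjE)
      show ?thesis
        by (rule embeds_if_uniform_off_four_vertices[OF arr n, where c = c and Q = Q and k = k]) (use c Q k in auto)
    qed
  qed
qed

section \<open>From the hypothesis on components to near-bipartite graphs\<close>

definition vertex_class :: "'a ugraph \<Rightarrow> 'a \<Rightarrow> 'a set" where
  "vertex_class H v = {w \<in> verts H. reachable H v w}"

lemma simple_graph_edge:
  assumes "simple_graph H" "{u, v} \<in> edges H"
  shows "u \<noteq> v" "u \<in> verts H" "v \<in> verts H"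
  using assms unfolding simple_graph_def by fastforce+

lemma reachable_sym: "reachable H u v \<Longrightarrow> reachable H v u"
proof -
  have "symp (\<lambda>u v. {u, v} \<in> edges H)" by (simp add: symp_def insert_commute)
  then show "reachable H u v \<Longrightarrow> reachable H v u"
    unfolding reachable_def by (meson symp_rtranclp sympD)
qed

lemma reachable_trans: "reachable H u v \<Longrightarrow> reachable H v w \<Longrightarrow> reachable H u w"
  unfolding reachable_def by (rule rtranclp_trans)

lemma reachable_edge: "{u, v} \<in> edges H \<Longrightarrow> reachable H u v"
  unfolding reachable_def by auto

lemma vertex_class_eq:
  assumes "w \<in> vertex_class H v"
  shows "vertex_class H w = vertex_class H v"
proof -
  have "reachable H v w" using assms unfolding vertex_class_def by simp
  then have "reachable H w x \<longleftrightarrow> reachable H v x" for x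
    using reachable_trans[of H v w x] reachable_trans[of H w v x] reachable_sym[of H v w] by blast
  then show ?thesis unfolding vertex_class_def by simp
qed

lemma vertex_class_refl: "v \<in> verts H \<Longrightarrow> v \<in> vertex_class H v"
  unfolding vertex_class_def reachable_def by simp

text \<open>An injective numbering colors a finite loopless graph, so the least number is taken over
  a nonempty set.\<close>

lemma chromatic_number_colorable:
  assumes "finite (verts G)" "\<And>u v. {u, v} \<in> edges G \<Longrightarrow> u \<noteq> v \<and> u \<in> verts G \<and> v \<in> verts G"
  shows "colorable G (chromatic_number G)"
proof -
  obtain f :: "'a \<Rightarrow> nat" where "bij_betw f (verts G) {0..<card (verts G)}"
    using ex_bij_betw_finite_nat[OF assms(1)] by blast
  then have "colorable G (card (verts G))"
    unfolding colorable_def using assms(2)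
    by (intro exI[of _ f]) (auto simp: bij_betw_def inj_on_def)
  then show ?thesis unfolding chromatic_number_def by (rule LeastI)
qed

definition two_colors :: "'a set set \<Rightarrow> 'a set \<Rightarrow> ('a \<Rightarrow> bool) \<Rightarrow> bool" where
  "two_colors E C f \<longleftrightarrow> (\<forall>u v. {u, v} \<in> E \<longrightarrow> {u, v} \<subseteq> C \<longrightarrow> f u \<noteq> f v)"

text \<open>The exceptional edge has both ends in the class \<open>True\<close>, which fixes the
  side that \<open>\<sigma>\<close> will mark.\<close>

definition two_colors_but :: "'a set set \<Rightarrow> 'a set \<Rightarrow> ('a \<Rightarrow> bool) \<Rightarrow> 'a \<Rightarrow> 'a \<Rightarrow> bool" where
  "two_colors_but E C f z x \<longleftrightarrow> {z, x} \<in> E \<and> z \<in> C \<and> x \<in> C \<and> f z \<and> f x \<and>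
    (\<forall>u v. {u, v} \<in> E \<longrightarrow> {u, v} \<subseteq> C \<longrightarrow> f u = f v \<longrightarrow> {u, v} = {z, x})"

lemma bipartite_two_colors:
  assumes "bipartite (induced_subgraph H C)"
  shows "\<exists>f. two_colors (edges H) C f"
proof -
  obtain A B where AB: "A \<inter> B = {}" "\<And>e. e \<in> edges H \<Longrightarrow> e \<subseteq> C \<Longrightarrow> \<exists>a\<in>A. \<exists>b\<in>B. e = {a, b}"
    using assms unfolding bipartite_def induced_subgraph_def by auto
  have "two_colors (edges H) C (\<lambda>v. v \<in> A)"
    unfolding two_colors_def
  proof (intro allI impI)
    fix u v assume "{u, v} \<in> edges H" "{u, v} \<subseteq> C"
    then obtain a b where "a \<in> A" "b \<in> B" "{u, v} = {a, b}" using AB(2) by blast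
    then show "(u \<in> A) \<noteq> (v \<in> A)" using AB(1) by (auto simp: doubleton_eq_iff)
  qed
  then show ?thesis by blast
qed

text \<open>Removing the critical edge leaves a two-coloring. If it separated the ends of that edge,
  it would color all of \<open>C\<close>; so the ends agree, and their color becomes the marked
  one.\<close>

lemma critical_near_two_colors:
  assumes H: "simple_graph H" and C: "C \<subseteq> verts H" and crit: "three_color_critical (induced_subgraph H C)"
    and no: "\<nexists>f. two_colors (edges H) C f"
  shows "\<exists>f z x. two_colors_but (edges H) C f z x"
proof -
  let ?G = "induced_subgraph H C"
  obtain e where e: "e \<in> edges ?G" "chromatic_number (delete_edge ?G e) = 2"
    using crit unfolding three_color_critical_def by blast
  have "finite C" using H C finite_subset unfolding simple_graph_def by blast
  then have "colorable (delete_edge ?G e) (chromatic_number (delete_edge ?G e))"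
    using simple_graph_edge[OF H]
    by (intro chromatic_number_colorable) (auto simp: delete_edge_def induced_subgraph_def)
  then have "colorable (delete_edge ?G e) 2" using e(2) by simp
  then obtain g :: "'a \<Rightarrow> nat" where g: "\<And>v. v \<in> C \<Longrightarrow> g v < 2"
    "\<And>u v. {u, v} \<in> edges H \<Longrightarrow> {u, v} \<subseteq> C \<Longrightarrow> {u, v} \<noteq> e \<Longrightarrow> g u \<noteq> g v"
    unfolding colorable_def delete_edge_def induced_subgraph_def by auto
  have eH: "e \<in> edges H" "e \<subseteq> C" using e(1) unfolding induced_subgraph_def by auto
  then have "card e = 2" using H unfolding simple_graph_def by blast
  then obtain z x where zx: "e = {z, x}" by (auto simp: card_2_iff)
  have proper: "(g u = g z) \<noteq> (g v = g z)" if "{u, v} \<in> edges H" "{u, v} \<subseteq> C" "{u, v} \<noteq> e" for u v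
    using g(2)[OF that] g(1)[of u] g(1)[of v] g(1)[of z] that(2) eH(2) zx by (auto simp: less_2_cases_iff)
  have "g x = g z"
  proof (rule ccontr)
    assume "g x \<noteq> g z"
    then have "two_colors (edges H) C (\<lambda>v. g v = g z)"
      unfolding two_colors_def using proper zx by (metis doubleton_eq_iff)
    then show False using no by blast
  qed
  then have "two_colors_but (edges H) C (\<lambda>v. g v = g z) z x"
    unfolding two_colors_but_def using eH zx proper by auto
  then show ?thesis by blast
qed

text \<open>\<open>Kc\<close> is defined by the absence of a two-coloring, so for its members the
  hypothesis leaves only criticality. On the other components a two-coloring can be negated to make
  the unmarked side the smaller one.\<close>

lemma near_bipartite_decomposition:
  fixes H :: "'a ugraph"
  assumes H: "simple_graph H" and comp: "\<forall>C\<in>components H. three_color_critical C \<or> bipartite C"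
  shows "\<exists>K Kc \<sigma> zc xc. near_bipartite_graph (edges H) K Kc \<sigma> zc xc"
proof -
  let ?E = "edges H"
  define K where "K = vertex_class H ` \<Union>?E"
  define Kc where "Kc = {C \<in> K. \<nexists>f. two_colors ?E C f}"
  have EV: "\<Union>?E \<subseteq> verts H" using H unfolding simple_graph_def by blast
  have finV: "finite (verts H)" using H unfolding simple_graph_def by blast
  have edge_class: "vertex_class H u = vertex_class H v" if "{u, v} \<in> ?E" for u v
    using vertex_class_eq[of v H u] reachable_edge[OF that] simple_graph_edge[OF H that]
    unfolding vertex_class_def by blast
  have class_sub: "vertex_class H v \<subseteq> \<Union>?E" if "v \<in> \<Union>?E" for v
  proof
    fix w assume "w \<in> vertex_class H v"
    then have "reachable H v w" unfolding vertex_class_def by blast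
    then have "v = w \<or> (\<exists>u. {u, w} \<in> ?E)" 
      unfolding reachable_def by (cases rule: rtranclp.cases) auto
    then show "w \<in> \<Union>?E" using that by blast
  qed
  have two: "\<exists>u v. e = {u, v} \<and> u \<noteq> v" if "e \<in> ?E" for e
    using H that unfolding simple_graph_def by (metis card_2_iff)
  have K_sub: "C \<subseteq> verts H" if "C \<in> K" for C using that unfolding K_def vertex_class_def by blast
  have near: "\<exists>f z x. two_colors_but ?E C f z x" if C: "C \<in> Kc" for C
  proof -
    obtain v where v: "v \<in> \<Union>?E" "C = vertex_class H v" using C unfolding Kc_def K_def by blast
    have no: "\<nexists>f. two_colors ?E C f" using C unfolding Kc_def by blast
    have "induced_subgraph H C \<in> components H"
      unfolding components_def v(2) vertex_class_def using v(1) EV by blast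
    then have "three_color_critical (induced_subgraph H C)" using comp bipartite_two_colors no by blast
    then show ?thesis using critical_near_two_colors[OF H K_sub _ no] C unfolding Kc_def by blast
  qed
  have bip: "\<exists>f. two_colors ?E C f \<and> card {v \<in> C. \<not> f v} \<le> card {v \<in> C. f v}" if C: "C \<in> K - Kc" for C
  proof -
    obtain f where f: "two_colors ?E C f" using C unfolding Kc_def by blast
    then have "two_colors ?E C (\<lambda>v. \<not> f v)" unfolding two_colors_def by blast
    moreover have "card {v \<in> C. \<not> f v} \<le> card {v \<in> C. f v} \<or> card {v \<in> C. \<not> \<not> f v} \<le> card {v \<in> C. \<not> f v}" by auto
    ultimately show ?thesis using f by blast
  qed
  obtain F1 zc xc where F1: "\<And>C. C \<in> Kc \<Longrightarrow> two_colors_but ?E C (F1 C) (zc C) (xc C)"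
    using near by metis
  obtain F2 where F2: "\<And>C. C \<in> K - Kc \<Longrightarrow> two_colors ?E C (F2 C) \<and> card {v \<in> C. \<not> F2 C v} \<le> card {v \<in> C. F2 C v}"
    using bip by metis
  define F where "F C = (if C \<in> Kc then F1 C else F2 C)" for C
  have zx: "two_colors_but ?E C (F C) (zc C) (xc C)" if "C \<in> Kc" for C using F1 that unfolding F_def by simp
  have bf: "two_colors ?E C (F C) \<and> card {v \<in> C. \<not> F C v} \<le> card {v \<in> C. F C v}" if "C \<in> K - Kc" for C
    using F2 that unfolding F_def by simp
  define \<sigma> where "\<sigma> v = F (vertex_class H v) v" for v
  have \<sigma>: "\<sigma> v = F C v" if "C \<in> K" "v \<in> C" for C v
    using that vertex_class_eq unfolding \<sigma>_def K_def by fastforce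
  have edge_K: "\<exists>C\<in>K. {u, v} \<subseteq> C" if "{u, v} \<in> ?E" for u v
  proof
    show "vertex_class H u \<in> K" unfolding K_def using that by blast
    show "{u, v} \<subseteq> vertex_class H u"
      using edge_class[OF that] vertex_class_refl[of u H] vertex_class_refl[of v H] simple_graph_edge[OF H that] by auto
  qed
  have "near_bipartite_graph ?E K Kc \<sigma> zc xc"
  proof
    show "finite (\<Union>?E)" using EV finV finite_subset by blast
    show "card e = 2" if "e \<in> ?E" for e using H that unfolding simple_graph_def by blast
    show "\<Union>K = \<Union>?E"
    proof
      show "\<Union>K \<subseteq> \<Union>?E" unfolding K_def using class_sub by blast
      show "\<Union>?E \<subseteq> \<Union>K"
      proof
        fix v assume v: "v \<in> \<Union>?E"
        then have "v \<in> vertex_class H v" "vertex_class H v \<in> K" 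
          using vertex_class_refl[of v H] EV unfolding K_def by blast+
        then show "v \<in> \<Union>K" by blast
      qed
    qed
    show "C \<inter> D = {}" if CD: "C \<in> K" "D \<in> K" "C \<noteq> D" for C D
    proof -
      obtain a b where "C = vertex_class H a" "D = vertex_class H b" using CD(1,2) unfolding K_def by blast
      then show ?thesis using vertex_class_eq[of _ H a] vertex_class_eq[of _ H b] CD(3) by blast
    qed
    show "\<exists>C\<in>K. e \<subseteq> C" if "e \<in> ?E" for e using two[OF that] edge_K that by blast
    show "Kc \<subseteq> K" unfolding Kc_def by blast
    show "\<sigma> u \<noteq> \<sigma> v \<or> (\<exists>C\<in>Kc. {u, v} = {zc C, xc C})" if uv: "{u, v} \<in> ?E" for u v
    proof -
      obtain C where C: "C \<in> K" "{u, v} \<subseteq> C" using edge_K[OF uv] by blast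
      then have s: "\<sigma> u = F C u" "\<sigma> v = F C v" using \<sigma> by auto
      show ?thesis
      proof (cases "C \<in> Kc")
        case True
        then show ?thesis using zx[OF True] uv C(2) s True unfolding two_colors_but_def by blast
      next
        case False
        then show ?thesis using bf[of C] C uv s unfolding two_colors_def by blast
      qed
    qed
    show "zc C \<in> C \<and> xc C \<in> C \<and> zc C \<noteq> xc C \<and> \<sigma> (zc C) \<and> \<sigma> (xc C)"
      if "C \<in> Kc" for C
    proof -
      have "C \<in> K" using that unfolding Kc_def by blast
      then show ?thesis using zx[OF that] \<sigma>[of C] simple_graph_edge(1)[OF H, of "zc C" "xc C"]
        unfolding two_colors_but_def by auto
    qed
    show "\<exists>u v. {u, v} \<in> ?E \<and> {u, v} \<subseteq> C \<and> f u = f v" if "C \<in> Kc" for C and f :: "'a \<Rightarrow> bool"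
    proof -
      have "\<not> two_colors ?E C f" using that unfolding Kc_def by blast
      then show ?thesis unfolding two_colors_def by blast
    qed
    show "g u = g v" if C: "C \<in> Kc" and g: "\<And>u v. {u, v} \<in> ?E \<Longrightarrow> {u, v} \<subseteq> C \<Longrightarrow> g u = g v" and uv: "u \<in> C" "v \<in> C"
      for C u v and g :: "'a \<Rightarrow> nat"
    proof -
      obtain r where r: "C = vertex_class H r" using C unfolding Kc_def K_def by blast
      have "g w = g r" if "reachable H r w" for w
        using that unfolding reachable_def
      proof (induction rule: rtranclp_induct)
        case (step a b)
        have "reachable H r a" "reachable H r b"
          using step.hyps unfolding reachable_def by (auto intro: rtranclp.rtrancl_into_rtrancl)
        then have "{a, b} \<subseteq> C" unfolding r vertex_class_def using simple_graph_edge[OF H step.hyps(2)] by blast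
        then show ?case using g[OF step.hyps(2)] step.IH by simp
      qed simp
      then show ?thesis using uv unfolding r vertex_class_def by simp
    qed
    show "card {v \<in> C. \<not> \<sigma> v} \<le> card {v \<in> C. \<sigma> v}" if C: "C \<in> K - Kc" for C
    proof -
      have "{v \<in> C. \<not> \<sigma> v} = {v \<in> C. \<not> F C v}" "{v \<in> C. \<sigma> v} = {v \<in> C. F C v}" using \<sigma> C by auto
      then show ?thesis using bf[OF C] by simp
    qed
  qed
  then show ?thesis by blast
qed

section \<open>Translation between copies of graphs and embeddings\<close>

lemma mono_copy_iff:
  fixes H :: "'a ugraph"
  assumes H: "simple_graph H"
  shows "(\<exists>F. is_copy_in F H (complete_graph n) \<and> monochromatic c F) \<longleftrightarrow>
    card (verts H) \<le> n \<and> (\<exists>k. embeds (edges H) n (\<lambda>x y. c {x, y}) k)"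
proof
  assume "\<exists>F. is_copy_in F H (complete_graph n) \<and> monochromatic c F"
  then obtain F \<phi> where \<phi>: "inj_on \<phi> (verts H)" "verts F = \<phi> ` verts H" "edges F = (\<lambda>e. \<phi> ` e) ` edges H"
    and sub: "verts F \<subseteq> {..<n}" and mono: "monochromatic c F"
    unfolding is_copy_in_def complete_graph_def by auto
  have card: "card (verts H) \<le> n" using card_inj_on_le[OF \<phi>(1), of "{..<n}"] \<phi>(2) sub by simp
  have "\<exists>k. \<forall>e\<in>edges F. c e = k" using mono unfolding monochromatic_def by blast
  then obtain k where k: "\<And>e. e \<in> edges F \<Longrightarrow> c e = k" by blast
  have EV: "\<Union>(edges H) \<subseteq> verts H" using H unfolding simple_graph_def by blast
  have "c {\<phi> u, \<phi> v} = k" if "{u, v} \<in> edges H" for u v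
    using k[of "\<phi> ` {u, v}"] imageI[OF that, of "\<lambda>e. \<phi> ` e"] \<phi>(3) by simp
  moreover have "inj_on \<phi> (\<Union>(edges H))" "\<phi> ` \<Union>(edges H) \<subseteq> {..<n}"
    using inj_on_subset[OF \<phi>(1) EV] \<phi>(2) sub EV by blast+
  ultimately have "embeds (edges H) n (\<lambda>x y. c {x, y}) k" unfolding embeds_def by blast
  then show "card (verts H) \<le> n \<and> (\<exists>k. embeds (edges H) n (\<lambda>x y. c {x, y}) k)" using card by blast
next
  assume "card (verts H) \<le> n \<and> (\<exists>k. embeds (edges H) n (\<lambda>x y. c {x, y}) k)"
  then obtain k \<phi>0 where n: "card (verts H) \<le> n" and \<phi>0: "inj_on \<phi>0 (\<Union>(edges H))" "\<phi>0 ` \<Union>(edges H) \<subseteq> {..<n}"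
    "\<And>u v. {u, v} \<in> edges H \<Longrightarrow> c {\<phi>0 u, \<phi>0 v} = k" unfolding embeds_def by blast
  have EV: "\<Union>(edges H) \<subseteq> verts H" and fin: "finite (verts H)" using H unfolding simple_graph_def by blast+
  \<comment> \<open>Isolated vertices are added to the embedding; a single class with target
    \<open>{..<n}\<close> is enough.\<close>
  have "\<exists>\<phi>. inj_on \<phi> (verts H) \<and> (\<forall>v\<in>verts H. \<phi> v \<in> {..<n}) \<and> (\<forall>v\<in>\<Union>(edges H). \<phi> v = \<phi>0 v)"
    using fin EV \<phi>0(1,2) n
    by (intro extend_injection[where S = "\<lambda>_. {..<n}" and \<kappa> = "\<lambda>_. ()"]) auto
  then obtain \<phi> where \<phi>: "inj_on \<phi> (verts H)" "\<And>v. v \<in> verts H \<Longrightarrow> \<phi> v < n" "\<And>v. v \<in> \<Union>(edges H) \<Longrightarrow> \<phi> v = \<phi>0 v" by auto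
  define F where "F = (\<phi> ` verts H, (\<lambda>e. \<phi> ` e) ` edges H)"
  have sub: "\<phi> ` e \<subseteq> {..<n} \<and> card (\<phi> ` e) = 2 \<and> c (\<phi> ` e) = k" if e: "e \<in> edges H" for e
  proof -
    have eV: "e \<subseteq> verts H" "card e = 2" using H e unfolding simple_graph_def by blast+
    obtain u v where uv: "e = {u, v}" using eV(2) by (auto simp: card_2_iff)
    have "card (\<phi> ` e) = 2" using card_image[OF inj_on_subset[OF \<phi>(1) eV(1)]] eV(2) by simp
    moreover have "\<phi> u = \<phi>0 u" "\<phi> v = \<phi>0 v" using \<phi>(3) e uv by blast+
    then have "\<phi> ` e = {\<phi>0 u, \<phi>0 v}" using uv by simp
    then have "c (\<phi> ` e) = k" using \<phi>0(3)[of u v] e uv by simp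
    moreover have "\<phi> ` e \<subseteq> {..<n}" using \<phi>(2) eV(1) by blast
    ultimately show ?thesis by blast
  qed
  have "edges F \<subseteq> {e. e \<subseteq> {..<n} \<and> card e = 2}" unfolding F_def snd_conv using sub by blast
  then have "is_copy_in F H (complete_graph n)"
    unfolding is_copy_in_def complete_graph_def using \<phi>(1,2) unfolding F_def by auto
  moreover have "monochromatic c F" unfolding monochromatic_def F_def using sub by auto
  ultimately show "\<exists>F. is_copy_in F H (complete_graph n) \<and> monochromatic c F" by blast
qed

lemma path_graph_5_edges: "edges (path_graph 5) = {{0, 1}, {1, 2}, {2, 3}, {3, 4}}"
proof -
  have "Suc i < 5 \<longleftrightarrow> i \<in> {0, 1, 2, 3}" for i by auto
  then have "edges (path_graph 5) = {{i, Suc i} |i. i \<in> {0, 1, 2, 3}}" unfolding path_graph_def snd_conv by simp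
  also have "\<dots> = (\<lambda>i. {i, Suc i}) ` {0, 1, 2, 3}" by (rule Setcompr_eq_image)
  also have "\<dots> = {{0, 1}, {1, 2}, {2, 3}, {3, 4}}" by (simp add: eval_nat_numeral)
  finally show ?thesis .
qed

lemma rainbow_copy_P5:
  assumes "distinct [v, w, x, y, z]" "{v, w, x, y, z} \<subseteq> {..<n}"
    and "distinct [c {v, w}, c {w, x}, c {x, y}, c {y, z}]"
  shows "\<exists>F. is_copy_in F (path_graph 5) (complete_graph n) \<and> rainbow c F"
proof -
  define \<phi> where "\<phi> = (\<lambda>i. [v, w, x, y, z] ! i)"
  have \<phi>: "\<phi> 0 = v" "\<phi> 1 = w" "\<phi> 2 = x" "\<phi> 3 = y" "\<phi> 4 = z" unfolding \<phi>_def by (simp_all add: eval_nat_numeral)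
  have verts: "verts (path_graph 5) = {0, 1, 2, 3, 4}" unfolding path_graph_def by (auto simp: eval_nat_numeral less_Suc_eq)
  define F where "F = (\<phi> ` verts (path_graph 5), (\<lambda>e. \<phi> ` e) ` edges (path_graph 5))"
  have edgesF: "edges F = {{v, w}, {w, x}, {x, y}, {y, z}}"
    unfolding F_def path_graph_5_edges using \<phi> by simp
  have vertsF: "verts F = {v, w, x, y, z}" unfolding F_def verts using \<phi> by simp
  have "inj_on \<phi> (verts (path_graph 5))"
    using distinct_map[of \<phi> "[0, 1, 2, 3, 4]"] \<phi> assms(1) unfolding verts by simp
  then have "\<exists>\<phi>. inj_on \<phi> (verts (path_graph 5)) \<and> verts F = \<phi> ` verts (path_graph 5) \<and>
      edges F = (\<lambda>e. \<phi> ` e) ` edges (path_graph 5)"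
    by (intro exI[of _ \<phi>]) (simp add: F_def)
  moreover have "verts F \<subseteq> verts (complete_graph n)" using vertsF assms(2) unfolding complete_graph_def by simp
  moreover have "edges F \<subseteq> edges (complete_graph n)"
    unfolding edgesF complete_graph_def using assms(1,2) by simp
  ultimately have "is_copy_in F (path_graph 5) (complete_graph n)" unfolding is_copy_in_def by blast
  moreover have "inj_on c (set [{v, w}, {w, x}, {x, y}, {y, z}])"
    using assms(3) by (intro distinct_map[THEN iffD1, THEN conjunct2]) (simp only: list.map)
  then have "rainbow c F" unfolding rainbow_def edgesF by (simp only: list.set)
  ultimately show ?thesis by blast
qed

text \<open>A copy of the path still has four edges, one more than there are colors.\<close>

lemma no_rainbow_P5_three_colors:
  fixes c :: "nat set \<Rightarrow> nat"
  assumes c: "c ` edges (complete_graph n) \<subseteq> {1, 2, 3}" and F: "is_copy_in F (path_graph 5) (complete_graph n)"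
  shows "\<not> rainbow c F"
proof
  assume r: "rainbow c F"
  obtain \<phi> where \<phi>: "inj_on \<phi> (verts (path_graph 5))" "edges F = (\<lambda>e. \<phi> ` e) ` edges (path_graph 5)"
    and sub: "edges F \<subseteq> edges (complete_graph n)" using F unfolding is_copy_in_def by blast
  have P: "card (edges (path_graph 5)) = 4" unfolding path_graph_5_edges by (simp add: doubleton_eq_iff)
  have "\<forall>e\<in>edges (path_graph 5). e \<subseteq> verts (path_graph 5)" unfolding path_graph_def by auto
  then have "inj_on (\<lambda>e. \<phi> ` e) (edges (path_graph 5))"
    using inj_on_image_eq_iff[OF \<phi>(1)] by (intro inj_onI) simp
  then have "card (edges F) = 4" using \<phi>(2) P card_image by metis
  then have "card (c ` edges F) = 4" using r card_image unfolding rainbow_def by metis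
  moreover have "card (c ` edges F) \<le> card {1, 2, 3 :: nat}" using c sub by (intro card_mono) auto
  ultimately show False by simp
qed

lemma arrows3_if_ramsey:
  fixes H :: "'a ugraph"
  assumes H: "simple_graph H"
    and R: "\<forall>c :: nat set \<Rightarrow> nat. c ` edges (complete_graph n) \<subseteq> {1, 2, 3} \<longrightarrow>
      (\<exists>F. is_copy_in F H (complete_graph n) \<and> monochromatic c F)"
  shows "card (verts H) \<le> n" "arrows3 (edges H) n"
proof -
  have "(\<lambda>_. 1) ` edges (complete_graph n) \<subseteq> {1, 2, 3 :: nat}" by auto
  then show "card (verts H) \<le> n" using R mono_copy_iff[OF H] by blast
  show "arrows3 (edges H) n" unfolding arrows3_def
  proof (intro allI impI)
    fix d :: "nat \<Rightarrow> nat \<Rightarrow> nat" assume sym: "\<forall>x y. d x y = d y x" and lt: "\<forall>x y. d x y < 3"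
    \<comment> \<open>\<open>Min\<close> and \<open>Max\<close> recover the two ends of an edge, and
      their order is irrelevant by symmetry; adding 1 passes from the colors 0, 1, 2 to 1, 2,
      3.\<close>
    define c where "c e = d (Min e) (Max e) + 1" for e
    have cd: "c {x, y} = d x y + 1" for x y
      unfolding c_def using sym by (simp add: min_def max_def)
    have "c e \<in> {1, 2, 3}" for e
    proof -
      have "d (Min e) (Max e) \<in> {0, 1, 2}" using lt[rule_format, of "Min e" "Max e"] by auto
      then show ?thesis unfolding c_def by auto
    qed
    then have "\<exists>F. is_copy_in F H (complete_graph n) \<and> monochromatic c F" using R by blast
    then obtain k \<phi> where \<phi>: "inj_on \<phi> (\<Union>(edges H))" "\<phi> ` \<Union>(edges H) \<subseteq> {..<n}"
      "\<forall>u v. {u, v} \<in> edges H \<longrightarrow> c {\<phi> u, \<phi> v} = k"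
      unfolding mono_copy_iff[OF H] embeds_def by blast
    have eq: "d (\<phi> u) (\<phi> v) = k - 1" if "{u, v} \<in> edges H" for u v
      using \<phi>(3) that cd[of "\<phi> u" "\<phi> v"] by auto
    show "\<exists>k<3. embeds (edges H) n d k"
    \<comment> \<open>Without edges nothing bounds \<open>k\<close>, and color 0 is taken
      instead.\<close>
    proof (cases "\<exists>u v. {u, v} \<in> edges H")
      case True
      then have "k - 1 < 3" using eq lt by metis
      moreover have "embeds (edges H) n d (k - 1)" using \<phi>(1,2) eq unfolding embeds_def by blast
      ultimately show ?thesis by blast
    next
      case False
      then have "embeds (edges H) n d 0" using \<phi>(1,2) unfolding embeds_def by blast
      then show ?thesis by (intro exI[of _ 0]) simp
    qed
  qed
qed

theorem theorem1p10:
  fixes H :: "'a ugraph"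
  assumes "simple_graph H"
    and "\<forall>C\<in>components H. three_color_critical C \<or> bipartite C"
  shows "mono_rainbow_number H (path_graph 5) = ramsey3 H"
proof -
  \<comment> \<open>The two conditions agree for every single \<open>n\<close>, so both infima are
    over the same set, whether or not it is empty.\<close>
  have "(\<forall>c :: nat set \<Rightarrow> nat. (\<exists>F. is_copy_in F H (complete_graph n) \<and> monochromatic c F) \<or>
      (\<exists>F. is_copy_in F (path_graph 5) (complete_graph n) \<and> rainbow c F)) \<longleftrightarrow>
    (\<forall>c :: nat set \<Rightarrow> nat. c ` edges (complete_graph n) \<subseteq> {1, 2, 3} \<longrightarrow>
      (\<exists>F. is_copy_in F H (complete_graph n) \<and> monochromatic c F))" (is "?L \<longleftrightarrow> ?R") for n
  proof
    assume ?L
    then show ?R using no_rainbow_P5_three_colors by blast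
  next
    assume R: ?R
    obtain K Kc \<sigma> zc xc where G: "near_bipartite_graph (edges H) K Kc \<sigma> zc xc"
      using near_bipartite_decomposition[OF assms] by blast
    show ?L
    proof (intro allI disjCI)
      fix c :: "nat set \<Rightarrow> nat"
      assume no: "\<nexists>F. is_copy_in F (path_graph 5) (complete_graph n) \<and> rainbow c F"
      have "rainbow_P5_free {..<n} (\<lambda>x y. c {x, y})"
      proof
        show "c {x, y} = c {y, x}" for x y by (simp add: insert_commute)
        show "\<not> distinct [c {v, w}, c {w, x}, c {x, y}, c {y, z}]"
          if "distinct [v, w, x, y, z]" "{v, w, x, y, z} \<subseteq> {..<n}" for v w x y z
          using rainbow_copy_P5[OF that] no by blast
      qed
      then have "\<exists>k. embeds (edges H) n (\<lambda>x y. c {x, y}) k"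
        using embeds_if_rainbow_P5_free[OF G arrows3_if_ramsey(2)[OF assms(1) R]] by blast
      then show "\<exists>F. is_copy_in F H (complete_graph n) \<and> monochromatic c F"
        using mono_copy_iff[OF assms(1)] arrows3_if_ramsey(1)[OF assms(1) R] by blast
    qed
  qed
  then show ?thesis unfolding mono_rainbow_number_def ramsey3_def by simp
qed

end
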